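(* Let $G$ be an FC-hypercentral (discrete) group and let $\sigma\in Z^2(G,\mathbb{T})$. Then the following are equivalent: (i) $(G,\sigma)$ satisfies Kleppner's condition; (ii) $C_r^*(G,\sigma)$ is simple; (iii) $C_r^*(G,\sigma)$ has a unique tracial state.
   Context: $Z^2(G,\mathbb{T})$ denotes the set of normalized two-cocycles $\sigma\colon G\times G\to\mathbb{T}$: $\sigma(g,h)\sigma(gh,k)=\sigma(h,k)\sigma(g,hk)$ and $\sigma(g,e)=\sigma(e,g)=1$. The left regular $\sigma$-projective representation on $\ell^2(G)$ is $(\lambda_\sigma(g)\xi)(h)=\sigma(g,g^{-1}h)\xi(g^{-1}h)$, and $C_r^*(G,\sigma)$ is the C$^*$-algebra it generates. An element $g\in G$ is $\sigma$-regular if $\sigma(g,h)=\sigma(h,g)$ for every $h\in G$ commuting with $g$; this property is invariant under conjugation. $(G,\sigma)$ satisfies Kleppner's condition if every nontrivial conjugacy class consisting of $\sigma$-regular elements is infinite. The FC-center $FC(G)$ is the subgroup of elements with finite conjugacy class; the upper FC-central series is $F_0=\{e\}$, $F_{\beta+1}/F_\beta=FC(G/F_\beta)$, $F_\alpha=\bigcup_{\beta<\alpha}F_\beta$ for limit $\alpha$; $FCH(G)=\bigcup_\alpha F_\alpha$, and $G$ is FC-hypercentral if $FCH(G)=G$. *)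

theory Defs
  imports "HOL-Analysis.Analysis"
begin

text \<open>The discrete group G is a type of class group_add (written additively:
  product = +, identity = 0, inverse = uminus; NOT assumed commutative).\<close>

definition two_cocycle :: "('g::group_add \<Rightarrow> 'g \<Rightarrow> complex) \<Rightarrow> bool" where
  "two_cocycle \<sigma> \<longleftrightarrow>
     (\<forall>g h. cmod (\<sigma> g h) = 1) \<and>
     (\<forall>g h k. \<sigma> g h * \<sigma> (g + h) k = \<sigma> h k * \<sigma> g (h + k)) \<and>
     (\<forall>g. \<sigma> g 0 = 1 \<and> \<sigma> 0 g = 1)"

definition conj_class :: "'g::group_add \<Rightarrow> 'g set" where
  "conj_class g = {h + g - h | h. True}"

definition sigma_regular :: "('g::group_add \<Rightarrow> 'g \<Rightarrow> complex) \<Rightarrow> 'g \<Rightarrow> bool" where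
  "sigma_regular \<sigma> g \<longleftrightarrow> (\<forall>h. g + h = h + g \<longrightarrow> \<sigma> g h = \<sigma> h g)"

definition kleppner :: "('g::group_add \<Rightarrow> 'g \<Rightarrow> complex) \<Rightarrow> bool" where
  "kleppner \<sigma> \<longleftrightarrow>
     (\<forall>g. g \<noteq> 0 \<and> (\<forall>x\<in>conj_class g. sigma_regular \<sigma> x) \<longrightarrow> infinite (conj_class g))"

definition lcoset :: "'g::group_add \<Rightarrow> 'g set \<Rightarrow> 'g set" where
  "lcoset x N = (\<lambda>n. x + n) ` N"

text \<open>For a normal subgroup N, fc_next N is the preimage in G of FC(G/N):
  the elements whose conjugacy class in G/N is finite.\<close>
definition fc_next :: "'g::group_add set \<Rightarrow> 'g set" where
  "fc_next N = {g. finite ((\<lambda>h. lcoset (h + g - h) N) ` UNIV)}"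

text \<open>The terms F_alpha of the upper FC-central series (transfinite recursion):
  F_0 = {e}, successor step via fc_next, unions at limit stages.\<close>
inductive fc_stage :: "'g::group_add set \<Rightarrow> bool" where
  zero: "fc_stage {0}"
| succ: "fc_stage N \<Longrightarrow> fc_stage (fc_next N)"
| lim: "S \<noteq> {} \<Longrightarrow> Complete_Partial_Order.chain (\<subseteq>) S \<Longrightarrow> (\<forall>N\<in>S. fc_stage N)
          \<Longrightarrow> fc_stage (\<Union>S)"

definition FCH :: "'g::group_add set" where
  "FCH = \<Union>{N. fc_stage N}"

definition FC_hypercentral :: "'g::group_add itself \<Rightarrow> bool" where
  "FC_hypercentral _ \<longleftrightarrow> (FCH :: 'g set) = UNIV"

type_synonym 'g vec = "'g \<Rightarrow> complex"
type_synonym 'g opr = "'g vec \<Rightarrow> 'g vec"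

definition ell2 :: "'g vec set" where
  "ell2 = {f. (\<lambda>x. (cmod (f x))\<^sup>2) summable_on UNIV}"

definition l2norm :: "'g vec \<Rightarrow> real" where
  "l2norm f = sqrt (\<Sum>\<^sub>\<infinity>x. (cmod (f x))\<^sup>2)"

definition l2inner :: "'g vec \<Rightarrow> 'g vec \<Rightarrow> complex" where
  "l2inner f h = (\<Sum>\<^sub>\<infinity>x. cnj (f x) * h x)"

text \<open>Bounded linear operators on l2(G), represented as functions on all of
  'g vec that vanish outside l2(G) (so that equality of operators is extensional).\<close>
definition bounded_op :: "'g opr \<Rightarrow> bool" where
  "bounded_op T \<longleftrightarrow>
     (\<forall>f\<in>ell2. T f \<in> ell2) \<and>
     (\<forall>f\<in>ell2. \<forall>h\<in>ell2. T (\<lambda>x. f x + h x) = (\<lambda>x. T f x + T h x)) \<and>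
     (\<forall>f\<in>ell2. \<forall>c. T (\<lambda>x. c * f x) = (\<lambda>x. c * T f x)) \<and>
     (\<exists>K. \<forall>f\<in>ell2. l2norm (T f) \<le> K * l2norm f) \<and>
     (\<forall>f. f \<notin> ell2 \<longrightarrow> T f = (\<lambda>x. 0))"

definition opnorm :: "'g opr \<Rightarrow> real" where
  "opnorm T = Sup {l2norm (T f) | f. f \<in> ell2 \<and> l2norm f \<le> 1}"

definition op_zero :: "'g opr" where
  "op_zero = (\<lambda>f x. 0)"

definition op_add :: "'g opr \<Rightarrow> 'g opr \<Rightarrow> 'g opr" where
  "op_add S T = (\<lambda>f x. S f x + T f x)"

definition op_scale :: "complex \<Rightarrow> 'g opr \<Rightarrow> 'g opr" where
  "op_scale c T = (\<lambda>f x. c * T f x)"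

definition op_mult :: "'g opr \<Rightarrow> 'g opr \<Rightarrow> 'g opr" where
  "op_mult S T = S \<circ> T"

definition adjoint :: "'g opr \<Rightarrow> 'g opr" where
  "adjoint T = (\<lambda>f. if f \<in> ell2
      then (THE u. u \<in> ell2 \<and> (\<forall>h\<in>ell2. l2inner u h = l2inner f (T h)))
      else (\<lambda>x. 0))"

definition lambda_sigma :: "('g::group_add \<Rightarrow> 'g \<Rightarrow> complex) \<Rightarrow> 'g \<Rightarrow> 'g opr" where
  "lambda_sigma \<sigma> g = (\<lambda>\<xi>. if \<xi> \<in> ell2 then (\<lambda>h. \<sigma> g (- g + h) * \<xi> (- g + h)) else (\<lambda>x. 0))"

inductive_set reduced_twisted :: "('g::group_add \<Rightarrow> 'g \<Rightarrow> complex) \<Rightarrow> 'g opr set"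
  for \<sigma> where
  gen: "lambda_sigma \<sigma> g \<in> reduced_twisted \<sigma>"
| add: "a \<in> reduced_twisted \<sigma> \<Longrightarrow> b \<in> reduced_twisted \<sigma> \<Longrightarrow> op_add a b \<in> reduced_twisted \<sigma>"
| scale: "a \<in> reduced_twisted \<sigma> \<Longrightarrow> op_scale c a \<in> reduced_twisted \<sigma>"
| mult: "a \<in> reduced_twisted \<sigma> \<Longrightarrow> b \<in> reduced_twisted \<sigma> \<Longrightarrow> op_mult a b \<in> reduced_twisted \<sigma>"
| adj: "a \<in> reduced_twisted \<sigma> \<Longrightarrow> adjoint a \<in> reduced_twisted \<sigma>"
| lim: "(\<forall>n. s n \<in> reduced_twisted \<sigma>) \<Longrightarrow> bounded_op T \<Longrightarrow>
        (\<lambda>n. opnorm (op_add (s n) (op_scale (-1) T))) \<longlonglongrightarrow> 0 \<Longrightarrow> T \<in> reduced_twisted \<sigma>"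

definition closed_ideal :: "'g opr set \<Rightarrow> 'g opr set \<Rightarrow> bool" where
  "closed_ideal A I \<longleftrightarrow>
     I \<subseteq> A \<and> op_zero \<in> I \<and>
     (\<forall>x\<in>I. \<forall>y\<in>I. op_add x y \<in> I) \<and>
     (\<forall>x\<in>I. \<forall>c. op_scale c x \<in> I) \<and>
     (\<forall>a\<in>A. \<forall>x\<in>I. op_mult a x \<in> I \<and> op_mult x a \<in> I) \<and>
     (\<forall>s T. (\<forall>n. s n \<in> I) \<and> T \<in> A \<and>
        (\<lambda>n. opnorm (op_add (s n) (op_scale (-1) T))) \<longlonglongrightarrow> 0 \<longrightarrow> T \<in> I)"

definition simple_alg :: "'g opr set \<Rightarrow> bool" where
  "simple_alg A \<longleftrightarrow> A \<noteq> {op_zero} \<and>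
     (\<forall>I. closed_ideal A I \<longrightarrow> I = {op_zero} \<or> I = A)"

text \<open>Tracial state: positive linear functional of norm one that is tracial.
  Functionals are taken to vanish outside A, so that uniqueness is meaningful.\<close>
definition tracial_state :: "'g opr set \<Rightarrow> ('g opr \<Rightarrow> complex) \<Rightarrow> bool" where
  "tracial_state A \<phi> \<longleftrightarrow>
     (\<forall>a\<in>A. \<forall>b\<in>A. \<phi> (op_add a b) = \<phi> a + \<phi> b) \<and>
     (\<forall>a\<in>A. \<forall>c. \<phi> (op_scale c a) = c * \<phi> a) \<and>
     (\<forall>a\<in>A. \<phi> (op_mult (adjoint a) a) \<in> \<real> \<and> Re (\<phi> (op_mult (adjoint a) a)) \<ge> 0) \<and>
     (\<exists>K. \<forall>a\<in>A. cmod (\<phi> a) \<le> K * opnorm a) \<and>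
     Sup {cmod (\<phi> a) | a. a \<in> A \<and> opnorm a \<le> 1} = 1 \<and>
     (\<forall>a\<in>A. \<forall>b\<in>A. \<phi> (op_mult a b) = \<phi> (op_mult b a)) \<and>
     (\<forall>a. a \<notin> A \<longrightarrow> \<phi> a = 0)"

definition unique_tracial_state :: "'g opr set \<Rightarrow> bool" where
  "unique_tracial_state A \<longleftrightarrow> (\<exists>!\<phi>. tracial_state A \<phi>)"

end

theory Submission
  imports Defs
begin

text \<open>
  Everything rests on averaging by convex combinations of conjugations with the unitaries \<open>L g\<close>. Under
  Kleppner's condition every finitely supported element with vanishing coefficient at the identity can be
  averaged to have arbitrarily small operator norm. The averages are first made small in the \<open>l2\<close>-norm, because
  no nonzero square-summable function off the identity is invariant under twisted conjugation. Induction along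
  the upper FC-central series, together with the Kadison inequality \<open>\<Phi>(b)* \<Phi>(b) \<le> \<Phi>(b* b)\<close>, then upgrades this to
  the operator norm. So the averages of any \<open>a\<close> approximate \<open>\<tau>(a) 1\<close>, where \<open>\<tau>\<close> is the canonical trace; hence every
  tracial state equals \<open>\<tau>\<close>, and a nonzero closed ideal contains the averages of some \<open>a* a\<close> with \<open>\<tau>(a* a) > 0\<close>,
  so it contains \<open>1\<close>.

  If Kleppner's condition fails, the sum of the conjugates of \<open>L g\<close> over a finite class of regular elements
  yields a self-adjoint central element \<open>z\<close> that is not scalar. A simple unital C*-algebra has no such element,
  and one of the vector states of \<open>(1 \<plusminus> z) \<delta>\<close>, with \<open>\<delta>\<close> the unit vector at the identity, is a tracial state
  different from \<open>\<tau>\<close>.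
\<close>

section \<open>The Hilbert space of square-summable functions\<close>

text \<open>A small \<open>l2\<close>-norm does not bound the operator norm, and this gap is what
  the FC-central series bridges. If \<open>b\<close> is supported in \<open>m\<close> left cosets of
  \<open>N\<close> and \<open>b_C\<close> is its part on the coset \<open>C\<close>, Cauchy-Schwarz
  gives \<open>b* b \<le> m * (\<Sum>C. b_C* b_C)\<close>. The right-hand side lives on
  \<open>N\<close>, and its trace is \<open>m\<close> times the squared \<open>l2\<close>-norm of
  \<open>b\<close>. An element of \<open>fc_next N\<close> has only finitely many conjugates modulo
  \<open>N\<close>, so \<open>m\<close> is fixed by the original element before any average is
  chosen, and the \<open>l2\<close>-norm can be made small relative to it. Spectral theory is
  avoided throughout: positivity appears as an inequality between quadratic forms, limits of
  averages are taken pointwise, and invertibility of a central element is replaced by a lower bound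
  \<open>l2norm f \<le> K * l2norm (w f)\<close>.\<close>

definition delta :: "'g \<Rightarrow> 'g vec" where
  "delta g = (\<lambda>x. if x = g then 1 else 0)"

definition restrict_vec :: "'g set \<Rightarrow> 'g vec \<Rightarrow> 'g vec" where
  "restrict_vec F f = (\<lambda>x. if x \<in> F then f x else 0)"

lemma ell2_summable: "f \<in> ell2 \<Longrightarrow> (\<lambda>x. (cmod (f x))\<^sup>2) summable_on UNIV"
  by (simp add: ell2_def)

lemma ell2_finite_support:
  assumes "finite F" "\<And>x. x \<notin> F \<Longrightarrow> f x = 0"
  shows "f \<in> ell2"
proof -
  have "(\<lambda>x. (cmod (f x))\<^sup>2) summable_on F" using assms by simp
  then have "(\<lambda>x. (cmod (f x))\<^sup>2) summable_on UNIV"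
    by (rule summable_on_cong_neutral[THEN iffD1, rotated -1]) (use assms in auto)
  then show ?thesis by (simp add: ell2_def)
qed

lemma ell2_zero [simp]: "(\<lambda>x. 0) \<in> ell2"
  by (simp add: ell2_def)

lemma ell2_delta [simp]: "delta g \<in> ell2"
  by (rule ell2_finite_support[of "{g}"]) (auto simp: delta_def)

lemma ell2_restrict_vec: "finite F \<Longrightarrow> restrict_vec F f \<in> ell2"
  by (rule ell2_finite_support[of F]) (auto simp: restrict_vec_def)

lemma cmod_add_sq_le: "(cmod (a + b))\<^sup>2 \<le> 2 * (cmod a)\<^sup>2 + 2 * (cmod b)\<^sup>2"
proof -
  have "(cmod (a + b))\<^sup>2 \<le> (cmod a + cmod b)\<^sup>2"
    by (intro power_mono norm_triangle_ineq) auto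
  moreover have "(cmod a + cmod b)\<^sup>2 \<le> 2 * (cmod a)\<^sup>2 + 2 * (cmod b)\<^sup>2"
    using zero_le_power2[of "cmod a - cmod b"] by (simp add: power2_sum power2_diff)
  ultimately show ?thesis by linarith
qed

lemma ell2_add [intro]:
  assumes "f \<in> ell2" "h \<in> ell2" shows "(\<lambda>x. f x + h x) \<in> ell2"
proof -
  have "(\<lambda>x. 2 * (cmod (f x))\<^sup>2 + 2 * (cmod (h x))\<^sup>2) summable_on UNIV"
    by (intro summable_on_add summable_on_cmult_right ell2_summable assms)
  then show ?thesis unfolding ell2_def mem_Collect_eq
    by (rule summable_on_comparison_test) (auto intro: cmod_add_sq_le)
qed

lemma ell2_scale [intro]:
  assumes "f \<in> ell2" shows "(\<lambda>x. c * f x) \<in> ell2"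
  using summable_on_cmult_right[OF ell2_summable[OF assms], of "(cmod c)\<^sup>2"]
  by (simp add: ell2_def norm_mult power_mult_distrib)

lemma ell2_diff [intro]:
  assumes "f \<in> ell2" "h \<in> ell2" shows "(\<lambda>x. f x - h x) \<in> ell2"
  using ell2_add[OF assms(1) ell2_scale[OF assms(2), of "-1"]] by simp

lemma ell2_sum:
  "(\<And>i. i \<in> I \<Longrightarrow> f i \<in> ell2) \<Longrightarrow> (\<lambda>x. \<Sum>i\<in>I. f i x) \<in> ell2"
proof (induction I rule: infinite_finite_induct)
  case (insert i I)
  then show ?case using ell2_add[of "f i" "\<lambda>x. \<Sum>i\<in>I. f i x"] by auto
qed auto

lemma l2norm_nonneg [simp]: "0 \<le> l2norm f"
  by (simp add: l2norm_def infsum_nonneg)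

lemma l2norm_sq: "(l2norm f)\<^sup>2 = (\<Sum>\<^sub>\<infinity>x. (cmod (f x))\<^sup>2)"
  by (simp add: l2norm_def infsum_nonneg)

lemma sum_le_l2norm_sq:
  assumes "f \<in> ell2" "finite F" shows "(\<Sum>x\<in>F. (cmod (f x))\<^sup>2) \<le> (l2norm f)\<^sup>2"
  unfolding l2norm_sq by (rule finite_sum_le_infsum) (use assms ell2_summable in auto)

lemma cmod_le_l2norm: "f \<in> ell2 \<Longrightarrow> cmod (f x) \<le> l2norm f"
  by (rule power2_le_imp_le) (use sum_le_l2norm_sq[of f "{x}"] in auto)

lemma L2_set_le_l2norm:
  assumes "f \<in> ell2" "finite F" shows "L2_set (\<lambda>x. cmod (f x)) F \<le> l2norm f"
  using real_sqrt_le_mono[OF sum_le_l2norm_sq[OF assms]] by (simp add: L2_set_def)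

lemma l2norm_sq_finite:
  assumes "finite F" "\<And>x. x \<notin> F \<Longrightarrow> f x = 0"
  shows "(l2norm f)\<^sup>2 = (\<Sum>x\<in>F. (cmod (f x))\<^sup>2)"
  unfolding l2norm_sq
  by (subst infsum_cong_neutral[where T = F]) (use assms in auto)

lemma l2norm_delta [simp]: "l2norm (delta g) = 1"
  by (rule power2_eq_imp_eq) (use l2norm_sq_finite[of "{g}" "delta g"] in \<open>auto simp: delta_def\<close>)

lemma l2norm_zero [simp]: "l2norm (\<lambda>x. 0) = 0"
  by (simp add: l2norm_def)

lemma l2norm_eq_0:
  assumes "f \<in> ell2" "l2norm f = 0" shows "f = (\<lambda>x. 0)"
  using cmod_le_l2norm[OF assms(1)] assms(2) by (auto simp: fun_eq_iff)

lemma l2norm_cmult: "l2norm (\<lambda>x. c * f x) = cmod c * l2norm f"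
proof -
  have "(l2norm (\<lambda>x. c * f x))\<^sup>2 = (cmod c * l2norm f)\<^sup>2"
    unfolding power_mult_distrib l2norm_sq norm_mult by (rule infsum_cmult_right')
  then show ?thesis by (simp add: power2_eq_iff_nonneg)
qed

lemma ell2_mult_abs_summable:
  assumes "f \<in> ell2" "h \<in> ell2" shows "(\<lambda>x. norm (cnj (f x) * h x)) summable_on UNIV"
proof -
  have "(\<lambda>x. (cmod (f x))\<^sup>2 + (cmod (h x))\<^sup>2) summable_on UNIV"
    by (intro summable_on_add ell2_summable assms)
  then show ?thesis
  proof (rule summable_on_comparison_test)
    fix x
    show "norm (cnj (f x) * h x) \<le> (cmod (f x))\<^sup>2 + (cmod (h x))\<^sup>2"
      using sum_squares_bound[of "cmod (f x)" "cmod (h x)"] mult_nonneg_nonneg[OF norm_ge_zero norm_ge_zero, of "f x" "h x"]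
      unfolding norm_mult complex_mod_cnj by linarith
  qed auto
qed

lemma ell2_mult_summable:
  assumes "f \<in> ell2" "h \<in> ell2" shows "(\<lambda>x. cnj (f x) * h x) summable_on UNIV"
  using abs_summable_summable[OF ell2_mult_abs_summable[OF assms]] .

lemma l2inner_add_right:
  "\<lbrakk>f \<in> ell2; h \<in> ell2; k \<in> ell2\<rbrakk> \<Longrightarrow> l2inner f (\<lambda>x. h x + k x) = l2inner f h + l2inner f k"
  unfolding l2inner_def by (subst infsum_add[symmetric]) (auto intro: ell2_mult_summable simp: distrib_left)

lemma l2inner_cmult_right: "l2inner f (\<lambda>x. c * h x) = c * l2inner f h"
  unfolding l2inner_def by (subst infsum_cmult_right'[symmetric]) (simp add: mult.left_commute)

lemma l2inner_cnj: "cnj (l2inner f h) = l2inner h f"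
  unfolding l2inner_def by (subst infsum_cnj[symmetric]) (simp add: mult.commute)

lemma l2inner_add_left:
  assumes "f \<in> ell2" "h \<in> ell2" "k \<in> ell2"
  shows "l2inner (\<lambda>x. h x + k x) f = l2inner h f + l2inner k f"
  using arg_cong[OF l2inner_add_right[OF assms], of cnj] by (simp add: l2inner_cnj)

lemma l2inner_cmult_left: "l2inner (\<lambda>x. c * h x) f = cnj c * l2inner h f"
  using arg_cong[OF l2inner_cmult_right[of f c h], of cnj] by (simp add: l2inner_cnj)

lemma l2inner_sum_right:
  assumes "f \<in> ell2"
  shows "(\<And>i. i \<in> I \<Longrightarrow> h i \<in> ell2) \<Longrightarrow> l2inner f (\<lambda>x. \<Sum>i\<in>I. h i x) = (\<Sum>i\<in>I. l2inner f (h i))"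
proof (induction I rule: infinite_finite_induct)
  case (insert i I)
  then show ?case using l2inner_add_right[OF assms, of "h i" "\<lambda>x. \<Sum>i\<in>I. h i x"]
    by (auto intro: ell2_sum)
qed (auto simp: l2inner_def)

lemma l2inner_self: assumes "f \<in> ell2" shows "l2inner f f = of_real ((l2norm f)\<^sup>2)"
proof -
  have *: "cnj z * z = of_real ((cmod z)\<^sup>2)" for z
    by (metis complex_norm_square mult.commute)
  show ?thesis unfolding l2inner_def l2norm_sq *
    using ell2_summable[OF assms] by (intro infsumI has_sum_of_real has_sum_infsum)
qed

lemma l2inner_finite:
  assumes "finite F" "\<And>x. x \<notin> F \<Longrightarrow> f x = 0 \<or> h x = 0"
  shows "l2inner f h = (\<Sum>x\<in>F. cnj (f x) * h x)"
  unfolding l2inner_def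
  by (subst infsum_cong_neutral[where T = F]) (use assms in auto)

lemma l2inner_delta_left [simp]: "l2inner (delta g) h = h g"
  by (subst l2inner_finite[of "{g}"]) (auto simp: delta_def)

lemma l2inner_delta_right [simp]: "l2inner h (delta g) = cnj (h g)"
  by (subst l2inner_finite[of "{g}"]) (auto simp: delta_def)

lemma l2inner_cauchy_schwarz:
  assumes "f \<in> ell2" "h \<in> ell2" shows "cmod (l2inner f h) \<le> l2norm f * l2norm h"
proof -
  have "cmod (l2inner f h) \<le> (\<Sum>\<^sub>\<infinity>x. norm (cnj (f x) * h x))"
    unfolding l2inner_def by (rule norm_infsum_bound[OF ell2_mult_abs_summable[OF assms]])
  also have "\<dots> \<le> l2norm f * l2norm h"
  proof (rule infsum_le_finite_sums[OF ell2_mult_abs_summable[OF assms]])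
    fix F :: "'a set" assume F: "finite F"
    have "(\<Sum>x\<in>F. norm (cnj (f x) * h x)) = (\<Sum>x\<in>F. \<bar>cmod (f x)\<bar> * \<bar>cmod (h x)\<bar>)"
      by (simp add: norm_mult)
    also have "\<dots> \<le> L2_set (\<lambda>x. cmod (f x)) F * L2_set (\<lambda>x. cmod (h x)) F"
      by (rule L2_set_mult_ineq)
    also have "\<dots> \<le> l2norm f * l2norm h"
      by (intro mult_mono L2_set_le_l2norm assms F L2_set_nonneg) auto
    finally show "(\<Sum>x\<in>F. norm (cnj (f x) * h x)) \<le> l2norm f * l2norm h" .
  qed
  finally show ?thesis .
qed

lemma l2norm_add_sq:
  assumes "f \<in> ell2" "h \<in> ell2"
  shows "(l2norm (\<lambda>x. f x + h x))\<^sup>2 = (l2norm f)\<^sup>2 + 2 * Re (l2inner f h) + (l2norm h)\<^sup>2"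
proof -
  have "complex_of_real ((l2norm (\<lambda>x. f x + h x))\<^sup>2) = l2inner (\<lambda>x. f x + h x) (\<lambda>x. f x + h x)"
    using assms by (intro l2inner_self[symmetric] ell2_add)
  also have "\<dots> = l2inner f f + l2inner h h + (l2inner f h + cnj (l2inner f h))"
    using assms by (simp add: l2inner_add_left l2inner_add_right ell2_add l2inner_cnj)
  also have "\<dots> = of_real ((l2norm f)\<^sup>2 + 2 * Re (l2inner f h) + (l2norm h)\<^sup>2)"
    using assms by (simp add: l2inner_self complex_add_cnj)
  finally show ?thesis using of_real_eq_iff by blast
qed

lemma l2norm_diff_sq:
  assumes "f \<in> ell2" "h \<in> ell2"
  shows "(l2norm (\<lambda>x. f x - h x))\<^sup>2 = (l2norm f)\<^sup>2 - 2 * Re (l2inner f h) + (l2norm h)\<^sup>2"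
  using l2norm_add_sq[OF assms(1) ell2_scale[OF assms(2), of "-1"]]
    l2norm_cmult[of "-1" h] l2inner_cmult_right[of f "-1" h] by simp

lemma l2norm_triangle:
  assumes "f \<in> ell2" "h \<in> ell2"
  shows "l2norm (\<lambda>x. f x + h x) \<le> l2norm f + l2norm h"
proof -
  have "Re (l2inner f h) \<le> l2norm f * l2norm h"
    using l2inner_cauchy_schwarz[OF assms] complex_Re_le_cmod order_trans by blast
  then have "(l2norm (\<lambda>x. f x + h x))\<^sup>2 \<le> (l2norm f + l2norm h)\<^sup>2"
    unfolding l2norm_add_sq[OF assms] by (simp add: power2_sum)
  then show ?thesis by (rule power2_le_imp_le) simp
qed

lemma l2norm_minus_commute: "l2norm (\<lambda>x. f x - h x) = l2norm (\<lambda>x. h x - f x)"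
  by (simp add: l2norm_def norm_minus_commute)

text \<open>The triangle inequality followed by Cauchy-Schwarz for finite sums. The factor
  \<open>card I\<close> becomes the number of cosets in the successor step of the induction.\<close>

lemma l2norm_sum_sq_le:
  assumes "finite I" "\<And>i. i \<in> I \<Longrightarrow> h i \<in> ell2"
  shows "(l2norm (\<lambda>x. \<Sum>i\<in>I. h i x))\<^sup>2 \<le> card I * (\<Sum>i\<in>I. (l2norm (h i))\<^sup>2)"
proof -
  have "l2norm (\<lambda>x. \<Sum>i\<in>I. h i x) \<le> (\<Sum>i\<in>I. l2norm (h i))"
    using assms
  proof (induction I rule: finite_induct)
    case (insert i I)
    then have "l2norm (\<lambda>x. h i x + (\<Sum>i\<in>I. h i x)) \<le> l2norm (h i) + l2norm (\<lambda>x. \<Sum>i\<in>I. h i x)"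
      by (intro l2norm_triangle ell2_sum) auto
    then show ?case using insert by simp
  qed auto
  then have "(l2norm (\<lambda>x. \<Sum>i\<in>I. h i x))\<^sup>2 \<le> (\<Sum>i\<in>I. l2norm (h i))\<^sup>2"
    by (rule power_mono) simp
  also have "\<dots> \<le> card I * (\<Sum>i\<in>I. (l2norm (h i))\<^sup>2)"
    using sum_squared_le_sum_of_squares[of "\<lambda>i. l2norm (h i)" I] by (simp add: mult.commute)
  finally show ?thesis .
qed

lemma ell2_restrict_vec_approx:
  assumes "f \<in> ell2" "0 < e"
  obtains F where "finite F" "l2norm (\<lambda>x. f x - restrict_vec F f x) < e"
proof -
  obtain F where F: "finite F" and d: "dist (\<Sum>x\<in>F. (cmod (f x))\<^sup>2) (\<Sum>\<^sub>\<infinity>x. (cmod (f x))\<^sup>2) \<le> (e/2)\<^sup>2"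
    using infsum_finite_approximation[OF ell2_summable[OF assms(1)], of "(e/2)\<^sup>2"] assms(2) by auto
  have c: "restrict_vec F f \<in> ell2" by (rule ell2_restrict_vec[OF F])
  have 1: "(l2norm (restrict_vec F f))\<^sup>2 = (\<Sum>x\<in>F. (cmod (f x))\<^sup>2)"
    by (subst l2norm_sq_finite[OF F]) (auto simp: restrict_vec_def)
  \<comment> \<open>Truncation is the orthogonal projection onto the functions supported in
    \<open>F\<close>, so the squared distance is the tail of the series.\<close>
  have 2: "l2inner f (restrict_vec F f) = l2inner (restrict_vec F f) (restrict_vec F f)"
    by (subst (1 2) l2inner_finite[OF F]) (auto simp: restrict_vec_def)
  have "(l2norm (\<lambda>x. f x - restrict_vec F f x))\<^sup>2 = (\<Sum>\<^sub>\<infinity>x. (cmod (f x))\<^sup>2) - (\<Sum>x\<in>F. (cmod (f x))\<^sup>2)"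
    unfolding l2norm_diff_sq[OF assms(1) c] 2 l2inner_self[OF c] 1 by (simp add: l2norm_sq)
  also have "\<dots> \<le> (e/2)\<^sup>2" using d by (simp add: dist_real_def)
  finally have "l2norm (\<lambda>x. f x - restrict_vec F f x) \<le> e/2"
    by (rule power2_le_imp_le) (use assms in auto)
  then show ?thesis using that[OF F] assms(2) by simp
qed

section \<open>Riesz representation for square-summable functions\<close>

lemma finite_linear_expansion:
  fixes \<phi> :: "'g vec \<Rightarrow> complex"
  assumes "\<And>f h. f \<in> ell2 \<Longrightarrow> h \<in> ell2 \<Longrightarrow> \<phi> (\<lambda>x. f x + h x) = \<phi> f + \<phi> h"
    and "\<And>f c. f \<in> ell2 \<Longrightarrow> \<phi> (\<lambda>x. c * f x) = c * \<phi> f"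
    and "finite F"
  shows "\<phi> (restrict_vec F f) = (\<Sum>x\<in>F. f x * \<phi> (delta x))"
  using assms(3)
proof (induction F rule: finite_induct)
  case empty
  have "\<phi> (\<lambda>x. 0 * delta undefined x) = 0 * \<phi> (delta undefined)" by (rule assms(2)) simp
  then show ?case by (simp add: restrict_vec_def)
next
  case (insert y F)
  have "restrict_vec (insert y F) f = (\<lambda>x. f y * delta y x + restrict_vec F f x)"
    using insert by (auto simp: restrict_vec_def delta_def fun_eq_iff)
  then show ?case
    using assms(1)[OF ell2_scale[OF ell2_delta] ell2_restrict_vec[OF insert(1)]] insert assms(2)[OF ell2_delta]
    by simp
qed

text \<open>The representing vector can only have the values \<open>cnj (\<phi> (delta x))\<close>.
  The bound on \<open>\<phi>\<close> makes it square-summable, and the identity extends from finite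
  supports by continuity.\<close>

lemma riesz_ell2:
  fixes \<phi> :: "'g vec \<Rightarrow> complex"
  assumes add: "\<And>f h. f \<in> ell2 \<Longrightarrow> h \<in> ell2 \<Longrightarrow> \<phi> (\<lambda>x. f x + h x) = \<phi> f + \<phi> h"
    and sc: "\<And>f c. f \<in> ell2 \<Longrightarrow> \<phi> (\<lambda>x. c * f x) = c * \<phi> f"
    and bd: "\<And>f. f \<in> ell2 \<Longrightarrow> cmod (\<phi> f) \<le> K * l2norm f"
  shows "\<exists>u\<in>ell2. l2norm u \<le> K \<and> (\<forall>h\<in>ell2. l2inner u h = \<phi> h)"
proof -
  define u where "u = (\<lambda>x. cnj (\<phi> (delta x)))"
  have expansion: "\<phi> (restrict_vec F f) = (\<Sum>x\<in>F. f x * \<phi> (delta x))" if "finite F" for F f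
    by (rule finite_linear_expansion) (fact add sc that)+
  have K: "0 \<le> K" using order_trans[OF norm_ge_zero bd[of "delta undefined"]] by simp
  \<comment> \<open>Testing \<open>\<phi>\<close> on the truncation of \<open>u\<close> itself gives
    \<open>s \<le> K * sqrt s\<close>.\<close>
  have fin: "(\<Sum>x\<in>F. (cmod (u x))\<^sup>2) \<le> K\<^sup>2" if F: "finite F" for F
  proof -
    define s where "s = (\<Sum>x\<in>F. (cmod (u x))\<^sup>2)"
    have s0: "0 \<le> s" by (simp add: s_def sum_nonneg)
    have n: "(l2norm (restrict_vec F u))\<^sup>2 = s"
      by (subst l2norm_sq_finite[OF F]) (auto simp: restrict_vec_def s_def)
    have "\<phi> (restrict_vec F u) = (\<Sum>x\<in>F. u x * cnj (u x))"
      unfolding expansion[OF F] by (simp add: u_def)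
    also have "\<dots> = of_real s" unfolding s_def of_real_sum complex_norm_square ..
    finally have "s \<le> K * l2norm (restrict_vec F u)" using bd[OF ell2_restrict_vec[OF F], of u] s0 by simp
    then have "(l2norm (restrict_vec F u))\<^sup>2 \<le> K * l2norm (restrict_vec F u)" using n by simp
    then have "l2norm (restrict_vec F u) \<le> K"
      using K l2norm_nonneg[of "restrict_vec F u"] by (auto simp: power2_eq_square mult_le_cancel_right)
    then show ?thesis using n power_mono[of "l2norm (restrict_vec F u)" K 2] by (simp add: s_def)
  qed
  have u: "u \<in> ell2" unfolding ell2_def mem_Collect_eq
    by (rule nonneg_bounded_partial_sums_imp_summable_on[where C = "K\<^sup>2"])
      (auto simp: fin intro!: eventually_finite_subsets_at_top_weakI)
  have "(l2norm u)\<^sup>2 \<le> K\<^sup>2" unfolding l2norm_sq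
    by (rule infsum_le_finite_sums[OF ell2_summable[OF u]]) (simp add: fin)
  then have nu: "l2norm u \<le> K" by (rule power2_le_imp_le) (rule K)
  have "l2inner u h = \<phi> h" if h: "h \<in> ell2" for h
  proof (rule ccontr)
    assume ne: "l2inner u h \<noteq> \<phi> h"
    \<comment> \<open>The error will be at most \<open>2 * K * e\<close>; the extra 1 makes the
      estimate strict and covers \<open>K = 0\<close>.\<close>
    define e where "e = cmod (l2inner u h - \<phi> h) / (2 * K + 1)"
    have "0 < e" using ne K by (simp add: e_def)
    then obtain F where F: "finite F" and d: "l2norm (\<lambda>x. h x - restrict_vec F h x) < e"
      by (rule ell2_restrict_vec_approx[OF h])
    have c: "restrict_vec F h \<in> ell2" by (rule ell2_restrict_vec[OF F])
    define d where "d = (\<lambda>x. h x - restrict_vec F h x)"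
    have de: "d \<in> ell2" unfolding d_def using h c by auto
    have eq: "h = (\<lambda>x. restrict_vec F h x + d x)" by (simp add: d_def)
    have "l2inner u (restrict_vec F h) = \<phi> (restrict_vec F h)"
      unfolding expansion[OF F]
      by (subst l2inner_finite[OF F]) (auto simp: restrict_vec_def u_def mult.commute)
    moreover have "l2inner u h = l2inner u (restrict_vec F h) + l2inner u d"
      by (subst eq) (rule l2inner_add_right[OF u c de])
    moreover have "\<phi> h = \<phi> (restrict_vec F h) + \<phi> d" by (subst eq) (rule add[OF c de])
    ultimately have "cmod (l2inner u h - \<phi> h) \<le> cmod (l2inner u d) + cmod (\<phi> d)"
      by (simp add: norm_triangle_ineq4)
    also have "\<dots> \<le> K * l2norm d + K * l2norm d"
      using l2inner_cauchy_schwarz[OF u de] bd[OF de] mult_right_mono[OF nu, of "l2norm d"] by simp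
    also have "\<dots> \<le> 2 * K * e" using mult_left_mono[OF less_imp_le[OF d] K] by (simp add: d_def)
    also have "\<dots> < (2 * K + 1) * e" using \<open>0 < e\<close> by (simp add: algebra_simps)
    also have "\<dots> = cmod (l2inner u h - \<phi> h)" using K by (simp add: e_def)
    finally show False by simp
  qed
  then show ?thesis using u nu by blast
qed

section \<open>Bounded operators and adjoints\<close>

lemma bounded_op_ell2 [intro]: "bounded_op T \<Longrightarrow> f \<in> ell2 \<Longrightarrow> T f \<in> ell2"
  and bounded_op_add: "bounded_op T \<Longrightarrow> f \<in> ell2 \<Longrightarrow> h \<in> ell2 \<Longrightarrow> T (\<lambda>x. f x + h x) = (\<lambda>x. T f x + T h x)"
  and bounded_op_cmult: "bounded_op T \<Longrightarrow> f \<in> ell2 \<Longrightarrow> T (\<lambda>x. c * f x) = (\<lambda>x. c * T f x)"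
  and bounded_op_outside: "bounded_op T \<Longrightarrow> f \<notin> ell2 \<Longrightarrow> T f = (\<lambda>x. 0)"
  by (simp_all add: bounded_op_def)

lemma bounded_op_zero: "bounded_op T \<Longrightarrow> T (\<lambda>x. 0) = (\<lambda>x. 0)"
  using bounded_op_cmult[of T "\<lambda>x. 0" 0] by simp

lemma bounded_opI:
  assumes "\<And>f. f \<in> ell2 \<Longrightarrow> T f \<in> ell2"
    and "\<And>f h. f \<in> ell2 \<Longrightarrow> h \<in> ell2 \<Longrightarrow> T (\<lambda>x. f x + h x) = (\<lambda>x. T f x + T h x)"
    and "\<And>f c. f \<in> ell2 \<Longrightarrow> T (\<lambda>x. c * f x) = (\<lambda>x. c * T f x)"
    and "\<And>f. f \<in> ell2 \<Longrightarrow> l2norm (T f) \<le> K * l2norm f"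
    and "\<And>f. f \<notin> ell2 \<Longrightarrow> T f = (\<lambda>x. 0)"
  shows "bounded_op T"
  using assms unfolding bounded_op_def by blast

lemma opnorm_bdd_above:
  assumes "bounded_op T"
  shows "bdd_above {l2norm (T f) | f. f \<in> ell2 \<and> l2norm f \<le> 1}"
proof -
  obtain K where K: "\<And>f. f \<in> ell2 \<Longrightarrow> l2norm (T f) \<le> K * l2norm f"
    using assms unfolding bounded_op_def by blast
  have K0: "0 \<le> K" using order_trans[OF l2norm_nonneg K[of "delta undefined"]] by simp
  show ?thesis
  proof (rule bdd_aboveI[of _ K])
    fix r assume "r \<in> {l2norm (T f) | f. f \<in> ell2 \<and> l2norm f \<le> 1}"
    then obtain f where "f \<in> ell2" "l2norm f \<le> 1" "r = l2norm (T f)" by blast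
    then show "r \<le> K" using K[of f] mult_left_mono[OF _ K0, of "l2norm f" 1] by simp
  qed
qed

lemma opnorm_upper:
  assumes "bounded_op T" "f \<in> ell2" "l2norm f \<le> 1" shows "l2norm (T f) \<le> opnorm T"
  unfolding opnorm_def by (rule cSup_upper[OF _ opnorm_bdd_above[OF assms(1)]]) (use assms in blast)

lemma opnorm_nonneg: assumes "bounded_op T" shows "0 \<le> opnorm T"
  using order_trans[OF l2norm_nonneg opnorm_upper[OF assms ell2_zero]] by simp

lemma opnorm_apply:
  assumes "bounded_op T" "f \<in> ell2" shows "l2norm (T f) \<le> opnorm T * l2norm f"
proof (cases "l2norm f = 0")
  case True
  then have "f = (\<lambda>x. 0)" using l2norm_eq_0 assms by blast
  then show ?thesis using True bounded_op_zero[OF assms(1)] by simp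
next
  case False
  then have p: "0 < l2norm f" using l2norm_nonneg[of f] by linarith
  let ?c = "complex_of_real (1 / l2norm f)"
  have n: "l2norm (\<lambda>x. ?c * f x) = 1" unfolding l2norm_cmult using p by (simp add: norm_divide)
  have "l2norm (T (\<lambda>x. ?c * f x)) \<le> opnorm T"
    by (rule opnorm_upper[OF assms(1) ell2_scale[OF assms(2)]]) (simp only: n)
  then have "l2norm (T f) / l2norm f \<le> opnorm T"
    unfolding bounded_op_cmult[OF assms] l2norm_cmult by (simp add: norm_divide)
  then show ?thesis using p by (simp add: divide_le_eq)
qed

lemma opnorm_le:
  assumes "0 \<le> K" "\<And>f. f \<in> ell2 \<Longrightarrow> l2norm (T f) \<le> K * l2norm f"
  shows "opnorm T \<le> K"
  unfolding opnorm_def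
proof (rule cSup_least)
  show "{l2norm (T f) | f. f \<in> ell2 \<and> l2norm f \<le> 1} \<noteq> {}"
    by (auto intro!: exI[of _ "\<lambda>x. 0"])
  fix r assume "r \<in> {l2norm (T f) | f. f \<in> ell2 \<and> l2norm f \<le> 1}"
  then obtain f where "f \<in> ell2" "l2norm f \<le> 1" "r = l2norm (T f)" by blast
  then show "r \<le> K" using assms(2)[of f] mult_left_mono[OF _ assms(1), of "l2norm f" 1] by simp
qed

lemma opnorm_le_sq:
  assumes "0 \<le> K" "\<And>f. f \<in> ell2 \<Longrightarrow> (l2norm (T f))\<^sup>2 \<le> K * (l2norm f)\<^sup>2"
  shows "opnorm T \<le> sqrt K"
proof (rule opnorm_le)
  fix f :: "'a vec" assume "f \<in> ell2"
  then have "sqrt ((l2norm (T f))\<^sup>2) \<le> sqrt (K * (l2norm f)\<^sup>2)"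
    using assms(2) by (intro real_sqrt_le_mono) auto
  then show "l2norm (T f) \<le> sqrt K * l2norm f" by (simp add: real_sqrt_mult)
qed (use assms in auto)

lemma op_add_apply [simp]: "op_add S T f = (\<lambda>x. S f x + T f x)"
  and op_scale_apply [simp]: "op_scale c T f = (\<lambda>x. c * T f x)"
  and op_mult_apply [simp]: "op_mult S T f = S (T f)"
  and op_zero_apply [simp]: "op_zero f = (\<lambda>x. 0)"
  by (simp_all add: op_add_def op_scale_def op_mult_def op_zero_def)

abbreviation op_diff :: "'g opr \<Rightarrow> 'g opr \<Rightarrow> 'g opr" where
  "op_diff S T \<equiv> op_add S (op_scale (-1) T)"

lemma bounded_op_op_zero [intro, simp]: "bounded_op op_zero"
  by (rule bounded_opI[where K = 0]) auto

lemma bounded_op_op_add [intro]: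
  assumes "bounded_op S" "bounded_op T" shows "bounded_op (op_add S T)"
proof (rule bounded_opI[where K = "opnorm S + opnorm T"])
  fix f :: "'a vec" assume f: "f \<in> ell2"
  have "l2norm (op_add S T f) \<le> l2norm (S f) + l2norm (T f)"
    using assms f by (auto intro!: l2norm_triangle)
  then show "l2norm (op_add S T f) \<le> (opnorm S + opnorm T) * l2norm f"
    using opnorm_apply[OF assms(1) f] opnorm_apply[OF assms(2) f] by (simp add: distrib_right)
qed (use assms in \<open>auto simp: bounded_op_add[OF assms(1)] bounded_op_add[OF assms(2)]
    bounded_op_cmult[OF assms(1)] bounded_op_cmult[OF assms(2)] bounded_op_outside algebra_simps\<close>)

lemma bounded_op_op_scale [intro]:
  assumes "bounded_op T" shows "bounded_op (op_scale c T)"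
proof (rule bounded_opI[where K = "cmod c * opnorm T"])
  fix f :: "'a vec" assume f: "f \<in> ell2"
  show "l2norm (op_scale c T f) \<le> cmod c * opnorm T * l2norm f"
    using mult_left_mono[OF opnorm_apply[OF assms f] norm_ge_zero[of c]] by (simp add: l2norm_cmult mult.assoc)
qed (use assms in \<open>auto simp: bounded_op_add[OF assms] bounded_op_cmult[OF assms] bounded_op_outside algebra_simps\<close>)

lemma opnorm_mult_bound:
  assumes "bounded_op S" "bounded_op T" "f \<in> ell2"
  shows "l2norm (op_mult S T f) \<le> opnorm S * opnorm T * l2norm f"
proof -
  have "l2norm (S (T f)) \<le> opnorm S * l2norm (T f)"
    using assms by (intro opnorm_apply) auto
  also have "\<dots> \<le> opnorm S * (opnorm T * l2norm f)"
    by (intro mult_left_mono opnorm_apply assms opnorm_nonneg)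
  finally show ?thesis by (simp add: mult.assoc)
qed

lemma bounded_op_op_mult [intro]:
  assumes "bounded_op S" "bounded_op T" shows "bounded_op (op_mult S T)"
proof (rule bounded_opI[where K = "opnorm S * opnorm T"])
  fix f h :: "'a vec" and c assume f: "f \<in> ell2"
  show "l2norm (op_mult S T f) \<le> opnorm S * opnorm T * l2norm f"
    by (rule opnorm_mult_bound[OF assms f])
  show "op_mult S T f \<in> ell2" using assms f by auto
  show "op_mult S T (\<lambda>x. c * f x) = (\<lambda>x. c * op_mult S T f x)"
    using assms f by (simp add: bounded_op_cmult[OF assms(1)] bounded_op_cmult[OF assms(2)] bounded_op_ell2)
  assume h: "h \<in> ell2"
  show "op_mult S T (\<lambda>x. f x + h x) = (\<lambda>x. op_mult S T f x + op_mult S T h x)"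
    using assms f h by (simp add: bounded_op_add[OF assms(1)] bounded_op_add[OF assms(2)] bounded_op_ell2)
qed (use assms in \<open>auto simp: bounded_op_outside bounded_op_zero\<close>)

lemma opnorm_add_le:
  assumes "bounded_op S" "bounded_op T" shows "opnorm (op_add S T) \<le> opnorm S + opnorm T"
proof (rule opnorm_le)
  fix f :: "'a vec" assume f: "f \<in> ell2"
  have "l2norm (op_add S T f) \<le> l2norm (S f) + l2norm (T f)"
    using assms f by (auto intro!: l2norm_triangle)
  then show "l2norm (op_add S T f) \<le> (opnorm S + opnorm T) * l2norm f"
    using opnorm_apply[OF assms(1) f] opnorm_apply[OF assms(2) f] by (simp add: distrib_right)
qed (simp add: assms opnorm_nonneg)

lemma opnorm_scale_le:
  assumes "bounded_op T" shows "opnorm (op_scale c T) \<le> cmod c * opnorm T"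
proof (rule opnorm_le)
  fix f :: "'a vec" assume f: "f \<in> ell2"
  show "l2norm (op_scale c T f) \<le> cmod c * opnorm T * l2norm f"
    using mult_left_mono[OF opnorm_apply[OF assms f] norm_ge_zero[of c]] by (simp add: l2norm_cmult mult.assoc)
qed (simp add: assms opnorm_nonneg)

lemma opnorm_mult_le:
  assumes "bounded_op S" "bounded_op T" shows "opnorm (op_mult S T) \<le> opnorm S * opnorm T"
  by (rule opnorm_le[OF _ opnorm_mult_bound[OF assms]]) (simp add: assms opnorm_nonneg)

lemma opnorm_zero [simp]: "opnorm op_zero = 0"
  by (rule antisym[OF opnorm_le opnorm_nonneg]) auto

lemma op_ext:
  assumes "bounded_op S" "bounded_op T" "\<And>f. f \<in> ell2 \<Longrightarrow> S f = T f" shows "S = T"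
proof
  fix f show "S f = T f" using assms by (cases "f \<in> ell2") (auto simp: bounded_op_outside)
qed

lemma opnorm_eq_0:
  assumes "bounded_op T" "opnorm T \<le> 0" shows "T = op_zero"
proof (rule op_ext[OF assms(1)])
  fix f :: "'a vec" assume f: "f \<in> ell2"
  have "l2norm (T f) \<le> 0" using opnorm_apply[OF assms(1) f] assms(2)
    mult_nonpos_nonneg[of "opnorm T" "l2norm f"] by simp
  then show "T f = op_zero f" using l2norm_eq_0[of "T f"] l2norm_nonneg[of "T f"] assms f by auto
qed auto

section \<open>Existence and algebra of adjoints\<close>

lemma l2inner_eqI:
  assumes "\<And>h. h \<in> ell2 \<Longrightarrow> l2inner u h = l2inner v h" shows "u = v"
  using assms[OF ell2_delta] by (simp add: fun_eq_iff)

lemma adjoint_exists: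
  assumes "bounded_op T" "f \<in> ell2"
  shows "\<exists>u\<in>ell2. l2norm u \<le> l2norm f * opnorm T \<and> (\<forall>h\<in>ell2. l2inner u h = l2inner f (T h))"
proof (rule riesz_ell2)
  fix h k :: "'a vec" and c assume h: "h \<in> ell2"
  show "l2inner f (T (\<lambda>x. c * h x)) = c * l2inner f (T h)"
    by (simp add: bounded_op_cmult[OF assms(1)] h l2inner_cmult_right)
  have "cmod (l2inner f (T h)) \<le> l2norm f * l2norm (T h)"
    using assms h by (auto intro: l2inner_cauchy_schwarz)
  also have "\<dots> \<le> l2norm f * (opnorm T * l2norm h)"
    by (intro mult_left_mono opnorm_apply assms h) auto
  finally show "cmod (l2inner f (T h)) \<le> l2norm f * opnorm T * l2norm h" by (simp add: mult.assoc)
  assume k: "k \<in> ell2"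
  show "l2inner f (T (\<lambda>x. h x + k x)) = l2inner f (T h) + l2inner f (T k)"
    using assms h k by (simp add: bounded_op_add[OF assms(1)] l2inner_add_right bounded_op_ell2)
qed

text \<open>Riesz supplies the existence, and \<open>l2inner_eqI\<close> the uniqueness, that the
  definite description in \<open>adjoint\<close> presupposes.\<close>

lemma adjoint_props:
  assumes "bounded_op T" "f \<in> ell2"
  shows "adjoint T f \<in> ell2" "l2norm (adjoint T f) \<le> opnorm T * l2norm f"
    and "h \<in> ell2 \<Longrightarrow> l2inner (adjoint T f) h = l2inner f (T h)"
proof -
  obtain u where u: "u \<in> ell2" "l2norm u \<le> l2norm f * opnorm T"
      "\<forall>h\<in>ell2. l2inner u h = l2inner f (T h)"
    using adjoint_exists[OF assms] by blast
  have "(THE u. u \<in> ell2 \<and> (\<forall>h\<in>ell2. l2inner u h = l2inner f (T h))) = u"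
    by (rule the_equality) (use u in \<open>auto intro!: l2inner_eqI\<close>)
  then have "adjoint T f = u" using assms(2) by (simp add: adjoint_def)
  then show "adjoint T f \<in> ell2" "l2norm (adjoint T f) \<le> opnorm T * l2norm f"
      "h \<in> ell2 \<Longrightarrow> l2inner (adjoint T f) h = l2inner f (T h)"
    using u by (simp_all add: mult.commute)
qed

lemma adjoint_inner_right:
  assumes "bounded_op T" "f \<in> ell2" "h \<in> ell2"
  shows "l2inner h (adjoint T f) = l2inner (T h) f"
  using arg_cong[OF adjoint_props(3)[OF assms], of cnj] by (simp add: l2inner_cnj)

lemma bounded_op_adjoint [intro]:
  assumes T: "bounded_op T" shows "bounded_op (adjoint T)"
proof (rule bounded_opI[where K = "opnorm T"])
  fix f h :: "'a vec" and c assume f: "f \<in> ell2"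
  show "adjoint T f \<in> ell2" "l2norm (adjoint T f) \<le> opnorm T * l2norm f"
    using adjoint_props[OF T f] by auto
  show "adjoint T (\<lambda>x. c * f x) = (\<lambda>x. c * adjoint T f x)"
    by (rule l2inner_eqI) (simp add: l2inner_cmult_left adjoint_props T f ell2_scale)
  assume h: "h \<in> ell2"
  show "adjoint T (\<lambda>x. f x + h x) = (\<lambda>x. adjoint T f x + adjoint T h x)"
    by (rule l2inner_eqI) (simp add: l2inner_add_left adjoint_props T f h ell2_add bounded_op_ell2)
qed (simp add: adjoint_def)

lemma adjoint_eqI:
  assumes "bounded_op T" "bounded_op S"
    and "\<And>f h. f \<in> ell2 \<Longrightarrow> h \<in> ell2 \<Longrightarrow> l2inner (S f) h = l2inner f (T h)"
  shows "adjoint T = S"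
  by (rule op_ext) (use assms in \<open>auto intro!: l2inner_eqI simp: adjoint_props\<close>)

lemma adjoint_op_add:
  assumes "bounded_op S" "bounded_op T"
  shows "adjoint (op_add S T) = op_add (adjoint S) (adjoint T)"
  by (rule adjoint_eqI)
    (use assms in \<open>auto simp: adjoint_props l2inner_add_left l2inner_add_right bounded_op_ell2\<close>)

lemma adjoint_op_scale:
  assumes "bounded_op T" shows "adjoint (op_scale c T) = op_scale (cnj c) (adjoint T)"
  by (rule adjoint_eqI)
    (use assms in \<open>auto simp: adjoint_props l2inner_cmult_left l2inner_cmult_right\<close>)

lemma adjoint_op_mult:
  assumes "bounded_op S" "bounded_op T"
  shows "adjoint (op_mult S T) = op_mult (adjoint T) (adjoint S)"
  by (rule adjoint_eqI) (use assms in \<open>auto simp: adjoint_props bounded_op_ell2\<close>)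

lemma adjoint_adjoint: "bounded_op T \<Longrightarrow> adjoint (adjoint T) = T"
  by (rule adjoint_eqI) (auto simp: adjoint_inner_right)

lemma adjoint_op_zero [simp]: "adjoint op_zero = op_zero"
  by (rule adjoint_eqI) (auto simp: l2inner_def)

lemma opnorm_adjoint_le: "bounded_op T \<Longrightarrow> opnorm (adjoint T) \<le> opnorm T"
  by (rule opnorm_le) (auto simp: opnorm_nonneg adjoint_props)

text \<open>The value of \<open>R f\<close> at \<open>x\<close> is the inner product of
  \<open>adjoint R (delta x)\<close> with \<open>f\<close>, and the entries of that vector are
  conjugated matrix entries of \<open>R\<close>. Passing through the adjoint avoids expanding
  \<open>f\<close> in the basis.\<close>

lemma op_ext_delta:
  assumes S: "bounded_op S" and T: "bounded_op T" and eq: "\<And>g. S (delta g) = T (delta g)"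
  shows "S = T"
proof (rule op_ext[OF S T])
  fix f :: "'a vec" assume f: "f \<in> ell2"
  have a: "adjoint R (delta x) = (\<lambda>g. cnj (R (delta g) x))" if "bounded_op R" for R x
  proof
    fix g
    show "adjoint R (delta x) g = cnj (R (delta g) x)"
      using arg_cong[OF adjoint_props(3)[OF that ell2_delta ell2_delta, of x g], of cnj] by simp
  qed
  have b: "R f x = l2inner (adjoint R (delta x)) f" if "bounded_op R" for R x
    using adjoint_props(3)[OF that ell2_delta f, of x] by simp
  show "S f = T f"
    by (rule ext) (simp only: b[OF S] b[OF T] a[OF S] a[OF T] eq)
qed

lemma op_diff_triangle:
  assumes "bounded_op R" "bounded_op S" "bounded_op T"
  shows "opnorm (op_diff R T) \<le> opnorm (op_diff R S) + opnorm (op_diff S T)"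
proof -
  have "op_diff R T = op_add (op_diff R S) (op_diff S T)" by (simp add: fun_eq_iff)
  then show ?thesis using opnorm_add_le[of "op_diff R S" "op_diff S T"] assms
    by (simp add: bounded_op_op_add bounded_op_op_scale)
qed

lemma op_diff_commute:
  "opnorm (op_diff S T) = opnorm (op_diff T S)"
proof -
  have "l2norm (op_diff S T f) = l2norm (op_diff T S f)" for f
    using l2norm_minus_commute[of "S f" "T f"] by simp
  then show ?thesis by (simp only: opnorm_def)
qed

section \<open>The twisted group algebra\<close>

text \<open>As rewrite rules these would also unfold operators that are not applied to a vector, by eta-expansion.\<close>

declare op_add_apply [simp del] op_scale_apply [simp del] op_mult_apply [simp del] op_zero_apply [simp del]

lemma op_apply_at:
  "op_add S T f x = S f x + T f x"
  "op_scale c T f x = c * T f x"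
  "op_mult S T f x = S (T f) x"
  "op_zero f x = 0"
  by (simp_all add: op_add_def op_scale_def op_mult_def op_zero_def)

section \<open>Finitely supported coefficient functions\<close>

definition fsupp :: "'g vec \<Rightarrow> bool" where
  "fsupp x \<longleftrightarrow> finite {g. x g \<noteq> 0}"

lemma fsupp_zero [simp]: "fsupp (\<lambda>_. 0)"
  by (simp add: fsupp_def)

lemma fsupp_delta [simp]: "fsupp (delta g)"
  by (simp add: fsupp_def delta_def)

lemma fsupp_add [intro]: "fsupp x \<Longrightarrow> fsupp y \<Longrightarrow> fsupp (\<lambda>k. x k + y k)"
  unfolding fsupp_def by (rule finite_subset[of _ "{g. x g \<noteq> 0} \<union> {g. y g \<noteq> 0}"]) auto

lemma fsupp_scale [intro]: "fsupp x \<Longrightarrow> fsupp (\<lambda>k. c * x k)"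
  unfolding fsupp_def by (rule finite_subset[of _ "{g. x g \<noteq> 0}"]) auto

lemma fsupp_ell2: "fsupp x \<Longrightarrow> x \<in> ell2"
  unfolding fsupp_def by (rule ell2_finite_support) auto

lemma fsupp_induct [consumes 1, case_names zero add]:
  assumes "fsupp x" "P (\<lambda>_. 0)"
    and step: "\<And>x g c. fsupp x \<Longrightarrow> P x \<Longrightarrow> P (\<lambda>k. x k + c * delta g k)"
  shows "P x"
proof -
  have "P x" if "finite F" "{g. x g \<noteq> 0} \<subseteq> F" for F x
    using that
  proof (induction F arbitrary: x rule: finite_induct)
    case empty
    then have "x = (\<lambda>_. 0)" by auto
    then show ?case using assms(2) by simp
  next
    case (insert g F)
    let ?y = "\<lambda>k. if k = g then 0 else x k"
    have s: "{k. ?y k \<noteq> 0} \<subseteq> F" using insert by auto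
    then have "fsupp ?y" unfolding fsupp_def using insert(1) finite_subset by blast
    then have "P (\<lambda>k. ?y k + x g * delta g k)" using step insert.IH[OF s] by blast
    moreover have "(\<lambda>k. ?y k + x g * delta g k) = x" by (auto simp: delta_def)
    ultimately show ?case by simp
  qed
  then show ?thesis using assms(1) by (simp add: fsupp_def)
qed

locale twisted_group =
  fixes \<sigma> :: "'g::group_add \<Rightarrow> 'g \<Rightarrow> complex"
  assumes two_cocycle: "two_cocycle \<sigma>"
begin

abbreviation L :: "'g \<Rightarrow> 'g opr" where "L \<equiv> lambda_sigma \<sigma>"

abbreviation A :: "'g opr set" where "A \<equiv> reduced_twisted \<sigma>"

lemma cmod_sigma [simp]: "cmod (\<sigma> g h) = 1"
  and sigma_assoc: "\<sigma> g h * \<sigma> (g + h) k = \<sigma> h k * \<sigma> g (h + k)"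
  and sigma_zero [simp]: "\<sigma> g 0 = 1" "\<sigma> 0 g = 1"
  using two_cocycle by (auto simp: two_cocycle_def)

lemma sigma_cnj [simp]: "\<sigma> g h * cnj (\<sigma> g h) = 1" "cnj (\<sigma> g h) * \<sigma> g h = 1"
  using complex_norm_square[of "\<sigma> g h"] by (simp_all add: mult.commute)

lemma sigma_inverse: "\<sigma> g (- g) = \<sigma> (- g) g"
  using sigma_assoc[of g "- g" g] by simp

lemma L_apply: "f \<in> ell2 \<Longrightarrow> L g f = (\<lambda>h. \<sigma> g (- g + h) * f (- g + h))"
  by (simp add: lambda_sigma_def)

lemma bij_plus_left: "bij_betw (\<lambda>h. g + h) UNIV (UNIV :: 'g set)"
  by (rule bij_betwI[where g = "\<lambda>h. - g + h"]) (auto simp: add.assoc[symmetric])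

lemma L_ell2:
  assumes "f \<in> ell2" shows "L g f \<in> ell2"
proof -
  have "(\<lambda>h. (cmod (f (- g + h)))\<^sup>2) summable_on UNIV"
    using summable_on_reindex_bij_betw[OF bij_plus_left[of "- g"], of "\<lambda>h. (cmod (f h))\<^sup>2"]
      ell2_summable[OF assms] by simp
  then show ?thesis by (simp add: ell2_def L_apply[OF assms] norm_mult)
qed

lemma L_l2norm:
  assumes "f \<in> ell2" shows "l2norm (L g f) = l2norm f"
  using infsum_reindex_bij_betw[OF bij_plus_left[of "- g"], of "\<lambda>h. (cmod (f h))\<^sup>2"]
  by (simp add: l2norm_def L_apply[OF assms] norm_mult)

lemma bounded_op_L [intro, simp]: "bounded_op (L g)"
proof (rule bounded_opI[where K = 1])
  fix f h :: "'g vec" and c assume f: "f \<in> ell2"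
  show "L g (\<lambda>x. c * f x) = (\<lambda>x. c * L g f x)"
    using f by (simp add: L_apply[OF f] L_apply[OF ell2_scale[OF f]] mult.left_commute)
  assume h: "h \<in> ell2"
  show "L g (\<lambda>x. f x + h x) = (\<lambda>x. L g f x + L g h x)"
    by (simp add: L_apply[OF f] L_apply[OF h] L_apply[OF ell2_add[OF f h]] distrib_left)
qed (auto simp: L_ell2 L_l2norm, simp add: lambda_sigma_def)

lemma opnorm_L_le: "opnorm (L g) \<le> 1"
  by (rule opnorm_le) (auto simp: L_l2norm)

lemma L_delta: "L g (delta h) = (\<lambda>x. \<sigma> g h * delta (g + h) x)"
proof
  fix x
  have "- g + x = h \<longleftrightarrow> x = g + h" by (metis add.assoc add.left_inverse add.right_inverse add_0)
  then show "L g (delta h) x = \<sigma> g h * delta (g + h) x"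
    unfolding L_apply[OF ell2_delta] by (auto simp: delta_def)
qed

lemma L_zero [simp]: "f \<in> ell2 \<Longrightarrow> L 0 f = f"
  by (simp add: L_apply)

lemma op_mult_L_zero [simp]:
  assumes "bounded_op a" shows "op_mult (L 0) a = a" "op_mult a (L 0) = a"
  by (rule op_ext; use assms in \<open>auto simp: bounded_op_ell2 op_mult_apply\<close>)+

lemma adjoint_L_zero [simp]: "adjoint (L 0) = L 0"
  by (rule adjoint_eqI) auto

lemma L_mult: "op_mult (L g) (L h) = op_scale (\<sigma> g h) (L (g + h))"
proof (rule op_ext)
  fix f :: "'g vec" assume f: "f \<in> ell2"
  show "op_mult (L g) (L h) f = op_scale (\<sigma> g h) (L (g + h)) f"
  proof
    fix k
    have e: "h + (- h + (- g + k)) = - g + k" "- (g + h) + k = - h + (- g + k)"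
      by (simp_all only: minus_add_cancel add_minus_cancel minus_add add.assoc)
    have "\<sigma> g h * \<sigma> (g + h) (- h + (- g + k)) = \<sigma> h (- h + (- g + k)) * \<sigma> g (- g + k)"
      using sigma_assoc[of g h "- h + (- g + k)"] e by simp
    then show "op_mult (L g) (L h) f k = op_scale (\<sigma> g h) (L (g + h)) f k"
      by (simp add: op_apply_at L_apply[OF f] L_apply[OF L_ell2[OF f], unfolded L_apply[OF f]] e)
  qed
qed auto

text \<open>By \<open>L_mult\<close>, the product of \<open>L g\<close> and \<open>L (- g)\<close>
  is the scalar \<open>\<sigma> g (- g)\<close>, so the inverse of the unitary \<open>L g\<close>
  carries the conjugate of that scalar.\<close>

lemma adjoint_L: "adjoint (L g) = op_scale (cnj (\<sigma> g (- g))) (L (- g))"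
proof (rule adjoint_eqI)
  fix f h :: "'g vec" assume f: "f \<in> ell2" and h: "h \<in> ell2"
  have "l2inner f (L g h) = (\<Sum>\<^sub>\<infinity>k. cnj (f k) * (\<sigma> g (- g + k) * h (- g + k)))"
    by (simp add: l2inner_def L_apply[OF h])
  also have "\<dots> = (\<Sum>\<^sub>\<infinity>j. cnj (f (g + j)) * (\<sigma> g j * h j))"
    by (subst infsum_reindex_bij_betw[OF bij_plus_left[of g], symmetric]) (simp add: add.assoc[symmetric])
  also have "\<dots> = (\<Sum>\<^sub>\<infinity>j. cnj (cnj (\<sigma> g (- g)) * (\<sigma> (- g) (g + j) * f (g + j))) * h j)"
  proof (rule infsum_cong)
    fix j
    have "\<sigma> g (- g) = \<sigma> g j * \<sigma> (- g) (g + j)"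
      using sigma_assoc[of "- g" g j] by (simp add: sigma_inverse)
    then have "\<sigma> g (- g) * cnj (\<sigma> (- g) (g + j)) = \<sigma> g j"
      by (simp add: mult.assoc)
    then show "cnj (f (g + j)) * (\<sigma> g j * h j) =
        cnj (cnj (\<sigma> g (- g)) * (\<sigma> (- g) (g + j) * f (g + j))) * h j"
      by (simp add: mult_ac)
  qed
  also have "\<dots> = l2inner (op_scale (cnj (\<sigma> g (- g))) (L (- g)) f) h"
    by (simp add: l2inner_def op_apply_at L_apply[OF f])
  finally show "l2inner (op_scale (cnj (\<sigma> g (- g))) (L (- g)) f) h = l2inner f (L g h)" ..
qed auto

lemma L_unitary:
  "op_mult (adjoint (L g)) (L g) = L 0" "op_mult (L g) (adjoint (L g)) = L 0"
proof -
  have "op_mult (adjoint (L g)) (L g) = op_scale (cnj (\<sigma> g (- g))) (op_mult (L (- g)) (L g))"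
    by (simp add: adjoint_L fun_eq_iff op_apply_at)
  also have "\<dots> = L 0" unfolding L_mult sigma_inverse[of g]
    by (simp add: fun_eq_iff op_apply_at mult.assoc[symmetric])
  finally show "op_mult (adjoint (L g)) (L g) = L 0" .
  have "op_mult (L g) (adjoint (L g)) = op_scale (cnj (\<sigma> g (- g))) (op_mult (L g) (L (- g)))"
    by (rule op_ext) (auto simp: adjoint_L op_mult_apply op_scale_apply bounded_op_cmult[OF bounded_op_L] L_ell2)
  also have "\<dots> = L 0" unfolding L_mult
    by (simp add: fun_eq_iff op_apply_at mult.assoc[symmetric])
  finally show "op_mult (L g) (adjoint (L g)) = L 0" .
qed

lemma L_unitary_apply:
  assumes "f \<in> ell2"
  shows "adjoint (L g) (L g f) = f" "L g (adjoint (L g) f) = f"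
    and "l2norm (adjoint (L g) f) = l2norm f"
proof -
  show "adjoint (L g) (L g f) = f" using fun_cong[OF L_unitary(1), of g f] assms by (simp add: op_mult_apply)
  show 1: "L g (adjoint (L g) f) = f" using fun_cong[OF L_unitary(2), of g f] assms by (simp add: op_mult_apply)
  show "l2norm (adjoint (L g) f) = l2norm f"
    using L_l2norm[of "adjoint (L g) f" g] assms 1 by (simp add: adjoint_props)
qed

text \<open>This is left twisted convolution by \<open>x\<close>. For a function of infinite support
  the sum defaults to 0, hence the hypothesis \<open>fsupp\<close> in the additivity law.\<close>

definition twist :: "'g vec \<Rightarrow> 'g opr" where
  "twist x = (\<lambda>f k. \<Sum>g | x g \<noteq> 0. x g * L g f k)"

lemma twist_superset:
  assumes "finite F" "{g. x g \<noteq> 0} \<subseteq> F"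
  shows "twist x f k = (\<Sum>g\<in>F. x g * L g f k)"
  unfolding twist_def by (rule sum.mono_neutral_left) (use assms in auto)

lemma twist_zero [simp]: "twist (\<lambda>_. 0) = op_zero"
  by (simp add: twist_def op_zero_def)

lemma twist_delta [simp]: "twist (delta g) = L g"
proof (intro ext)
  fix f k show "twist (delta g) f k = L g f k"
    by (subst twist_superset[of "{g}"]) (auto simp: delta_def)
qed

lemma twist_add:
  assumes "fsupp x" "fsupp y"
  shows "twist (\<lambda>k. x k + y k) = op_add (twist x) (twist y)"
proof (intro ext)
  fix f k
  let ?F = "{g. x g \<noteq> 0} \<union> {g. y g \<noteq> 0}"
  have F: "finite ?F" using assms by (simp add: fsupp_def)
  have s: "{g. x g + y g \<noteq> 0} \<subseteq> ?F" "{g. x g \<noteq> 0} \<subseteq> ?F" "{g. y g \<noteq> 0} \<subseteq> ?F" by auto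
  show "twist (\<lambda>k. x k + y k) f k = op_add (twist x) (twist y) f k"
    unfolding op_add_apply twist_superset[OF F s(1)] twist_superset[OF F s(2)] twist_superset[OF F s(3)]
    by (simp add: distrib_right sum.distrib)
qed

lemma twist_scale: "twist (\<lambda>k. c * x k) = op_scale c (twist x)"
proof (cases "c = 0")
  case True then show ?thesis by (simp add: fun_eq_iff op_apply_at twist_def)
next
  case False then show ?thesis by (simp add: fun_eq_iff op_apply_at twist_def sum_distrib_left mult.assoc)
qed

lemma twist_add_delta:
  "fsupp x \<Longrightarrow> twist (\<lambda>k. x k + c * delta g k) = op_add (twist x) (op_scale c (L g))"
  using twist_add[of x "\<lambda>k. c * delta g k"] by (simp add: twist_scale fsupp_scale)

lemma bounded_op_twist [intro]: "fsupp x \<Longrightarrow> bounded_op (twist x)"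
  by (induction rule: fsupp_induct) (auto simp: twist_add_delta)

lemma twist_apply_delta:
  assumes "fsupp x" shows "twist x (delta h) = (\<lambda>k. \<sigma> (k - h) h * x (k - h))"
  using assms
proof (induction rule: fsupp_induct)
  case (add x g c)
  have "delta (g + h) k = delta g (k - h)" for k by (auto simp: delta_def algebra_simps)
  moreover have "c * (\<sigma> g h * delta g (k - h)) = \<sigma> (k - h) h * (c * delta g (k - h))" for k
    by (simp add: delta_def)
  ultimately show ?case using add by (simp add: twist_add_delta L_delta fun_eq_iff op_apply_at distrib_left)
qed (simp add: op_zero_apply)

text \<open>The unit vector at the identity recovers the coefficients. For this reason
  \<open>a (delta 0)\<close> serves as the coefficient function of \<open>a\<close>, also for
  \<open>a\<close> in the completion.\<close>

lemma twist_delta_zero: "fsupp x \<Longrightarrow> twist x (delta 0) = x"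
  by (simp add: twist_apply_delta)

section \<open>The dense subalgebra of finite linear combinations\<close>

definition fin_alg :: "'g opr set" where
  "fin_alg = {twist x | x. fsupp x}"

lemma fin_alg_bounded [intro]: "a \<in> fin_alg \<Longrightarrow> bounded_op a"
  by (auto simp: fin_alg_def)

lemma fin_alg_coeff: assumes "a \<in> fin_alg" shows "fsupp (a (delta 0))" "a = twist (a (delta 0))"
  using assms by (auto simp: fin_alg_def twist_delta_zero)

lemma fin_alg_zero [simp]: "op_zero \<in> fin_alg"
  unfolding fin_alg_def by (auto intro!: exI[of _ "\<lambda>_. 0"])

lemma fin_alg_L [simp]: "L g \<in> fin_alg"
  unfolding fin_alg_def by (auto intro!: exI[of _ "delta g"])

lemma fin_alg_add [intro]: "a \<in> fin_alg \<Longrightarrow> b \<in> fin_alg \<Longrightarrow> op_add a b \<in> fin_alg"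
  unfolding fin_alg_def by (auto simp flip: twist_add)

lemma fin_alg_scale [intro]: "a \<in> fin_alg \<Longrightarrow> op_scale c a \<in> fin_alg"
  unfolding fin_alg_def by (auto simp flip: twist_scale)

lemma fin_alg_induct [consumes 1, case_names zero add]:
  assumes "a \<in> fin_alg" "P op_zero"
    and step: "\<And>a g c. a \<in> fin_alg \<Longrightarrow> P a \<Longrightarrow> P (op_add a (op_scale c (L g)))"
  shows "P a"
proof -
  obtain x where "fsupp x" and a: "a = twist x" using assms(1) by (auto simp: fin_alg_def)
  then have "P (twist x)"
  proof (induction arbitrary: a rule: fsupp_induct)
    case (add x g c)
    then show ?case using step[of "twist x"] by (auto simp: twist_add_delta fin_alg_def)
  qed (simp add: assms(2))
  then show ?thesis using a by simp
qed

lemma op_mult_add_left: "op_mult (op_add a b) c = op_add (op_mult a c) (op_mult b c)"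
  by (simp add: fun_eq_iff op_apply_at)

lemma op_mult_scale_left: "op_mult (op_scale s a) c = op_scale s (op_mult a c)"
  by (simp add: fun_eq_iff op_apply_at)

lemma op_mult_add_right:
  assumes "bounded_op a" "bounded_op b" "bounded_op c"
  shows "op_mult a (op_add b c) = op_add (op_mult a b) (op_mult a c)"
  by (rule op_ext) (use assms in \<open>auto simp: op_add_apply op_mult_apply bounded_op_add[OF assms(1)] bounded_op_ell2\<close>)

lemma op_mult_scale_right:
  assumes "bounded_op a" "bounded_op b"
  shows "op_mult a (op_scale s b) = op_scale s (op_mult a b)"
  by (rule op_ext) (use assms in \<open>auto simp: op_scale_apply op_mult_apply bounded_op_cmult[OF assms(1)] bounded_op_ell2\<close>)

lemma op_mult_zero_left [simp]: "op_mult op_zero a = op_zero"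
  by (simp add: fun_eq_iff op_apply_at)

lemma op_mult_zero_right [simp]: "bounded_op a \<Longrightarrow> op_mult a op_zero = op_zero"
  by (simp add: fun_eq_iff op_apply_at bounded_op_zero op_zero_apply)

lemma op_mult_assoc: "op_mult (op_mult a b) c = op_mult a (op_mult b c)"
  by (simp add: fun_eq_iff op_apply_at op_mult_apply)

lemma fin_alg_mult [intro]:
  assumes "a \<in> fin_alg" "b \<in> fin_alg" shows "op_mult a b \<in> fin_alg"
  using assms(1)
proof (induction rule: fin_alg_induct)
  case (add a g c)
  have "op_mult (L g) b \<in> fin_alg" using assms(2)
  proof (induction rule: fin_alg_induct)
    case (add b h d)
    have eq: "op_mult (L g) (op_add b (op_scale d (L h))) =
        op_add (op_mult (L g) b) (op_scale d (op_scale (\<sigma> g h) (L (g + h))))"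
      using add by (simp add: op_mult_add_right op_mult_scale_right L_mult fin_alg_bounded bounded_op_op_scale)
    show ?case unfolding eq using add by (intro fin_alg_add fin_alg_scale fin_alg_L)
  qed simp
  then show ?case unfolding op_mult_add_left op_mult_scale_left
    using add by (intro fin_alg_add fin_alg_scale)
qed simp

lemma fin_alg_adjoint [intro]:
  assumes "a \<in> fin_alg" shows "adjoint a \<in> fin_alg"
  using assms
proof (induction rule: fin_alg_induct)
  case (add a g c)
  have eq: "adjoint (op_add a (op_scale c (L g))) =
      op_add (adjoint a) (op_scale (cnj c) (op_scale (cnj (\<sigma> g (- g))) (L (- g))))"
    using add by (simp add: adjoint_op_add adjoint_op_scale adjoint_L fin_alg_bounded bounded_op_op_scale)
  show ?case unfolding eq using add by (intro fin_alg_add fin_alg_scale fin_alg_L)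
qed simp

lemma fin_alg_subset: "a \<in> fin_alg \<Longrightarrow> a \<in> A"
proof (induction rule: fin_alg_induct)
  case zero
  have "op_zero = op_scale 0 (L 0)" by (simp add: fun_eq_iff op_apply_at)
  then show ?case using reduced_twisted.scale[OF reduced_twisted.gen] by metis
next
  case (add a g c)
  then show ?case by (intro reduced_twisted.add reduced_twisted.scale reduced_twisted.gen)
qed

text \<open>The bounded operators approximable by finite combinations are closed under every rule
  that generates \<open>A\<close>. Boundedness is carried along because the supremum in
  \<open>opnorm\<close> is meaningful only for bounded operators.\<close>

lemma A_approx:
  assumes "a \<in> A"
  shows "bounded_op a \<and> (\<forall>e>0. \<exists>b\<in>fin_alg. opnorm (op_diff a b) < e)"
  using assms
proof (induction rule: reduced_twisted.induct)
  case (gen g)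
  have "opnorm (op_diff (L g) (L g)) = 0"
    using opnorm_zero by (simp add: op_zero_def op_add_def op_scale_def)
  then have "\<exists>b\<in>fin_alg. opnorm (op_diff (L g) b) < e" if "e > 0" for e
    using that by (intro bexI[of _ "L g"]) simp_all
  then show ?case using bounded_op_L by blast
next
  case (add a b)
  have "\<exists>d\<in>fin_alg. opnorm (op_diff (op_add a b) d) < e" if "e > 0" for e
  proof -
    have "e/2 > 0" using that by simp
    then obtain a' b' where ab: "a' \<in> fin_alg" "b' \<in> fin_alg"
        "opnorm (op_diff a a') < e/2" "opnorm (op_diff b b') < e/2"
      using add.IH by blast
    have "op_diff (op_add a b) (op_add a' b') = op_add (op_diff a a') (op_diff b b')"
      by (simp add: fun_eq_iff op_apply_at)
    then have "opnorm (op_diff (op_add a b) (op_add a' b')) \<le> opnorm (op_diff a a') + opnorm (op_diff b b')"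
      using opnorm_add_le[of "op_diff a a'" "op_diff b b'"] add.IH ab
      by (simp add: bounded_op_op_add bounded_op_op_scale fin_alg_bounded)
    then have "opnorm (op_diff (op_add a b) (op_add a' b')) < e" using ab by linarith
    then show ?thesis using ab by blast
  qed
  then show ?case using add.IH bounded_op_op_add by blast
next
  case (scale a c)
  have "\<exists>d\<in>fin_alg. opnorm (op_diff (op_scale c a) d) < e" if "e > 0" for e
  proof -
    have "e / (cmod c + 1) > 0" using that by (simp add: add_nonneg_pos)
    then obtain a' where a': "a' \<in> fin_alg" "opnorm (op_diff a a') < e / (cmod c + 1)"
      using scale.IH by blast
    have b: "bounded_op (op_diff a a')" using scale a' by auto
    have "op_diff (op_scale c a) (op_scale c a') = op_scale c (op_diff a a')"
      by (simp add: fun_eq_iff op_apply_at right_diff_distrib)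
    then have "opnorm (op_diff (op_scale c a) (op_scale c a')) \<le> cmod c * opnorm (op_diff a a')"
      using opnorm_scale_le[OF b, of c] by simp
    also have "\<dots> \<le> (cmod c + 1) * opnorm (op_diff a a')"
      by (intro mult_right_mono opnorm_nonneg b) simp
    also have "\<dots> < e" using a'(2) by (simp add: less_divide_eq add_nonneg_pos mult.commute)
    finally show ?thesis using a' by blast
  qed
  then show ?case using scale.IH bounded_op_op_scale by blast
next
  case (mult a b)
  have "\<exists>d\<in>fin_alg. opnorm (op_diff (op_mult a b) d) < e" if "e > 0" for e
  proof -
    have ba: "bounded_op a" and bb: "bounded_op b" using mult by auto
    \<comment> \<open>The approximant \<open>b'\<close> is chosen first, since the accuracy required
      of \<open>a'\<close> depends on its norm. Adding 1 keeps the divisors positive.\<close>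
    define s where "s = opnorm a + 1"
    have s: "s > 0" using opnorm_nonneg[OF ba] by (simp add: s_def)
    have "e / (2 * s) > 0" using that s by simp
    then obtain b' where b': "b' \<in> fin_alg" "opnorm (op_diff b b') < e / (2 * s)"
      using mult.IH by blast
    have bb': "bounded_op b'" using b' by auto
    define t' where "t' = opnorm b' + 1"
    have t': "t' > 0" using opnorm_nonneg[OF bb'] by (auto simp: t'_def)
    have "e / (2 * t') > 0" using that t' by simp
    then obtain a' where a': "a' \<in> fin_alg" "opnorm (op_diff a a') < e / (2 * t')"
      using mult.IH by blast
    have ba': "bounded_op a'" using a' by auto
    have eq: "op_diff (op_mult a b) (op_mult a' b') =
        op_add (op_mult a (op_diff b b')) (op_mult (op_diff a a') b')"
      using ba bb ba' bb'
      by (simp add: op_mult_add_right op_mult_scale_right op_mult_add_left op_mult_scale_left bounded_op_op_scale)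
        (simp add: fun_eq_iff op_apply_at)
    have "opnorm (op_mult a (op_diff b b')) \<le> opnorm a * opnorm (op_diff b b')"
      using ba bb bb' by (intro opnorm_mult_le) auto
    also have "\<dots> \<le> s * opnorm (op_diff b b')"
      using bb bb' by (intro mult_right_mono opnorm_nonneg) (auto simp: s_def)
    also have "\<dots> < e / 2" using b'(2) s by (simp add: field_simps)
    finally have 1: "opnorm (op_mult a (op_diff b b')) < e / 2" .
    have "opnorm (op_mult (op_diff a a') b') \<le> opnorm (op_diff a a') * opnorm b'"
      using ba ba' bb' by (intro opnorm_mult_le) auto
    also have "\<dots> \<le> opnorm (op_diff a a') * t'"
      using ba ba' by (intro mult_left_mono opnorm_nonneg) (auto simp: t'_def)
    also have "\<dots> < e / 2" using a'(2) t' by (simp add: field_simps)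
    finally have 2: "opnorm (op_mult (op_diff a a') b') < e / 2" .
    have "opnorm (op_diff (op_mult a b) (op_mult a' b')) \<le>
        opnorm (op_mult a (op_diff b b')) + opnorm (op_mult (op_diff a a') b')"
      unfolding eq using ba bb ba' bb' by (intro opnorm_add_le bounded_op_op_add bounded_op_op_mult bounded_op_op_scale)
    then have "opnorm (op_diff (op_mult a b) (op_mult a' b')) < e" using 1 2 by linarith
    then show ?thesis using a' b' by blast
  qed
  then show ?case using mult.IH bounded_op_op_mult by blast
next
  case (adj a)
  have "\<exists>d\<in>fin_alg. opnorm (op_diff (adjoint a) d) < e" if e: "e > 0" for e
  proof -
    obtain a' where a': "a' \<in> fin_alg" "opnorm (op_diff a a') < e"
      using adj.IH e by blast
    note b = adj.IH[THEN conjunct1] fin_alg_bounded[OF a'(1)]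
    have "adjoint (op_diff a a') = op_diff (adjoint a) (adjoint a')"
      using b by (simp add: adjoint_op_add adjoint_op_scale bounded_op_op_scale)
    then have "opnorm (op_diff (adjoint a) (adjoint a')) \<le> opnorm (op_diff a a')"
      using opnorm_adjoint_le[OF bounded_op_op_add[OF b(1) bounded_op_op_scale[OF b(2)]], of "-1"] by simp
    then have "opnorm (op_diff (adjoint a) (adjoint a')) < e" using a'(2) by linarith
    then show ?thesis using fin_alg_adjoint[OF a'(1)] by blast
  qed
  then show ?case using adj.IH bounded_op_adjoint by blast
next
  case (lim s T)
  have "\<exists>d\<in>fin_alg. opnorm (op_diff T d) < e" if "e > 0" for e
  proof -
    have "\<forall>\<^sub>F n in sequentially. opnorm (op_diff (s n) T) < e/2"
      using order_tendstoD(2)[OF lim(3), of "e/2"] that by simp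
    then obtain n where n: "opnorm (op_diff (s n) T) < e/2" by (auto simp: eventually_sequentially)
    have e2: "e/2 > 0" using that by simp
    have sn: "bounded_op (s n)" "\<forall>e>0. \<exists>b\<in>fin_alg. opnorm (op_diff (s n) b) < e"
      using lim(1) by blast+
    obtain d where d: "d \<in> fin_alg" "opnorm (op_diff (s n) d) < e/2" using sn(2) e2 by blast
    have "opnorm (op_diff T d) < e"
      using op_diff_triangle[OF lim(2) sn(1) fin_alg_bounded[OF d(1)]] op_diff_commute[of T "s n"] n d(2)
      by linarith
    then show ?thesis using d by blast
  qed
  then show ?case using lim(2) by blast
qed

lemma A_bounded [intro]: "a \<in> A \<Longrightarrow> bounded_op a"
  using A_approx by blast

lemma A_approxE:
  assumes "a \<in> A" "e > 0"
  obtains b where "b \<in> fin_alg" "opnorm (op_diff a b) < e"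
  using A_approx assms by blast

lemma L_in_A [simp]: "L g \<in> A"
  by (rule reduced_twisted.gen)

end

section \<open>Averaging maps\<close>

lemma closed_idealD:
  assumes "closed_ideal B I"
  shows "x \<in> I \<Longrightarrow> x \<in> B" "x \<in> I \<Longrightarrow> y \<in> I \<Longrightarrow> op_add x y \<in> I" "x \<in> I \<Longrightarrow> op_scale c x \<in> I"
    "a \<in> B \<Longrightarrow> x \<in> I \<Longrightarrow> op_mult a x \<in> I" "a \<in> B \<Longrightarrow> x \<in> I \<Longrightarrow> op_mult x a \<in> I"
  using assms unfolding closed_ideal_def by auto

lemma closed_ideal_limit:
  assumes "closed_ideal B I" "\<forall>n. s n \<in> I" "T \<in> B" "(\<lambda>n. opnorm (op_diff (s n) T)) \<longlonglongrightarrow> 0"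
  shows "T \<in> I"
proof -
  have "\<forall>s T. (\<forall>n. s n \<in> I) \<and> T \<in> B \<and> (\<lambda>n. opnorm (op_diff (s n) T)) \<longlonglongrightarrow> 0 \<longrightarrow> T \<in> I"
    using assms(1) unfolding closed_ideal_def by (elim conjE)
  from this[THEN spec, THEN spec, THEN mp, OF conjI[OF assms(2) conjI[OF assms(3,4)]]] show ?thesis .
qed

lemma tracial_stateD:
  assumes "tracial_state B \<phi>"
  shows "a \<in> B \<Longrightarrow> b \<in> B \<Longrightarrow> \<phi> (op_add a b) = \<phi> a + \<phi> b" "a \<in> B \<Longrightarrow> \<phi> (op_scale c a) = c * \<phi> a"
    "a \<in> B \<Longrightarrow> \<phi> (op_mult (adjoint a) a) \<in> \<real>" "a \<in> B \<Longrightarrow> 0 \<le> Re (\<phi> (op_mult (adjoint a) a))"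
    "\<exists>K. \<forall>a\<in>B. cmod (\<phi> a) \<le> K * opnorm a" "Sup {cmod (\<phi> a) | a. a \<in> B \<and> opnorm a \<le> 1} = 1"
    "a \<in> B \<Longrightarrow> b \<in> B \<Longrightarrow> \<phi> (op_mult a b) = \<phi> (op_mult b a)" "a \<notin> B \<Longrightarrow> \<phi> a = 0"
  using assms unfolding tracial_state_def by simp_all

context twisted_group
begin

lemma L_delta_zero [simp]: "L g (delta 0) = delta g"
  by (simp add: L_delta)

lemma cmod_matrix_entry_le:
  assumes "bounded_op a" shows "cmod (a (delta g) k) \<le> opnorm a"
proof -
  have "cmod (a (delta g) k) \<le> l2norm (a (delta g))"
    by (rule cmod_le_l2norm[OF bounded_op_ell2[OF assms ell2_delta]])
  also have "\<dots> \<le> opnorm a" using opnorm_apply[OF assms ell2_delta[of g]] by simp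
  finally show ?thesis .
qed

text \<open>The matrix of a finite combination is constant along diagonals up to the cocycle, as for
  a Toeplitz matrix. Matrix entries are norm-continuous, so this survives in the closure.\<close>

lemma A_matrix_entry:
  assumes "a \<in> A" shows "a (delta g) k = \<sigma> (k - g) g * a (delta 0) (k - g)"
proof -
  let ?d = "\<lambda>a. a (delta g) k - \<sigma> (k - g) g * a (delta 0) (k - g)"
  have "cmod (?d a) \<le> 0 + e" if e: "e > 0" for e
  proof -
    have "e/2 > 0" using e by simp
    then obtain b where b: "b \<in> fin_alg" "opnorm (op_diff a b) < e/2" by (rule A_approxE[OF assms])
    have bd: "bounded_op (op_diff a b)" using assms b by (intro bounded_op_op_add bounded_op_op_scale) auto
    have "?d b = 0"
      using b(1) by (auto simp: fin_alg_def twist_apply_delta)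
    then have "?d a = op_diff a b (delta g) k - \<sigma> (k - g) g * op_diff a b (delta 0) (k - g)"
      by (simp add: op_apply_at algebra_simps)
    then have "cmod (?d a) \<le> cmod (op_diff a b (delta g) k) + cmod (op_diff a b (delta 0) (k - g))"
      using norm_triangle_ineq4 by (metis cmod_sigma mult.left_neutral norm_mult)
    also have "\<dots> \<le> e" using cmod_matrix_entry_le[OF bd, of g k] cmod_matrix_entry_le[OF bd, of 0 "k - g"] b
      by linarith
    finally show ?thesis by simp
  qed
  then have "cmod (?d a) \<le> 0" by (rule field_le_epsilon)
  then show ?thesis by simp
qed

text \<open>The column at the identity determines all the others, so \<open>delta 0\<close> is a
  separating vector. This is the faithfulness of the canonical trace.\<close>

lemma A_faithful:
  assumes "a \<in> A" "a (delta 0) = (\<lambda>_. 0)" shows "a = op_zero"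
proof (rule op_ext_delta)
  fix g show "a (delta g) = op_zero (delta g)"
    using A_matrix_entry[OF assms(1), of g] assms(2) by (simp add: fun_eq_iff op_apply_at)
qed (use assms in auto)

text \<open>The phase picked up when \<open>L g\<close> conjugates \<open>L h\<close>. When
  \<open>g\<close> and \<open>h\<close> commute it is
  \<open>\<sigma> g h * cnj (\<sigma> h g)\<close>, so \<open>h\<close> is regular exactly if it
  equals 1 for all \<open>g\<close> commuting with \<open>h\<close>.\<close>

definition gamma :: "'g \<Rightarrow> 'g \<Rightarrow> complex" where
  "gamma g h = \<sigma> g h * cnj (\<sigma> (g + h - g) g)"

lemma cmod_gamma [simp]: "cmod (gamma g h) = 1"
  by (simp add: gamma_def norm_mult)

section \<open>Conjugation by the unitaries and its convex combinations\<close>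

definition Ad :: "'g \<Rightarrow> 'g opr \<Rightarrow> 'g opr" where
  "Ad g a = op_mult (op_mult (L g) a) (adjoint (L g))"

lemma Ad_apply: "Ad g a f = L g (a (adjoint (L g) f))"
  by (simp add: Ad_def op_mult_apply)

lemma bounded_op_Ad [intro]: "bounded_op a \<Longrightarrow> bounded_op (Ad g a)"
  unfolding Ad_def by (intro bounded_op_op_mult bounded_op_adjoint) auto

lemma fin_alg_Ad: "a \<in> fin_alg \<Longrightarrow> Ad g a \<in> fin_alg"
  unfolding Ad_def by (intro fin_alg_mult fin_alg_adjoint fin_alg_L)

lemma A_Ad: "a \<in> A \<Longrightarrow> Ad g a \<in> A"
  unfolding Ad_def by (intro reduced_twisted.mult reduced_twisted.adj L_in_A)

lemma Ad_add: "bounded_op a \<Longrightarrow> bounded_op b \<Longrightarrow> Ad g (op_add a b) = op_add (Ad g a) (Ad g b)"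
  by (simp add: Ad_def op_mult_add_right op_mult_add_left)

lemma Ad_scale: "bounded_op a \<Longrightarrow> Ad g (op_scale c a) = op_scale c (Ad g a)"
  by (simp add: Ad_def op_mult_scale_right op_mult_scale_left)

lemma Ad_one [simp]: "Ad g (L 0) = L 0"
  by (simp add: Ad_def L_unitary)

lemma Ad_zero [simp]: "Ad g op_zero = op_zero"
  by (simp add: Ad_def)

lemma Ad_zero_left [simp]: "bounded_op a \<Longrightarrow> Ad 0 a = a"
  by (simp add: Ad_def)

lemma Ad_L: "Ad g (L h) = op_scale (gamma g h) (L (g + h - g))"
proof -
  have e: "(g + h - g) + g = g + h" by simp
  have "L (g + h) = op_scale (cnj (\<sigma> (g + h - g) g)) (op_mult (L (g + h - g)) (L g))"
    unfolding L_mult e by (simp add: fun_eq_iff op_apply_at mult.assoc[symmetric])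
  then have "op_mult (L (g + h)) (adjoint (L g)) =
      op_scale (cnj (\<sigma> (g + h - g) g)) (op_mult (L (g + h - g)) (op_mult (L g) (adjoint (L g))))"
    by (simp add: op_mult_scale_left op_mult_assoc)
  also have "\<dots> = op_scale (cnj (\<sigma> (g + h - g) g)) (L (g + h - g))"
    by (simp add: L_unitary)
  finally show ?thesis unfolding Ad_def L_mult op_mult_scale_left
    by (simp add: fun_eq_iff op_apply_at gamma_def mult.assoc)
qed

lemma Ad_coeff:
  assumes "a \<in> fin_alg" shows "Ad g a (delta 0) (g + k - g) = gamma g k * a (delta 0) k"
  using assms
proof (induction rule: fin_alg_induct)
  case zero show ?case unfolding Ad_zero by (simp add: op_apply_at)
next
  case (add a h c)
  have "g + k - g = g + h - g \<longleftrightarrow> k = h" by (metis add_diff_cancel add_left_cancel diff_add_cancel)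
  then have d: "delta (g + h - g) (g + k - g) = delta h k" by (simp add: delta_def)
  have c: "gamma g h * delta h k = gamma g k * delta h k" by (simp add: delta_def)
  have eq: "Ad g (op_add a (op_scale c (L h))) =
      op_add (Ad g a) (op_scale c (op_scale (gamma g h) (L (g + h - g))))"
    using add by (simp add: Ad_add Ad_scale Ad_L fin_alg_bounded bounded_op_op_scale)
  show ?case unfolding eq unfolding op_apply_at add.IH L_delta_zero d c by (simp add: algebra_simps)
qed

text \<open>The averages are kept as maps rather than as points in the convex hull of an orbit,
  because the Kadison inequality must apply one and the same average to two elements.\<close>

inductive_set avg :: "('g opr \<Rightarrow> 'g opr) set" where
  id: "(\<lambda>a. a) \<in> avg"
| Ad: "\<Phi> \<in> avg \<Longrightarrow> (\<lambda>a. Ad g (\<Phi> a)) \<in> avg"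
| convex: "\<Phi> \<in> avg \<Longrightarrow> \<Psi> \<in> avg \<Longrightarrow> 0 \<le> t \<Longrightarrow> t \<le> 1 \<Longrightarrow>
    (\<lambda>a. op_add (op_scale (of_real t) (\<Phi> a)) (op_scale (of_real (1 - t)) (\<Psi> a))) \<in> avg"

lemma avg_comp: "\<Phi> \<in> avg \<Longrightarrow> \<Psi> \<in> avg \<Longrightarrow> (\<lambda>a. \<Phi> (\<Psi> a)) \<in> avg"
proof (induction rule: avg.induct)
  case (Ad \<Phi> g)
  then show ?case by (intro avg.Ad)
next
  case (convex \<Phi> \<Phi>' t)
  then show ?case by (intro avg.convex)
qed

lemma avg_bounded: "\<Phi> \<in> avg \<Longrightarrow> bounded_op a \<Longrightarrow> bounded_op (\<Phi> a)"
  by (induction rule: avg.induct) (auto intro: bounded_op_Ad bounded_op_op_add bounded_op_op_scale)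

lemma avg_fin_alg: "\<Phi> \<in> avg \<Longrightarrow> a \<in> fin_alg \<Longrightarrow> \<Phi> a \<in> fin_alg"
  by (induction rule: avg.induct) (auto intro: fin_alg_Ad fin_alg_add fin_alg_scale)

lemma avg_A: "\<Phi> \<in> avg \<Longrightarrow> a \<in> A \<Longrightarrow> \<Phi> a \<in> A"
  by (induction rule: avg.induct) (auto intro: A_Ad reduced_twisted.add reduced_twisted.scale)

lemma avg_add:
  "\<Phi> \<in> avg \<Longrightarrow> bounded_op a \<Longrightarrow> bounded_op b \<Longrightarrow> \<Phi> (op_add a b) = op_add (\<Phi> a) (\<Phi> b)"
proof (induction rule: avg.induct)
  case (convex \<Phi> \<Psi> t)
  then show ?case by (simp add: fun_eq_iff op_apply_at algebra_simps)
qed (auto simp: Ad_add avg_bounded)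

lemma avg_scale: "\<Phi> \<in> avg \<Longrightarrow> bounded_op a \<Longrightarrow> \<Phi> (op_scale c a) = op_scale c (\<Phi> a)"
proof (induction rule: avg.induct)
  case (convex \<Phi> \<Psi> t)
  then show ?case by (simp add: fun_eq_iff op_apply_at algebra_simps)
qed (auto simp: Ad_scale avg_bounded)

lemma avg_one: "\<Phi> \<in> avg \<Longrightarrow> \<Phi> (L 0) = L 0"
proof (induction rule: avg.induct)
  case (convex \<Phi> \<Psi> t)
  then show ?case by (simp add: fun_eq_iff op_apply_at algebra_simps)
qed auto

lemma opnorm_Ad_le:
  assumes "bounded_op a" shows "opnorm (Ad g a) \<le> opnorm a"
proof (rule opnorm_le)
  fix f :: "'g vec" assume f: "f \<in> ell2"
  then have f': "adjoint (L g) f \<in> ell2" by (simp add: adjoint_props)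
  have "l2norm (Ad g a f) = l2norm (a (adjoint (L g) f))"
    using f' assms by (simp add: Ad_apply L_l2norm bounded_op_ell2)
  also have "\<dots> \<le> opnorm a * l2norm (adjoint (L g) f)" by (rule opnorm_apply[OF assms f'])
  also have "\<dots> = opnorm a * l2norm f" using f by (simp add: L_unitary_apply)
  finally show "l2norm (Ad g a f) \<le> opnorm a * l2norm f" .
qed (simp add: assms opnorm_nonneg)

lemma avg_opnorm_le: "\<Phi> \<in> avg \<Longrightarrow> bounded_op a \<Longrightarrow> opnorm (\<Phi> a) \<le> opnorm a"
proof (induction rule: avg.induct)
  case (Ad \<Phi> g)
  then show ?case using opnorm_Ad_le[OF avg_bounded[OF Ad(1,3)], of g] by simp
next
  case (convex \<Phi> \<Psi> t)
  have b: "bounded_op (\<Phi> a)" "bounded_op (\<Psi> a)" using convex avg_bounded by blast+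
  have "opnorm (op_add (op_scale (of_real t) (\<Phi> a)) (op_scale (of_real (1 - t)) (\<Psi> a)))
      \<le> opnorm (op_scale (of_real t) (\<Phi> a)) + opnorm (op_scale (of_real (1 - t)) (\<Psi> a))"
    using b by (intro opnorm_add_le bounded_op_op_scale)
  also have "\<dots> \<le> t * opnorm (\<Phi> a) + (1 - t) * opnorm (\<Psi> a)"
    using opnorm_scale_le[OF b(1), of "of_real t"] opnorm_scale_le[OF b(2), of "of_real (1 - t)"] convex(3,4)
    by (simp flip: of_real_diff)
  also have "\<dots> \<le> t * opnorm a + (1 - t) * opnorm a"
    using convex by (intro add_mono mult_left_mono) auto
  finally show ?case by (simp add: algebra_simps)
qed simp

lemma avg_ideal:
  assumes J: "closed_ideal A J" shows "\<Phi> \<in> avg \<Longrightarrow> a \<in> J \<Longrightarrow> \<Phi> a \<in> J"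
proof (induction rule: avg.induct)
  case (Ad \<Phi> g)
  then show ?case unfolding Ad_def
    by (intro closed_idealD(4,5)[OF J] reduced_twisted.adj L_in_A) simp
next
  case (convex \<Phi> \<Psi> t)
  then show ?case by (intro closed_idealD(2,3)[OF J]) simp_all
qed

lemma avg_trace:
  assumes tr: "tracial_state A \<phi>" shows "\<Phi> \<in> avg \<Longrightarrow> a \<in> A \<Longrightarrow> \<phi> (\<Phi> a) = \<phi> a"
proof (induction rule: avg.induct)
  case (Ad \<Phi> g)
  have b: "\<Phi> a \<in> A" using avg_A Ad by blast
  then have "\<phi> (Ad g (\<Phi> a)) = \<phi> (op_mult (adjoint (L g)) (op_mult (L g) (\<Phi> a)))"
    unfolding Ad_def by (intro tracial_stateD(7)[OF tr] reduced_twisted.adj reduced_twisted.mult L_in_A)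
  also have "op_mult (adjoint (L g)) (op_mult (L g) (\<Phi> a)) = \<Phi> a"
    using b by (simp add: op_mult_assoc[symmetric] L_unitary A_bounded)
  finally show ?case using Ad by simp
next
  case (convex \<Phi> \<Psi> t)
  have b: "\<Phi> a \<in> A" "\<Psi> a \<in> A" using avg_A convex by blast+
  have "\<phi> (op_add (op_scale (of_real t) (\<Phi> a)) (op_scale (of_real (1 - t)) (\<Psi> a)))
      = \<phi> (op_scale (of_real t) (\<Phi> a)) + \<phi> (op_scale (of_real (1 - t)) (\<Psi> a))"
    using b by (intro tracial_stateD(1)[OF tr] reduced_twisted.scale)
  also have "\<dots> = of_real t * \<phi> (\<Phi> a) + of_real (1 - t) * \<phi> (\<Psi> a)"
    using b by (simp only: tracial_stateD(2)[OF tr])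
  also have "\<dots> = \<phi> a" using convex by (simp add: algebra_simps)
  finally show ?case .
qed simp

text \<open>The hypothesis says \<open>b* b \<le> c\<close> as quadratic forms. A conjugation merely
  moves the test vector by a unitary, and a convex combination is handled by convexity of the
  square.\<close>

lemma avg_kadison:
  assumes "bounded_op b" "bounded_op c"
    and le: "\<And>f. f \<in> ell2 \<Longrightarrow> (l2norm (b f))\<^sup>2 \<le> Re (l2inner f (c f))"
  shows "\<Phi> \<in> avg \<Longrightarrow> f \<in> ell2 \<Longrightarrow> (l2norm (\<Phi> b f))\<^sup>2 \<le> Re (l2inner f (\<Phi> c f))"
proof (induction arbitrary: f rule: avg.induct)
  case id then show ?case by (rule le)
next
  case (Ad \<Phi> g)
  have f': "adjoint (L g) f \<in> ell2" using Ad by (simp add: adjoint_props)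
  have b: "bounded_op (\<Phi> b)" "bounded_op (\<Phi> c)" using Ad avg_bounded assms by blast+
  have 1: "l2norm (Ad g (\<Phi> b) f) = l2norm (\<Phi> b (adjoint (L g) f))"
    using f' b by (simp add: Ad_apply L_l2norm bounded_op_ell2)
  have 2: "l2inner f (Ad g (\<Phi> c) f) = l2inner (adjoint (L g) f) (\<Phi> c (adjoint (L g) f))"
    unfolding Ad_apply using Ad f' b by (intro adjoint_props(3)[symmetric]) auto
  show ?case unfolding 1 2 by (rule Ad.IH[OF f'])
next
  case (convex \<Phi> \<Psi> t)
  have b: "\<Phi> b f \<in> ell2" "\<Psi> b f \<in> ell2" "\<Phi> c f \<in> ell2" "\<Psi> c f \<in> ell2"
    using convex avg_bounded assms bounded_op_ell2 by blast+
  let ?u = "\<lambda>x. complex_of_real t * \<Phi> b f x" and ?v = "\<lambda>x. complex_of_real (1 - t) * \<Psi> b f x"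
  define p q where "p = l2norm (\<Phi> b f)" and "q = l2norm (\<Psi> b f)"
  have "l2norm (\<lambda>x. ?u x + ?v x) \<le> l2norm ?u + l2norm ?v"
    using b by (intro l2norm_triangle ell2_scale)
  also have "\<dots> = t * p + (1 - t) * q"
    unfolding l2norm_cmult p_def q_def norm_of_real using convex by simp
  finally have "(l2norm (\<lambda>x. ?u x + ?v x))\<^sup>2 \<le> (t * p + (1 - t) * q)\<^sup>2"
    by (rule power_mono) simp
  also have "\<dots> = t * p\<^sup>2 + (1 - t) * q\<^sup>2 - t * (1 - t) * (p - q)\<^sup>2"
    by (simp add: power2_eq_square algebra_simps)
  also have "\<dots> \<le> t * p\<^sup>2 + (1 - t) * q\<^sup>2" using convex by simp
  also have "\<dots> \<le> t * Re (l2inner f (\<Phi> c f)) + (1 - t) * Re (l2inner f (\<Psi> c f))"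
    unfolding p_def q_def using convex by (intro add_mono mult_left_mono) auto
  also have "\<dots> = Re (l2inner f (\<lambda>x. of_real t * \<Phi> c f x + of_real (1 - t) * \<Psi> c f x))"
    using b convex by (subst l2inner_add_right) (auto simp: l2inner_cmult_right simp del: of_real_diff)
  finally show ?case by (simp add: op_add_apply op_scale_apply)
qed

lemma conj_class_trans: "k \<in> conj_class h \<Longrightarrow> h \<in> conj_class g \<Longrightarrow> k \<in> conj_class g"
proof -
  assume "k \<in> conj_class h" "h \<in> conj_class g"
  then obtain s t where "k = s + h - s" "h = t + g - t" by (auto simp: conj_class_def)
  then have "k = (s + t) + g - (s + t)" by (simp add: add.assoc diff_conv_add_uminus minus_add del: add_uminus_conv_diff)
  then show ?thesis by (auto simp: conj_class_def)
qed

lemma conj_class_self: "(g::'g) \<in> conj_class g"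
  by (auto simp: conj_class_def intro!: exI[of _ 0])

lemma conj_undo: "g + (- g + k + g) - g = (k :: 'g)"
  by (simp add: add.assoc[symmetric])

lemma conj_class_undo: "k \<in> conj_class (- g + k + g :: 'g)"
  using conj_undo[of g k] by (auto simp: conj_class_def intro!: exI[of _ g])

text \<open>Conjugation permutes the group elements up to phases, so no average leaves the conjugacy
  classes that meet the support of \<open>a\<close>.\<close>

lemma avg_support:
  assumes a: "a \<in> fin_alg"
  shows "\<Phi> \<in> avg \<Longrightarrow> \<Phi> a (delta 0) k \<noteq> 0 \<Longrightarrow> \<exists>g. a (delta 0) g \<noteq> 0 \<and> k \<in> conj_class g"
proof (induction arbitrary: k rule: avg.induct)
  case id
  then show ?case using conj_class_self by blast
next
  case (Ad \<Phi> g)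
  have "Ad g (\<Phi> a) (delta 0) k = gamma g (- g + k + g) * \<Phi> a (delta 0) (- g + k + g)"
    using Ad_coeff[OF avg_fin_alg[OF Ad(1) a], of g "- g + k + g"] by (simp add: conj_undo)
  then have "\<Phi> a (delta 0) (- g + k + g) \<noteq> 0" using Ad.prems by auto
  then obtain h where "a (delta 0) h \<noteq> 0" "- g + k + g \<in> conj_class h" using Ad.IH by blast
  then show ?case using conj_class_trans conj_class_undo by blast
next
  case (convex \<Phi> \<Psi> t)
  then have "\<Phi> a (delta 0) k \<noteq> 0 \<or> \<Psi> a (delta 0) k \<noteq> 0" by (auto simp: op_apply_at)
  then show ?case using convex.IH by blast
qed

end

definition op_sum :: "'i set \<Rightarrow> ('i \<Rightarrow> 'g opr) \<Rightarrow> 'g opr" where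
  "op_sum I T = (\<lambda>f x. \<Sum>i\<in>I. T i f x)"

lemma op_sum_insert:
  "finite I \<Longrightarrow> i \<notin> I \<Longrightarrow> op_sum (insert i I) T = op_add (T i) (op_sum I T)"
  by (simp add: op_sum_def op_add_def)

lemma op_sum_empty [simp]: "op_sum {} T = op_zero"
  by (simp add: op_sum_def op_zero_def)

text \<open>At a limit stage this places a finite support inside a single earlier stage.\<close>

lemma chain_finite_subset:
  assumes "finite K" "K \<subseteq> \<Union>S" "S \<noteq> {}" "Complete_Partial_Order.chain (\<subseteq>) S"
  shows "\<exists>N\<in>S. K \<subseteq> N"
  using assms(1,2)
proof (induction K rule: finite_induct)
  case empty
  then show ?case using assms(3) by blast
next
  case (insert k K)
  then obtain M N where "M \<in> S" "K \<subseteq> M" "N \<in> S" "k \<in> N" by auto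
  moreover have "M \<subseteq> N \<or> N \<subseteq> M" using calculation assms(4) by (auto simp: chain_def)
  ultimately show ?case by blast
qed

context twisted_group
begin

section \<open>Finite sums of operators and averages of small \<open>l2\<close>-norm\<close>

lemma fin_alg_op_sum:
  assumes "finite I" "\<And>i. i \<in> I \<Longrightarrow> T i \<in> fin_alg" shows "op_sum I T \<in> fin_alg"
  using assms
proof (induction I rule: finite_induct)
  case (insert i I)
  then show ?case unfolding op_sum_insert[OF insert(1,2)] by (intro fin_alg_add) auto
qed simp

lemma twist_sum:
  assumes "finite I" "\<And>i. i \<in> I \<Longrightarrow> fsupp (x i)"
  shows "twist (\<lambda>k. \<Sum>i\<in>I. x i k) = op_sum I (\<lambda>i. twist (x i)) \<and> fsupp (\<lambda>k. \<Sum>i\<in>I. x i k)"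
  using assms
proof (induction I rule: finite_induct)
  case (insert i I)
  then have IH: "twist (\<lambda>k. \<Sum>i\<in>I. x i k) = op_sum I (\<lambda>i. twist (x i))" "fsupp (\<lambda>k. \<Sum>i\<in>I. x i k)"
    by blast+
  have eq: "(\<lambda>k. \<Sum>i\<in>insert i I. x i k) = (\<lambda>k. x i k + (\<Sum>i\<in>I. x i k))" using insert by simp
  have xi: "fsupp (x i)" using insert by simp
  show ?case unfolding op_sum_insert[OF insert(1,2)] eq twist_add[OF xi IH(2)] IH(1)
    using xi IH(2) by (simp add: fsupp_add)
qed simp

text \<open>Invariance makes \<open>cmod (v x)\<close> constant on conjugacy classes, so the bound
  on partial sums rules out an infinite class. A finite class contains a nonregular
  \<open>x\<close>; some \<open>h\<close> commuting with \<open>x\<close> then gives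
  \<open>v x = gamma h x * v x\<close> with a phase different from 1. Only finite partial sums are
  bounded because \<open>v\<close> will be a pointwise limit.\<close>

lemma conj_invariant_vanishes:
  fixes v :: "'g \<Rightarrow> complex"
  assumes kl: "kleppner \<sigma>"
    and inv: "\<And>g k. v (g + k - g) = gamma g k * v k"
    and bd: "\<And>F. finite F \<Longrightarrow> (\<Sum>k\<in>F. (cmod (v k))\<^sup>2) \<le> B"
    and k: "k \<noteq> 0"
  shows "v k = 0"
proof -
  have abs: "cmod (v x) = cmod (v k)" if "x \<in> conj_class k" for x
    using that inv by (auto simp: conj_class_def norm_mult)
  show ?thesis
  proof (cases "finite (conj_class k)")
    case True
    then obtain x where x: "x \<in> conj_class k" "\<not> sigma_regular \<sigma> x"
      using kl k unfolding kleppner_def by blast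
    then obtain h where h: "x + h = h + x" "\<sigma> x h \<noteq> \<sigma> h x" by (auto simp: sigma_regular_def)
    have hx: "h + x - h = x" by (simp add: h(1)[symmetric])
    have "gamma h x \<noteq> 1"
    proof
      assume "gamma h x = 1"
      then have "\<sigma> h x * cnj (\<sigma> x h) * \<sigma> x h = \<sigma> x h" by (simp add: gamma_def hx)
      then show False using h(2) by (simp add: mult.assoc)
    qed
    moreover have "v x = gamma h x * v x" using inv[of h x] by (simp add: hx)
    ultimately have "v x = 0" by simp
    then show ?thesis using abs[OF x(1)] by simp
  next
    case False
    show ?thesis
    proof (rule ccontr)
      assume "v k \<noteq> 0"
      then have c: "(cmod (v k))\<^sup>2 > 0" by simp
      obtain n :: nat where n: "B < n * (cmod (v k))\<^sup>2" using reals_Archimedean3[OF c] by blast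
      obtain F where F: "F \<subseteq> conj_class k" "finite F" "card F = n"
        using infinite_arbitrarily_large[OF False] by blast
      have "(\<Sum>x\<in>F. (cmod (v x))\<^sup>2) = (\<Sum>x\<in>F. (cmod (v k))\<^sup>2)"
        by (rule sum.cong) (use F abs in auto)
      then have "(\<Sum>x\<in>F. (cmod (v x))\<^sup>2) = n * (cmod (v k))\<^sup>2" using F by simp
      then show False using bd[OF F(2)] n by linarith
    qed
  qed
qed

lemma l2norm_Ad_coeff:
  assumes "a \<in> fin_alg" shows "l2norm (Ad g a (delta 0)) = l2norm (a (delta 0))"
proof -
  have undo: "- g + (g + k - g) + g = k" for k
    by (simp only: diff_conv_add_uminus add.assoc minus_add_cancel left_minus add_0_right)
  have "bij_betw (\<lambda>k. g + k - g) UNIV (UNIV :: 'g set)"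
    by (rule bij_betwI[where g = "\<lambda>k. - g + k + g"]) (auto simp: conj_undo undo)
  from infsum_reindex_bij_betw[OF this, of "\<lambda>k. (cmod (Ad g a (delta 0) k))\<^sup>2"]
  show ?thesis by (simp add: Ad_coeff[OF assms] l2norm_def norm_mult)
qed

text \<open>The infimum of the norms over the averages of \<open>a\<close> is nearly attained by a sequence which, by the
  parallelogram law, converges pointwise to a function invariant under twisted conjugation. Kleppner's
  condition forces that function to vanish.\<close>

lemma avg_l2_small:
  assumes kl: "kleppner \<sigma>" and a: "a \<in> fin_alg" and a0: "a (delta 0) 0 = 0" and e: "e > 0"
  shows "\<exists>\<Phi>\<in>avg. l2norm (\<Phi> a (delta 0)) < e"
proof (rule ccontr)
  assume neg: "\<not> (\<exists>\<Phi>\<in>avg. l2norm (\<Phi> a (delta 0)) < e)"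
  define N where "N = (\<lambda>\<Phi> :: 'g opr \<Rightarrow> 'g opr. (l2norm (\<Phi> a (delta 0)))\<^sup>2)"
  define r where "r = Inf (N ` avg)"
  have ne: "N ` avg \<noteq> {}" using avg.id by blast
  have bb: "bdd_below (N ` avg)" by (rule bdd_belowI[of _ 0]) (auto simp: N_def)
  have r_le: "r \<le> N \<Phi>" if "\<Phi> \<in> avg" for \<Phi>
    unfolding r_def by (rule cInf_lower[OF _ bb]) (use that in blast)
  have "e\<^sup>2 \<le> r" unfolding r_def
  proof (rule cInf_greatest[OF ne])
    fix s assume "s \<in> N ` avg"
    then obtain \<Phi> where \<Phi>: "\<Phi> \<in> avg" "s = N \<Phi>" by blast
    then have "e \<le> l2norm (\<Phi> a (delta 0))" using neg by (meson not_less)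
    then show "e\<^sup>2 \<le> s" using \<Phi> e by (simp add: N_def power_mono)
  qed
  then have r0: "0 < r" using e by (meson less_le_trans zero_less_power)
  have el: "\<Phi> a (delta 0) \<in> ell2" if "\<Phi> \<in> avg" for \<Phi>
    using avg_fin_alg[OF that a] by (auto intro: bounded_op_ell2)
  \<comment> \<open>The midpoint of two averages is again an average, so its squared norm is at
    least \<open>r\<close>. Through the parallelogram law this makes near-minimisers close to each
    other.\<close>
  have par: "4 * r \<le> N \<Phi> + 2 * Re (l2inner (\<Phi> a (delta 0)) (\<Psi> a (delta 0))) + N \<Psi>"
    if \<Phi>: "\<Phi> \<in> avg" and \<Psi>: "\<Psi> \<in> avg" for \<Phi> \<Psi>
  proof -
    let ?u = "\<Phi> a (delta 0)" and ?v = "\<Psi> a (delta 0)"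
    let ?M = "\<lambda>a. op_add (op_scale (of_real (1/2)) (\<Phi> a)) (op_scale (of_real (1 - 1/2)) (\<Psi> a))"
    have "?M \<in> avg" by (rule avg.convex[OF \<Phi> \<Psi>]) auto
    moreover have "?M a (delta 0) = (\<lambda>x. (1/2) * (?u x + ?v x))"
      by (simp add: op_add_apply op_scale_apply algebra_simps)
    then have "N ?M = (1/4) * (l2norm (\<lambda>x. ?u x + ?v x))\<^sup>2"
      by (simp only: N_def l2norm_cmult) (simp add: power_mult_distrib power2_eq_square)
    ultimately have "4 * r \<le> (l2norm (\<lambda>x. ?u x + ?v x))\<^sup>2" using r_le by fastforce
    then show ?thesis unfolding l2norm_add_sq[OF el[OF \<Phi>] el[OF \<Psi>]] N_def .
  qed
  have diff: "(cmod (\<Phi> a (delta 0) k - \<Psi> a (delta 0) k))\<^sup>2 \<le> 2 * N \<Phi> + 2 * N \<Psi> - 4 * r"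
    if \<Phi>: "\<Phi> \<in> avg" and \<Psi>: "\<Psi> \<in> avg" for \<Phi> \<Psi> k
  proof -
    have "(cmod (\<Phi> a (delta 0) k - \<Psi> a (delta 0) k))\<^sup>2 \<le> (l2norm (\<lambda>x. \<Phi> a (delta 0) x - \<Psi> a (delta 0) x))\<^sup>2"
      using cmod_le_l2norm[OF ell2_diff[OF el[OF \<Phi>] el[OF \<Psi>]], of k] by (intro power_mono) auto
    then show ?thesis using par[OF \<Phi> \<Psi>] unfolding l2norm_diff_sq[OF el[OF \<Phi>] el[OF \<Psi>]] N_def by linarith
  qed
  have "\<exists>\<Phi>\<in>avg. N \<Phi> < r + inverse (Suc n)" for n
    using cInf_lessD[OF ne, of "r + inverse (Suc n)"] by (auto simp: r_def)
  then obtain X where X: "\<And>n. X n \<in> avg" and NX: "\<And>n. N (X n) < r + inverse (Suc n)" by metis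
  define x where "x = (\<lambda>n. X n a (delta 0))"
  have inv_le: "inverse (real (Suc n)) \<le> inverse (Suc m)" if "m \<le> n" for m n
    using that by (simp add: field_simps)
  have "Cauchy (\<lambda>n. x n k)" for k
  proof (rule CauchyI)
    fix d :: real assume d: "0 < d"
    obtain M where M: "inverse (real (Suc M)) < d\<^sup>2 / 4" using reals_Archimedean[of "d\<^sup>2/4"] d by auto
    have "cmod (x m k - x n k) < d" if "M \<le> m" "M \<le> n" for m n
    proof (rule power2_less_imp_less)
      show "(cmod (x m k - x n k))\<^sup>2 < d\<^sup>2"
        using diff[OF X[of m] X[of n], of k] NX[of m] NX[of n] inv_le[OF that(1)] inv_le[OF that(2)] M
        unfolding x_def by linarith
    qed (use d in simp)
    then show "\<exists>M. \<forall>m\<ge>M. \<forall>n\<ge>M. cmod (x m k - x n k) < d" by blast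
  qed
  then have "\<exists>l. (\<lambda>n. x n k) \<longlonglongrightarrow> l" for k using Cauchy_convergent convergent_def by blast
  then obtain v where v: "\<And>k. (\<lambda>n. x n k) \<longlonglongrightarrow> v k" by metis
  have invt: "v (g + k - g) = gamma g k * v k" for g k
  proof -
    \<comment> \<open>Conjugating \<open>X n a\<close> by \<open>L g\<close> preserves its
      \<open>l2\<close>-norm, so the result is an equally good near-minimiser and must be close to
      \<open>X n a\<close>.\<close>
    have "(\<lambda>n. (cmod (gamma g k * x n k - x n (g + k - g)))\<^sup>2) \<longlonglongrightarrow> 0"
    proof (rule tendsto_sandwich[OF _ _ tendsto_const])
      show "\<forall>\<^sub>F n in sequentially. 0 \<le> (cmod (gamma g k * x n k - x n (g + k - g)))\<^sup>2" by simp
      show "\<forall>\<^sub>F n in sequentially. (cmod (gamma g k * x n k - x n (g + k - g)))\<^sup>2 \<le> 4 * inverse (Suc n)"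
      proof (rule always_eventually, rule allI)
        fix n
        have f: "X n a \<in> fin_alg" by (rule avg_fin_alg[OF X a])
        have "N (\<lambda>a. Ad g (X n a)) = N (X n)" by (simp add: N_def l2norm_Ad_coeff[OF f])
        then show "(cmod (gamma g k * x n k - x n (g + k - g)))\<^sup>2 \<le> 4 * inverse (Suc n)"
          using diff[OF avg.Ad[OF X[of n], of g] X[of n], of "g + k - g"] NX[of n]
          unfolding Ad_coeff[OF f] x_def by linarith
      qed
      show "(\<lambda>n. 4 * inverse (real (Suc n))) \<longlonglongrightarrow> 0"
        using tendsto_mult[OF tendsto_const LIMSEQ_inverse_real_of_nat, of 4] by simp
    qed
    moreover have "(\<lambda>n. (cmod (gamma g k * x n k - x n (g + k - g)))\<^sup>2) \<longlonglongrightarrow>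
        (cmod (gamma g k * v k - v (g + k - g)))\<^sup>2"
      by (intro tendsto_intros v)
    ultimately have "(cmod (gamma g k * v k - v (g + k - g)))\<^sup>2 = 0" using LIMSEQ_unique by blast
    then show ?thesis by simp
  qed
  have bd: "(\<Sum>k\<in>F. (cmod (v k))\<^sup>2) \<le> r + 1" if F: "finite F" for F
  proof (rule LIMSEQ_le_const2)
    show "(\<lambda>n. \<Sum>k\<in>F. (cmod (x n k))\<^sup>2) \<longlonglongrightarrow> (\<Sum>k\<in>F. (cmod (v k))\<^sup>2)"
      by (intro tendsto_intros v)
    have "(\<Sum>k\<in>F. (cmod (x n k))\<^sup>2) \<le> r + 1" for n
      using sum_le_l2norm_sq[OF el[OF X[of n]] F] NX[of n] inv_le[of 0 n]
      unfolding N_def x_def by simp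
    then show "\<exists>M. \<forall>n\<ge>M. (\<Sum>k\<in>F. (cmod (x n k))\<^sup>2) \<le> r + 1" by blast
  qed
  \<comment> \<open>The identity is conjugate only to itself, so averaging never creates a
    coefficient there.\<close>
  have "x n 0 = 0" for n
  proof (rule ccontr)
    assume "x n 0 \<noteq> 0"
    then obtain g where g: "a (delta 0) g \<noteq> 0" "0 \<in> conj_class g"
      using avg_support[OF a X[of n]] unfolding x_def by blast
    then obtain h where "h + g - h = 0" unfolding conj_class_def by auto
    then have "h + g = h + 0" by simp
    then have "g = 0" using add_left_imp_eq by blast
    then show False using g a0 by simp
  qed
  then have "v 0 = 0" using LIMSEQ_unique[OF v[of 0]] by simp
  moreover have "v k = 0" if "k \<noteq> 0" for k
    by (rule conj_invariant_vanishes[OF kl _ _ that]) (fact invt, rule bd)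
  ultimately have v0: "v k = 0" for k by (cases "k = 0") simp_all
  \<comment> \<open>Fix \<open>n\<close> and let \<open>m\<close> grow: \<open>x n\<close> has
    finite support and \<open>x m\<close> tends to 0 pointwise, so the cross term in
    \<open>par\<close> disappears and only the two excesses over \<open>r\<close> remain. Finite
    support is what lets pointwise convergence replace convergence in norm.\<close>
  have "2 * r \<le> inverse (Suc n)" for n
  proof -
    have fs: "finite {k. x n k \<noteq> 0}"
      using fin_alg_coeff(1)[OF avg_fin_alg[OF X a]] by (simp add: fsupp_def x_def)
    have "(\<lambda>m. \<Sum>k | x n k \<noteq> 0. cnj (x n k) * x m k) \<longlonglongrightarrow> (\<Sum>k | x n k \<noteq> 0. cnj (x n k) * v k)"
      by (intro tendsto_intros v)
    moreover have "l2inner (x n) (x m) = (\<Sum>k | x n k \<noteq> 0. cnj (x n k) * x m k)" for m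
      by (rule l2inner_finite[OF fs]) simp
    ultimately have "(\<lambda>m. l2inner (x n) (x m)) \<longlonglongrightarrow> 0" by (simp add: v0)
    then have "(\<lambda>m. Re (l2inner (x n) (x m))) \<longlonglongrightarrow> 0" using tendsto_Re by fastforce
    then have lim: "(\<lambda>m. inverse (Suc n) + 2 * Re (l2inner (x n) (x m)) + inverse (Suc m)) \<longlonglongrightarrow>
        inverse (Suc n) + 2 * 0 + 0"
      by (intro tendsto_intros LIMSEQ_inverse_real_of_nat)
    have "2 * r \<le> inverse (Suc n) + 2 * Re (l2inner (x n) (x m)) + inverse (Suc m)" for m
      using par[OF X[of n] X[of m]] NX[of n] NX[of m] unfolding x_def by linarith
    then have "2 * r \<le> inverse (Suc n) + 2 * 0 + 0" by (intro LIMSEQ_le_const[OF lim]) blast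
    then show ?thesis by simp
  qed
  moreover obtain n where "inverse (real (Suc n)) < 2 * r" using reals_Archimedean[of "2 * r"] r0 by auto
  ultimately show False by (meson not_less)
qed

end

section \<open>The upper FC-central series\<close>

definition is_normal_subgroup :: "'g::group_add set \<Rightarrow> bool" where
  "is_normal_subgroup N \<longleftrightarrow> 0 \<in> N \<and> (\<forall>x\<in>N. \<forall>y\<in>N. x + y \<in> N) \<and> (\<forall>x\<in>N. - x \<in> N) \<and> (\<forall>x\<in>N. \<forall>h. h + x - h \<in> N)"

lemma is_normal_subgroupD:
  assumes "is_normal_subgroup N"
  shows "0 \<in> N" "x \<in> N \<Longrightarrow> y \<in> N \<Longrightarrow> x + y \<in> N" "x \<in> N \<Longrightarrow> - x \<in> N" "x \<in> N \<Longrightarrow> h + x - h \<in> N"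
  using assms by (simp_all add: is_normal_subgroup_def)

lemma lcoset_eqD:
  assumes "0 \<in> N" "lcoset x N = lcoset y N" shows "- x + y \<in> N"
proof -
  have "y \<in> lcoset y N" using assms(1) by (auto simp: lcoset_def intro!: image_eqI[of _ _ 0])
  then obtain n where "n \<in> N" "y = x + n" using assms(2) by (auto simp: lcoset_def)
  then show ?thesis by (simp add: add.assoc[symmetric])
qed

lemma lcoset_eqI:
  assumes N: "is_normal_subgroup N" and xy: "- x + y \<in> N" shows "lcoset x N = lcoset y N"
proof -
  have sub: "lcoset y N \<subseteq> lcoset x N" if "- x + y \<in> N" for x y
  proof
    fix z assume "z \<in> lcoset y N"
    then obtain n where n: "n \<in> N" "z = y + n" by (auto simp: lcoset_def)
    then have "z = x + ((- x + y) + n)" by (simp add: add.assoc[symmetric])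
    then show "z \<in> lcoset x N" using is_normal_subgroupD(2)[OF N that n(1)] by (auto simp: lcoset_def)
  qed
  have "- y + x \<in> N" using is_normal_subgroupD(3)[OF N xy] by (simp add: minus_add)
  then show ?thesis using sub xy by blast
qed

text \<open>Used to bound the number of conjugates modulo \<open>N\<close> of a product or an
  inverse by those of the factors, without forming the quotient group. \<open>SOME\<close> picks a
  common preimage of a pair of values.\<close>

lemma finite_range_factor:
  assumes "finite (range p)" "finite (range q)" "\<And>h h'. p h = p h' \<Longrightarrow> q h = q h' \<Longrightarrow> r h = r h'"
  shows "finite (range r)"
proof -
  let ?R = "\<lambda>(u, v). r (SOME h. p h = u \<and> q h = v)"
  have "r h = ?R (p h, q h)" for h
  proof -
    let ?s = "SOME h'. p h' = p h \<and> q h' = q h"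
    have "p ?s = p h \<and> q ?s = q h" by (rule someI[of _ h]) simp
    then have "r ?s = r h" by (intro assms(3)) simp_all
    then show ?thesis by (simp only: prod.case)
  qed
  then have "range r \<subseteq> ?R ` (range p \<times> range q)" by blast
  then show ?thesis using assms(1,2) by (meson finite_SigmaI finite_imageI finite_subset)
qed

text \<open>The conjugates of \<open>x\<close> and \<open>y\<close> modulo \<open>N\<close>
  determine that of \<open>x + y\<close>, and the conjugate of \<open>x\<close> determines that of
  \<open>- x\<close>; both rest on the normality of \<open>N\<close>. Conjugating \<open>x\<close>
  only reparametrizes its class.\<close>

lemma is_normal_subgroup_fc_next:
  fixes N :: "'g::group_add set"
  assumes N: "is_normal_subgroup N" shows "is_normal_subgroup (fc_next N)"
  unfolding is_normal_subgroup_def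
proof (intro conjI ballI allI)
  note grp = diff_conv_add_uminus add.assoc minus_add minus_add_cancel add_minus_cancel minus_minus
    right_minus left_minus add_0_right
  show "0 \<in> fc_next N" by (simp add: fc_next_def)
  fix x :: 'g assume x: "x \<in> fc_next N"
  let ?X = "\<lambda>h. h + x - h"
  have fx: "finite (range (\<lambda>h. lcoset (?X h) N))" using x by (simp add: fc_next_def)
  show "- x \<in> fc_next N" unfolding fc_next_def mem_Collect_eq
  proof (rule finite_range_factor[OF fx fx])
    fix h h' assume "lcoset (?X h) N = lcoset (?X h') N"
    then have n: "- ?X h + ?X h' \<in> N" by (rule lcoset_eqD[OF is_normal_subgroupD(1)[OF N]])
    have "- (h + (- x) - h) + (h' + (- x) - h') = ?X h + (- (- ?X h + ?X h')) - ?X h"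
      by (simp only: grp)
    also have "\<dots> \<in> N" using is_normal_subgroupD(4)[OF N is_normal_subgroupD(3)[OF N n]] .
    finally show "lcoset (h + (- x) - h) N = lcoset (h' + (- x) - h') N" by (rule lcoset_eqI[OF N])
  qed
  fix k
  have "range (\<lambda>h. lcoset (h + (k + x - k) - h) N) \<subseteq> range (\<lambda>h. lcoset (?X h) N)"
  proof
    fix C assume "C \<in> range (\<lambda>h. lcoset (h + (k + x - k) - h) N)"
    then obtain h where "C = lcoset (h + (k + x - k) - h) N" by blast
    also have "h + (k + x - k) - h = ?X (h + k)" by (simp only: grp)
    finally show "C \<in> range (\<lambda>h. lcoset (?X h) N)" by blast
  qed
  then show "k + x - k \<in> fc_next N" using fx by (simp add: fc_next_def finite_subset)
  fix y :: 'g assume y: "y \<in> fc_next N"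
  let ?Y = "\<lambda>h. h + y - h"
  have fy: "finite (range (\<lambda>h. lcoset (?Y h) N))" using y by (simp add: fc_next_def)
  show "x + y \<in> fc_next N" unfolding fc_next_def mem_Collect_eq
  proof (rule finite_range_factor[OF fx fy])
    fix h h' assume X: "lcoset (?X h) N = lcoset (?X h') N" and Y: "lcoset (?Y h) N = lcoset (?Y h') N"
    note nx = lcoset_eqD[OF is_normal_subgroupD(1)[OF N] X] and ny = lcoset_eqD[OF is_normal_subgroupD(1)[OF N] Y]
    have "- (h + (x + y) - h) + (h' + (x + y) - h') =
        (- ?Y h + (- ?X h + ?X h') - (- ?Y h)) + (- ?Y h + ?Y h')"
      by (simp only: grp)
    also have "\<dots> \<in> N" by (intro is_normal_subgroupD(2)[OF N] is_normal_subgroupD(4)[OF N] nx ny)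
    finally show "lcoset (h + (x + y) - h) N = lcoset (h' + (x + y) - h') N" by (rule lcoset_eqI[OF N])
  qed
qed

lemma is_normal_subgroup_chain_Union:
  assumes ne: "S \<noteq> {}" and ch: "Complete_Partial_Order.chain (\<subseteq>) S" and S: "\<And>N. N \<in> S \<Longrightarrow> is_normal_subgroup N"
  shows "is_normal_subgroup (\<Union>S)"
proof -
  have "x + y \<in> \<Union>S" if xy: "x \<in> \<Union>S" "y \<in> \<Union>S" for x y
  proof -
    obtain N where "N \<in> S" "{x, y} \<subseteq> N" using chain_finite_subset[OF _ _ ne ch, of "{x, y}"] xy by auto
    then show ?thesis using is_normal_subgroupD(2)[OF S] by blast
  qed
  moreover have "0 \<in> \<Union>S" using ne is_normal_subgroupD(1)[OF S] by blast
  moreover have "- x \<in> \<Union>S" if "x \<in> \<Union>S" for x using that is_normal_subgroupD(3)[OF S] by blast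
  moreover have "h + x - h \<in> \<Union>S" if "x \<in> \<Union>S" for x h using that is_normal_subgroupD(4)[OF S] by blast
  ultimately show ?thesis unfolding is_normal_subgroup_def by blast
qed

lemma fc_stage_normal: "fc_stage N \<Longrightarrow> is_normal_subgroup N"
proof (induction rule: fc_stage.induct)
  case zero then show ?case by (simp add: is_normal_subgroup_def)
next
  case (succ N) then show ?case by (simp add: is_normal_subgroup_fc_next)
next
  case (lim S) then show ?case by (intro is_normal_subgroup_chain_Union) auto
qed

lemma fc_next_increasing: assumes N: "is_normal_subgroup N" shows "N \<subseteq> fc_next N"
proof
  fix x assume x: "x \<in> N"
  have "lcoset (h + x - h) N = lcoset 0 N" for h
    by (rule lcoset_eqI[OF N]) (use is_normal_subgroupD(3)[OF N is_normal_subgroupD(4)[OF N x]] in simp)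
  then show "x \<in> fc_next N" by (simp add: fc_next_def)
qed

text \<open>Passing to a coarser quotient can only merge conjugates.\<close>

lemma fc_next_mono:
  assumes "0 \<in> N" "is_normal_subgroup M" "N \<subseteq> M" shows "fc_next N \<subseteq> fc_next M"
proof
  fix x assume "x \<in> fc_next N"
  then have f: "finite (range (\<lambda>h. lcoset (h + x - h) N))" by (simp add: fc_next_def)
  show "x \<in> fc_next M" unfolding fc_next_def mem_Collect_eq
  proof (rule finite_range_factor[OF f f])
    fix h h' assume "lcoset (h + x - h) N = lcoset (h' + x - h') N"
    then have "- (h + x - h) + (h' + x - h') \<in> M" using lcoset_eqD[OF assms(1)] assms(3) by blast
    then show "lcoset (h + x - h) M = lcoset (h' + x - h') M" by (rule lcoset_eqI[OF assms(2)])
  qed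
qed

text \<open>A maximal stage, given by Zorn's lemma, contains every other stage.\<close>

lemma fc_stage_FCH: "fc_stage (FCH :: 'g::group_add set)"
proof -
  have "\<exists>M\<in>{N :: 'g set. fc_stage N}. \<forall>N\<in>{N. fc_stage N}. M \<subseteq> N \<longrightarrow> N = M"
  proof (rule subset_Zorn_nonempty)
    show "{N :: 'g set. fc_stage N} \<noteq> {}" using fc_stage.zero by blast
    fix S :: "'g set set" assume "S \<noteq> {}" and ch: "subset.chain {N. fc_stage N} S"
    then show "\<Union>S \<in> {N. fc_stage N}"
      using fc_stage.lim[of S] by (auto simp: subset_chain_def chain_def)
  qed
  then obtain M :: "'g set" where M: "fc_stage M" "\<And>N. fc_stage N \<Longrightarrow> M \<subseteq> N \<Longrightarrow> N = M" by blast
  have fix_M: "fc_next M = M"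
    using M(2)[OF fc_stage.succ[OF M(1)]] fc_next_increasing[OF fc_stage_normal[OF M(1)]] by blast
  have "N \<subseteq> M" if "fc_stage N" for N using that
  proof (induction rule: fc_stage.induct)
    case zero then show ?case using is_normal_subgroupD(1)[OF fc_stage_normal[OF M(1)]] by simp
  next
    case (succ N)
    then show ?case
      using fc_next_mono[OF is_normal_subgroupD(1)[OF fc_stage_normal[OF succ(1)]] fc_stage_normal[OF M(1)]] fix_M by blast
  next
    case (lim S) then show ?case by blast
  qed
  then have "FCH = M" using M(1) by (auto simp: FCH_def)
  then show ?thesis using M(1) by simp
qed

context twisted_group
begin

section \<open>From the \<open>l2\<close>-norm to the operator norm along the series\<close>

lemma adjoint_mult_self_entry:
  assumes "bounded_op b"
  shows "op_mult (adjoint b) b (delta 0) k = l2inner (b (delta k)) (b (delta 0))"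
proof -
  have "l2inner (delta k) (adjoint b (b (delta 0))) = l2inner (b (delta k)) (b (delta 0))"
    by (rule adjoint_inner_right[OF assms]) (use assms in \<open>auto intro: bounded_op_ell2\<close>)
  then show ?thesis by (simp add: op_mult_apply)
qed

text \<open>The product \<open>b* b\<close> is supported on elements \<open>- i + j\<close> with
  \<open>i\<close> and \<open>j\<close> in the support of \<open>y\<close>, and such an element lies
  in \<open>N\<close> when \<open>i\<close> and \<open>j\<close> share a left coset.\<close>

lemma twist_coset_square_support:
  assumes y: "fsupp y" and C: "\<And>k. y k \<noteq> 0 \<Longrightarrow> lcoset k N = C" and N: "0 \<in> N"
    and k: "op_mult (adjoint (twist y)) (twist y) (delta 0) k \<noteq> 0"
  shows "k \<in> N"
proof -
  have "l2inner (twist y (delta k)) y \<noteq> 0"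
    using k by (simp add: adjoint_mult_self_entry[OF bounded_op_twist[OF y]] twist_delta_zero[OF y])
  then obtain j where "twist y (delta k) j \<noteq> 0" and yj: "y j \<noteq> 0"
    using l2inner_finite[of "{}" "twist y (delta k)" y] by auto
  then have "y (j - k) \<noteq> 0" by (simp add: twist_apply_delta[OF y])
  then have "lcoset (j - k) N = lcoset j N" using C yj by metis
  moreover have "j \<in> lcoset j N" using N by (auto simp: lcoset_def intro!: image_eqI[of _ _ 0])
  ultimately obtain n where n: "n \<in> N" "j = (j - k) + n" by (auto simp: lcoset_def)
  have "(j - k) + k = (j - k) + n" using n(2) by simp
  then have "k = n" using add_left_imp_eq by blast
  then show ?thesis using n by simp
qed

text \<open>The successor step of the induction. An \<open>l2\<close>-small average \<open>b\<close> of \<open>a\<close> is supported on finitely many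
  cosets of \<open>N\<close>, and \<open>b* b\<close> is dominated by a multiple of the sum of the squares of its restrictions to
  these cosets. Those squares live on \<open>N\<close>, so another average makes their part off the identity small, and the
  Kadison inequality transfers this to \<open>b\<close>.\<close>

lemma avg_small_step:
  assumes kl: "kleppner \<sigma>" and N0: "0 \<in> N"
    and IH: "\<And>a e. a \<in> fin_alg \<Longrightarrow> (\<And>k. a (delta 0) k \<noteq> 0 \<Longrightarrow> k \<in> N \<and> k \<noteq> 0) \<Longrightarrow> e > 0 \<Longrightarrow>
      \<exists>\<Phi>\<in>avg. opnorm (\<Phi> a) < e"
    and a: "a \<in> fin_alg" and supp: "\<And>k. a (delta 0) k \<noteq> 0 \<Longrightarrow> k \<in> fc_next N \<and> k \<noteq> 0" and e: "e > 0"
  shows "\<exists>\<Phi>\<in>avg. opnorm (\<Phi> a) < e"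
proof -
  \<comment> \<open>By \<open>avg_support\<close> every average of \<open>a\<close> is supported in
    \<open>D\<close>, so the number \<open>m\<close> of cosets is known before the average is
    chosen.\<close>
  define D where "D = (\<Union>g\<in>{g. a (delta 0) g \<noteq> 0}. conj_class g)"
  define K where "K = (\<lambda>k. lcoset k N) ` D"
  have K: "finite K"
  proof -
    have "K \<subseteq> (\<Union>g\<in>{g. a (delta 0) g \<noteq> 0}. (\<lambda>h. lcoset (h + g - h) N) ` UNIV)"
      by (auto simp: K_def D_def conj_class_def)
    moreover have "finite (\<Union>g\<in>{g. a (delta 0) g \<noteq> 0}. (\<lambda>h. lcoset (h + g - h) N) ` UNIV)"
      using fin_alg_coeff(1)[OF a] supp by (auto simp: fsupp_def fc_next_def)
    ultimately show ?thesis by (rule finite_subset)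
  qed
  define m where "m = real (card K)"
  have m0: "0 \<le> m" by (simp add: m_def)
  \<comment> \<open>Chosen so that \<open>m * d \<le> e^2 / 4\<close>, which will bound the trace of
    the dominating element \<open>c\<close>. The summand 1 covers \<open>m = 0\<close>.\<close>
  define d where "d = e\<^sup>2 / 4 / (m + 1)"
  have d: "0 < d" using e m0 by (simp add: d_def)
  have "a (delta 0) 0 = 0" using supp by blast
  then obtain \<Phi> where \<Phi>: "\<Phi> \<in> avg" "l2norm (\<Phi> a (delta 0)) < sqrt d"
    using avg_l2_small[OF kl a, of "sqrt d"] d by auto
  define y where "y = \<Phi> a (delta 0)"
  have \<Phi>a: "\<Phi> a \<in> fin_alg" by (rule avg_fin_alg[OF \<Phi>(1) a])
  have y: "fsupp y" and \<Phi>y: "\<Phi> a = twist y" using fin_alg_coeff[OF \<Phi>a] by (simp_all add: y_def)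
  have yD: "k \<in> D" if "y k \<noteq> 0" for k
    using avg_support[OF a \<Phi>(1), of k] that by (auto simp: y_def D_def)
  have ysq: "(l2norm y)\<^sup>2 \<le> d"
    using power_mono[OF less_imp_le[OF \<Phi>(2)], of 2] d by (simp add: y_def)
  define z where "z = (\<lambda>C k. if lcoset k N = C then y k else 0)"
  have z: "fsupp (z C)" for C
    using y unfolding fsupp_def by (rule finite_subset[rotated]) (auto simp: z_def)
  define b where "b = (\<lambda>C. twist (z C))"
  have b: "b C \<in> fin_alg" for C using z by (auto simp: b_def fin_alg_def)
  have bb: "bounded_op (b C)" for C by (rule fin_alg_bounded[OF b])
  have "y k = (\<Sum>C\<in>K. z C k)" for k
  proof (cases "y k = 0")
    case True
    then have "z C k = 0" for C by (simp add: z_def)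
    then show ?thesis using True by simp
  next
    case False
    then have "lcoset k N \<in> K" using yD by (simp add: K_def)
    then show ?thesis using K by (simp add: z_def)
  qed
  then have "y = (\<lambda>k. \<Sum>C\<in>K. z C k)" by blast
  then have \<Phi>b: "\<Phi> a = op_sum K b" using twist_sum[OF K, of z] z by (simp add: \<Phi>y b_def)
  define c where "c = op_sum K (\<lambda>C. op_scale (of_real m) (op_mult (adjoint (b C)) (b C)))"
  have c: "c \<in> fin_alg" unfolding c_def
    by (intro fin_alg_op_sum K fin_alg_scale fin_alg_mult fin_alg_adjoint b)
  have dom: "(l2norm (\<Phi> a f))\<^sup>2 \<le> Re (l2inner f (c f))" if f: "f \<in> ell2" for f
  proof -
    have bf: "b C f \<in> ell2" "adjoint (b C) (b C f) \<in> ell2" for C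
      using bb f by (auto intro: bounded_op_ell2)
    have "(l2norm (\<Phi> a f))\<^sup>2 \<le> m * (\<Sum>C\<in>K. (l2norm (b C f))\<^sup>2)"
      unfolding \<Phi>b op_sum_def m_def using bf by (intro l2norm_sum_sq_le K)
    moreover have "l2inner f (c f) = (\<Sum>C\<in>K. l2inner f (\<lambda>x. of_real m * adjoint (b C) (b C f) x))"
      unfolding c_def op_sum_def op_scale_apply op_mult_apply using bf f
      by (intro l2inner_sum_right ell2_scale)
    moreover have "l2inner f (\<lambda>x. of_real m * adjoint (b C) (b C f) x) = of_real (m * (l2norm (b C f))\<^sup>2)" for C
      using bf f bb by (simp add: l2inner_cmult_right adjoint_inner_right l2inner_self)
    ultimately show ?thesis by (simp add: sum_distrib_left)
  qed
  have c_at: "c (delta 0) k = (\<Sum>C\<in>K. of_real m * op_mult (adjoint (b C)) (b C) (delta 0) k)" for k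
    by (simp add: c_def op_sum_def op_scale_apply)
  have c_supp: "k \<in> N" if ck: "c (delta 0) k \<noteq> 0" for k
  proof -
    have "\<exists>C. op_mult (adjoint (b C)) (b C) (delta 0) k \<noteq> 0"
    proof (rule ccontr)
      assume "\<nexists>C. op_mult (adjoint (b C)) (b C) (delta 0) k \<noteq> 0"
      then have "c (delta 0) k = 0" unfolding c_at by simp
      then show False using ck by simp
    qed
    then obtain C where C: "op_mult (adjoint (twist (z C))) (twist (z C)) (delta 0) k \<noteq> 0"
      unfolding b_def by blast
    have "lcoset j N = C" if "z C j \<noteq> 0" for j using that by (simp add: z_def split: if_splits)
    then show ?thesis by (rule twist_coset_square_support[OF z _ N0 C])
  qed
  define s where "s = m * (\<Sum>C\<in>K. (l2norm (z C))\<^sup>2)"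
  have c0: "c (delta 0) 0 = of_real s"
  proof -
    have "op_mult (adjoint (b C)) (b C) (delta 0) 0 = of_real ((l2norm (z C))\<^sup>2)" for C
      unfolding adjoint_mult_self_entry[OF bb] using z[of C]
      by (simp add: b_def twist_delta_zero l2inner_self fsupp_ell2)
    then show ?thesis by (simp add: c_at s_def sum_distrib_left)
  qed
  \<comment> \<open>The cosets partition the support of \<open>y\<close>, so by Parseval
    \<open>s\<close> equals \<open>m\<close> times the squared norm of \<open>y\<close>.\<close>
  have s_le: "s \<le> e\<^sup>2 / 4"
  proof -
    let ?F = "{k. y k \<noteq> 0}"
    have F: "finite ?F" using y by (simp add: fsupp_def)
    have "(\<Sum>C\<in>K. (l2norm (z C))\<^sup>2) = (\<Sum>C\<in>K. \<Sum>k\<in>?F. (cmod (z C k))\<^sup>2)"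
      by (intro sum.cong refl l2norm_sq_finite[OF F]) (simp add: z_def)
    also have "\<dots> = (\<Sum>k\<in>?F. \<Sum>C\<in>K. (cmod (z C k))\<^sup>2)" by (rule sum.swap)
    also have "\<dots> = (\<Sum>k\<in>?F. (cmod (y k))\<^sup>2)"
    proof (rule sum.cong[OF refl])
      fix k assume "k \<in> ?F"
      then have "lcoset k N \<in> K" using yD by (simp add: K_def)
      moreover have "(cmod (z C k))\<^sup>2 = (if lcoset k N = C then (cmod (y k))\<^sup>2 else 0)" for C
        by (simp add: z_def)
      ultimately show "(\<Sum>C\<in>K. (cmod (z C k))\<^sup>2) = (cmod (y k))\<^sup>2" using K by simp
    qed
    also have "\<dots> = (l2norm y)\<^sup>2" by (rule l2norm_sq_finite[OF F, symmetric]) simp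
    finally have "s = m * (l2norm y)\<^sup>2" by (simp add: s_def)
    also have "\<dots> \<le> (m + 1) * d" using ysq m0 by (intro mult_mono) auto
    also have "\<dots> = e\<^sup>2 / 4" unfolding d_def using m0 by (subst times_divide_eq_right) (simp only: nonzero_mult_div_cancel_left)
    finally show ?thesis .
  qed
  \<comment> \<open>The identity coefficient \<open>s\<close> of \<open>c\<close> is fixed by every
    average, which is why it had to be made small beforehand. The induction hypothesis handles the
    rest.\<close>
  define c' where "c' = op_add c (op_scale (- of_real s) (L 0))"
  have c': "c' \<in> fin_alg" unfolding c'_def using c by (intro fin_alg_add fin_alg_scale fin_alg_L)
  have c'_at: "c' (delta 0) k = c (delta 0) k - of_real s * delta 0 k" for k
    unfolding c'_def by (simp add: op_add_apply op_scale_apply)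
  have "\<exists>\<Psi>\<in>avg. opnorm (\<Psi> c') < e\<^sup>2 / 4"
  proof (rule IH[OF c'])
    fix k assume k: "c' (delta 0) k \<noteq> 0"
    then have k0: "k \<noteq> 0" using c0 c'_at[of k] by (auto simp: delta_def)
    then have "c (delta 0) k \<noteq> 0" using k c'_at[of k] by (simp add: delta_def)
    then show "k \<in> N \<and> k \<noteq> 0" using c_supp k0 by simp
  qed (use e in simp)
  then obtain \<Psi> where \<Psi>: "\<Psi> \<in> avg" "opnorm (\<Psi> c') < e\<^sup>2 / 4" by blast
  have bc': "bounded_op (\<Psi> c')" by (rule avg_bounded[OF \<Psi>(1) fin_alg_bounded[OF c']])
  have "c = op_add c' (op_scale (of_real s) (L 0))" unfolding c'_def by (simp add: fun_eq_iff op_apply_at)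
  then have "\<Psi> c = op_add (\<Psi> c') (op_scale (of_real s) (L 0))"
    using c' \<Psi>(1) by (metis avg_add avg_one avg_scale bounded_op_L bounded_op_op_scale fin_alg_bounded)
  then have \<Psi>c: "\<Psi> c f = (\<lambda>x. \<Psi> c' f x + of_real s * f x)" if "f \<in> ell2" for f
    using that by (simp add: op_add_apply op_scale_apply)
  \<comment> \<open>The scalar part \<open>s\<close> and the averaged remainder each contribute
    \<open>e^2 / 4\<close> to the quadratic form, leaving room below \<open>e^2\<close>.\<close>
  have "opnorm (\<Psi> (\<Phi> a)) \<le> sqrt (e\<^sup>2 / 2)"
  proof (rule opnorm_le_sq)
    fix f :: "'g vec" assume f: "f \<in> ell2"
    have "(l2norm (\<Psi> (\<Phi> a) f))\<^sup>2 \<le> Re (l2inner f (\<Psi> c f))"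
      using avg_kadison[OF fin_alg_bounded[OF \<Phi>a] fin_alg_bounded[OF c] dom \<Psi>(1) f] by blast
    also have "\<dots> = Re (l2inner f (\<Psi> c' f)) + s * (l2norm f)\<^sup>2"
      unfolding \<Psi>c[OF f] using f bc'
      by (simp add: l2inner_add_right bounded_op_ell2 ell2_scale l2inner_cmult_right l2inner_self)
    also have "Re (l2inner f (\<Psi> c' f)) \<le> l2norm f * l2norm (\<Psi> c' f)"
      using l2inner_cauchy_schwarz[OF f bounded_op_ell2[OF bc' f]] complex_Re_le_cmod order_trans by blast
    also have "\<dots> \<le> l2norm f * (opnorm (\<Psi> c') * l2norm f)"
      by (intro mult_left_mono opnorm_apply bc' f l2norm_nonneg)
    also have "\<dots> \<le> e\<^sup>2 / 4 * (l2norm f)\<^sup>2"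
      using mult_right_mono[OF less_imp_le[OF \<Psi>(2)], of "(l2norm f)\<^sup>2"] by (simp add: power2_eq_square mult_ac)
    finally have "(l2norm (\<Psi> (\<Phi> a) f))\<^sup>2 \<le> e\<^sup>2 / 4 * (l2norm f)\<^sup>2 + s * (l2norm f)\<^sup>2" by simp
    also have "\<dots> \<le> e\<^sup>2 / 2 * (l2norm f)\<^sup>2"
      using mult_right_mono[OF s_le, of "(l2norm f)\<^sup>2"] by simp
    finally show "(l2norm (\<Psi> (\<Phi> a) f))\<^sup>2 \<le> e\<^sup>2 / 2 * (l2norm f)\<^sup>2" .
  qed simp
  also have "\<dots> < sqrt (e\<^sup>2)" using e by (intro real_sqrt_less_mono) simp
  also have "\<dots> = e" using e by simp
  finally show ?thesis by (intro bexI[of _ "\<lambda>a. \<Psi> (\<Phi> a)"] avg_comp[OF \<Psi>(1) \<Phi>(1)])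
qed

text \<open>Membership of 0 is carried through the induction because the successor step uses it to
  pass from equal cosets to membership in \<open>N\<close>. At a limit stage the finite support
  already lies in an earlier stage.\<close>

lemma avg_small_stage:
  assumes kl: "kleppner \<sigma>" and "fc_stage N"
  shows "0 \<in> N \<and> (\<forall>a e. a \<in> fin_alg \<longrightarrow> (\<forall>k. a (delta 0) k \<noteq> 0 \<longrightarrow> k \<in> N \<and> k \<noteq> 0) \<longrightarrow> e > 0 \<longrightarrow>
    (\<exists>\<Phi>\<in>avg. opnorm (\<Phi> a) < e))"
  using assms(2)
proof (induction rule: fc_stage.induct)
  case zero
  have "\<exists>\<Phi>\<in>avg. opnorm (\<Phi> a) < e"
    if a: "a \<in> fin_alg" and s: "\<forall>k. a (delta 0) k \<noteq> 0 \<longrightarrow> k \<in> {0} \<and> k \<noteq> 0" and e: "e > 0" for a and e :: real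
  proof -
    have "a (delta 0) = (\<lambda>_. 0)" using s by auto
    then have "a = op_zero" using fin_alg_coeff(2)[OF a] by simp
    then show ?thesis using avg.id e by (intro bexI[of _ "\<lambda>a. a"]) simp_all
  qed
  then show ?case by blast
next
  case (succ N)
  have "0 \<in> fc_next N" by (simp add: fc_next_def)
  moreover have "\<exists>\<Phi>\<in>avg. opnorm (\<Phi> a) < e"
    if "a \<in> fin_alg" and "\<forall>k. a (delta 0) k \<noteq> 0 \<longrightarrow> k \<in> fc_next N \<and> k \<noteq> 0" and "e > 0" for a and e :: real
    by (rule avg_small_step[OF kl, of N]) (use that succ.IH in auto)
  ultimately show ?case by blast
next
  case (lim S)
  have "\<exists>\<Phi>\<in>avg. opnorm (\<Phi> a) < e"
    if a: "a \<in> fin_alg" and s: "\<forall>k. a (delta 0) k \<noteq> 0 \<longrightarrow> k \<in> \<Union>S \<and> k \<noteq> 0" and e: "e > 0" for a and e :: real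
  proof -
    obtain N where N: "N \<in> S" "{k. a (delta 0) k \<noteq> 0} \<subseteq> N"
      using chain_finite_subset[of "{k. a (delta 0) k \<noteq> 0}" S] fin_alg_coeff(1)[OF a] s lim(1,2)
      unfolding fsupp_def by blast
    then have "\<forall>k. a (delta 0) k \<noteq> 0 \<longrightarrow> k \<in> N \<and> k \<noteq> 0" using s by blast
    then show ?thesis using lim(3) N(1) a e by blast
  qed
  moreover have "0 \<in> \<Union>S" using lim(1,3) by blast
  ultimately show ?case by blast
qed

theorem avg_small:
  assumes kl: "kleppner \<sigma>" and hc: "FC_hypercentral TYPE('g)"
    and a: "a \<in> fin_alg" and a0: "a (delta 0) 0 = 0" and e: "e > 0"
  obtains \<Phi> where "\<Phi> \<in> avg" "opnorm (\<Phi> a) < e"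
proof -
  have "fc_stage (UNIV :: 'g set)" using fc_stage_FCH[where 'g = 'g] hc by (simp add: FC_hypercentral_def)
  from avg_small_stage[OF kl this] have "\<exists>\<Phi>\<in>avg. opnorm (\<Phi> a) < e" using a a0 e by auto
  then show ?thesis using that by blast
qed

end

section \<open>Consequences of Kleppner's condition\<close>

lemma delta_self [simp]: "delta g g = 1"
  by (simp add: delta_def)

lemma delta_nonzero: "delta g \<noteq> (\<lambda>_. 0)"
  using delta_self[of g] by force

context twisted_group
begin

definition central :: "'g opr \<Rightarrow> bool" where
  "central z \<longleftrightarrow> z \<in> A \<and> (\<forall>a\<in>A. op_mult z a = op_mult a z)"

lemma op_zero_in_A [simp]: "op_zero \<in> A"
  by (rule fin_alg_subset) simp

lemma A_diff [intro]: "a \<in> A \<Longrightarrow> b \<in> A \<Longrightarrow> op_diff a b \<in> A"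
  by (intro reduced_twisted.add reduced_twisted.scale)

lemma op_diff_self [simp]: "op_diff a a = op_zero"
  by (simp add: op_add_def op_scale_def op_zero_def)

lemma zero_if_le_all:
  fixes x K :: real
  assumes "\<And>e. e > 0 \<Longrightarrow> x \<le> K * e" "0 \<le> K" shows "x \<le> 0"
proof (rule field_le_epsilon)
  fix d :: real assume d: "0 < d"
  have "x \<le> K * (d / (K + 1))" using assms(2) d by (intro assms(1)) simp
  also have "\<dots> \<le> d" using assms(2) d by (simp add: field_simps)
  finally show "x \<le> 0 + d" by simp
qed

lemma commute_A:
  assumes z: "bounded_op z" and zL: "\<And>k. op_mult z (L k) = op_mult (L k) z" and a: "a \<in> A"
  shows "op_mult z a = op_mult a z"
proof -
  have fin: "op_mult z b = op_mult b z" if "b \<in> fin_alg" for b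
    using that
  proof (induction rule: fin_alg_induct)
    case zero show ?case using z by simp
  next
    case (add b g c)
    then show ?case using z
      by (simp add: op_mult_add_right op_mult_add_left op_mult_scale_right op_mult_scale_left zL
          fin_alg_bounded bounded_op_op_scale)
  qed
  have ba: "bounded_op a" using a by auto
  have bd: "bounded_op (op_diff (op_mult z a) (op_mult a z))"
    using z ba by (intro bounded_op_op_add bounded_op_op_scale bounded_op_op_mult)
  have "opnorm (op_diff (op_mult z a) (op_mult a z)) \<le> (2 * opnorm z) * e" if e: "e > 0" for e
  proof -
    obtain b where b: "b \<in> fin_alg" "opnorm (op_diff a b) < e" using A_approxE[OF a e] .
    have bb: "bounded_op b" using b by auto
    have bab: "bounded_op (op_diff a b)" using ba bb by (intro bounded_op_op_add bounded_op_op_scale)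
    have "op_diff (op_mult z a) (op_mult a z) =
        op_diff (op_mult z (op_diff a b)) (op_mult (op_diff a b) z)"
      using z ba bb
      by (simp add: op_mult_add_right op_mult_add_left op_mult_scale_right op_mult_scale_left
          bounded_op_op_scale fin[OF b(1)]) (simp add: fun_eq_iff op_apply_at)
    then have "opnorm (op_diff (op_mult z a) (op_mult a z)) \<le>
        opnorm (op_mult z (op_diff a b)) + opnorm (op_scale (-1) (op_mult (op_diff a b) z))"
      using z bab by (simp only:) (intro opnorm_add_le bounded_op_op_scale bounded_op_op_mult)
    also have "\<dots> \<le> opnorm (op_mult z (op_diff a b)) + opnorm (op_mult (op_diff a b) z)"
      using opnorm_scale_le[OF bounded_op_op_mult[OF bab z], of "-1"] by simp
    also have "\<dots> \<le> opnorm z * opnorm (op_diff a b) + opnorm (op_diff a b) * opnorm z"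
      by (intro add_mono opnorm_mult_le z bab)
    also have "\<dots> = (2 * opnorm z) * opnorm (op_diff a b)" by (simp add: mult.commute)
    also have "\<dots> \<le> (2 * opnorm z) * e"
      using b(2) by (intro mult_left_mono) (simp_all add: opnorm_nonneg z)
    finally show ?thesis .
  qed
  then have "opnorm (op_diff (op_mult z a) (op_mult a z)) \<le> 0"
    by (rule zero_if_le_all) (simp_all add: opnorm_nonneg z)
  then have "op_diff (op_mult z a) (op_mult a z) = op_zero" by (rule opnorm_eq_0[OF bd])
  then show ?thesis by (simp add: fun_eq_iff op_apply_at)
qed

section \<open>The canonical trace and tracial vector states\<close>

definition tau :: "'g opr \<Rightarrow> complex" where
  "tau a = a (delta 0) 0"

lemma tau_add [simp]: "tau (op_add a b) = tau a + tau b"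
  and tau_scale [simp]: "tau (op_scale c a) = c * tau a"
  and tau_zero [simp]: "tau op_zero = 0"
  and tau_one [simp]: "tau (L 0) = 1"
  by (simp_all add: tau_def op_add_apply op_scale_apply op_zero_apply)

lemma cmod_tau_le: "bounded_op a \<Longrightarrow> cmod (tau a) \<le> opnorm a"
  unfolding tau_def by (rule cmod_matrix_entry_le)

text \<open>Both sides are the coefficient of \<open>b\<close> at \<open>- g\<close> times a cocycle
  value, and the two values agree by \<open>sigma_inverse\<close>.\<close>

lemma tau_commute_L:
  assumes "b \<in> A" shows "tau (op_mult (L g) b) = tau (op_mult b (L g))"
proof -
  have e: "b (delta 0) \<in> ell2" using assms by (auto intro: bounded_op_ell2)
  show ?thesis using A_matrix_entry[OF assms, of g 0]
    by (simp add: tau_def op_mult_apply L_apply[OF e] sigma_inverse)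
qed

lemma tau_commute:
  assumes a: "a \<in> A" and b: "b \<in> A" shows "tau (op_mult a b) = tau (op_mult b a)"
proof -
  have bb: "bounded_op b" and ba: "bounded_op a" using a b by auto
  have fin: "tau (op_mult c b) = tau (op_mult b c)" if "c \<in> fin_alg" for c
    using that
  proof (induction rule: fin_alg_induct)
    case zero show ?case using bb by simp
  next
    case (add c g s)
    then show ?case using bb tau_commute_L[OF b]
      by (simp add: op_mult_add_right op_mult_add_left op_mult_scale_right op_mult_scale_left
          fin_alg_bounded bounded_op_op_scale)
  qed
  have "cmod (tau (op_mult a b) - tau (op_mult b a)) \<le> (2 * opnorm b) * e" if e: "e > 0" for e
  proof -
    obtain c where c: "c \<in> fin_alg" "opnorm (op_diff a c) < e" using A_approxE[OF a e] .
    have bc: "bounded_op c" using c by auto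
    have bac: "bounded_op (op_diff a c)" using ba bc by (intro bounded_op_op_add bounded_op_op_scale)
    have "tau (op_mult a b) - tau (op_mult b a) = tau (op_mult (op_diff a c) b) - tau (op_mult b (op_diff a c))"
      using ba bb bc fin[OF c(1)]
      by (simp add: op_mult_add_right op_mult_add_left op_mult_scale_right op_mult_scale_left bounded_op_op_scale)
    then have "cmod (tau (op_mult a b) - tau (op_mult b a)) \<le>
        cmod (tau (op_mult (op_diff a c) b)) + cmod (tau (op_mult b (op_diff a c)))"
      by (simp only: norm_triangle_ineq4)
    also have "\<dots> \<le> opnorm (op_mult (op_diff a c) b) + opnorm (op_mult b (op_diff a c))"
      by (intro add_mono cmod_tau_le bounded_op_op_mult bac bb)
    also have "\<dots> \<le> opnorm (op_diff a c) * opnorm b + opnorm b * opnorm (op_diff a c)"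
      by (intro add_mono opnorm_mult_le bb bac)
    also have "\<dots> = (2 * opnorm b) * opnorm (op_diff a c)" by (simp add: mult.commute)
    also have "\<dots> \<le> (2 * opnorm b) * e"
      using c(2) by (intro mult_left_mono) (simp_all add: opnorm_nonneg bb)
    finally show ?thesis .
  qed
  then have "cmod (tau (op_mult a b) - tau (op_mult b a)) \<le> 0"
    by (rule zero_if_le_all) (simp_all add: opnorm_nonneg bb)
  then show ?thesis by simp
qed

definition vector_state :: "'g opr \<Rightarrow> 'g opr \<Rightarrow> complex" where
  "vector_state S = (\<lambda>a. if a \<in> A
     then l2inner (S (delta 0)) (a (S (delta 0))) / of_real ((l2norm (S (delta 0)))\<^sup>2) else 0)"

text \<open>Up to normalization the state is \<open>tau\<close> of \<open>S a S\<close>, that is,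
  the canonical trace weighted by the central element \<open>S\<close> squared. A central weight
  preserves the trace property.\<close>

lemma vector_state_tracial:
  assumes S: "central S" and sa: "adjoint S = S" and nz: "S (delta 0) \<noteq> (\<lambda>_. 0)"
  shows "tracial_state A (vector_state S)"
proof -
  define x where "x = S (delta 0)"
  have SA: "S \<in> A" and comm: "\<And>a. a \<in> A \<Longrightarrow> op_mult S a = op_mult a S" using S by (auto simp: central_def)
  have bS: "bounded_op S" using SA by auto
  have x: "x \<in> ell2" unfolding x_def using bS by (auto intro: bounded_op_ell2)
  define n where "n = (l2norm x)\<^sup>2"
  have "l2norm x \<noteq> 0" using l2norm_eq_0[OF x] nz by (auto simp: x_def)
  then have n: "0 < n" by (simp add: n_def)
  let ?f = "vector_state S"
  have f: "?f a = l2inner x (a x) / of_real n" if "a \<in> A" for a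
    using that by (simp add: vector_state_def x_def n_def)
  have ax: "a x \<in> ell2" if "a \<in> A" for a using that x by (auto intro: bounded_op_ell2)
  have le: "cmod (?f a) \<le> opnorm a" if a: "a \<in> A" for a
  proof -
    have "cmod (l2inner x (a x)) \<le> l2norm x * l2norm (a x)"
      by (rule l2inner_cauchy_schwarz[OF x ax[OF a]])
    also have "\<dots> \<le> l2norm x * (opnorm a * l2norm x)"
      by (intro mult_left_mono opnorm_apply x A_bounded[OF a] l2norm_nonneg)
    also have "\<dots> = opnorm a * n" by (simp add: n_def power2_eq_square)
    finally show ?thesis using n by (simp add: f[OF a] norm_divide divide_le_eq)
  qed
  have tr: "?f (op_mult a b) = ?f (op_mult b a)" if a: "a \<in> A" and b: "b \<in> A" for a b
  proof -
    have key: "l2inner x (op_mult a b x) = tau (op_mult (op_mult S a) (op_mult b S))" if a: "a \<in> A" and b: "b \<in> A" for a b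
    proof -
      have "l2inner (delta 0) (S (op_mult a b x)) = l2inner (adjoint S (delta 0)) (op_mult a b x)"
        using adjoint_props(3)[OF bS ell2_delta ax[OF reduced_twisted.mult[OF a b]]] by simp
      then show ?thesis by (simp add: tau_def op_mult_apply sa x_def)
    qed
    have "tau (op_mult (op_mult S a) (op_mult b S)) = tau (op_mult (op_mult b S) (op_mult S a))"
      using a b SA by (intro tau_commute reduced_twisted.mult)
    also have "\<dots> = tau (op_mult (op_mult S b) (op_mult a S))" by (simp only: comm[OF a] comm[OF b])
    finally show ?thesis
      using key[OF a b] key[OF b a] f reduced_twisted.mult[OF a b] reduced_twisted.mult[OF b a] by simp
  qed
  have one: "?f (L 0) = 1" using n x by (simp add: f l2inner_self n_def)
  show ?thesis unfolding tracial_state_def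
  proof (intro conjI ballI allI impI)
    fix a b c assume a: "a \<in> A"
    show "?f (op_scale c a) = c * ?f a"
      using a by (simp add: f reduced_twisted.scale op_scale_apply l2inner_cmult_right)
    have "l2inner x (op_mult (adjoint a) a x) = of_real ((l2norm (a x))\<^sup>2)"
      using adjoint_inner_right[OF A_bounded[OF a] ax[OF a] x] ax[OF a] by (simp add: op_mult_apply l2inner_self)
    then have "?f (op_mult (adjoint a) a) = of_real ((l2norm (a x))\<^sup>2 / n)"
      using a by (simp add: f reduced_twisted.mult reduced_twisted.adj)
    then show "?f (op_mult (adjoint a) a) \<in> \<real>" "0 \<le> Re (?f (op_mult (adjoint a) a))"
      using n by (simp_all del: of_real_divide)
    assume b: "b \<in> A"
    show "?f (op_add a b) = ?f a + ?f b"
      using a b by (simp add: f reduced_twisted.add op_add_apply l2inner_add_right x ax add_divide_distrib)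
    show "?f (op_mult a b) = ?f (op_mult b a)" by (rule tr[OF a b])
  next
    show "\<exists>K. \<forall>a\<in>A. cmod (?f a) \<le> K * opnorm a" using le by (intro exI[of _ 1]) simp
    show "Sup {cmod (?f a) | a. a \<in> A \<and> opnorm a \<le> 1} = 1"
    proof (rule cSup_eq_maximum)
      show "1 \<in> {cmod (?f a) | a. a \<in> A \<and> opnorm a \<le> 1}"
        using one opnorm_L_le[of 0] by (auto intro!: exI[of _ "L 0"])
      fix t assume "t \<in> {cmod (?f a) | a. a \<in> A \<and> opnorm a \<le> 1}"
      then show "t \<le> 1" using le by fastforce
    qed
  next
    fix a assume "a \<notin> A"
    then show "?f a = 0" by (simp add: vector_state_def)
  qed
qed

lemma central_one: "central (L 0)"
  by (simp add: central_def A_bounded)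

lemma vector_state_one_tracial: "tracial_state A (vector_state (L 0))"
proof (rule vector_state_tracial)
  show "L 0 (delta 0) \<noteq> (\<lambda>_. 0)" by (simp add: delta_nonzero)
qed (simp_all add: central_one)

lemma vector_state_one: "a \<in> A \<Longrightarrow> vector_state (L 0) a = tau a"
  by (simp add: vector_state_def tau_def)

section \<open>Simplicity and uniqueness of the trace\<close>

lemma avg_to_tau:
  assumes kl: "kleppner \<sigma>" and hc: "FC_hypercentral TYPE('g)" and a: "a \<in> A" and e: "e > 0"
  shows "\<exists>\<Phi>\<in>avg. opnorm (op_diff (\<Phi> a) (op_scale (tau a) (L 0))) < e"
proof -
  have e3: "e/3 > 0" using e by simp
  obtain b where b: "b \<in> fin_alg" "opnorm (op_diff a b) < e/3" using A_approxE[OF a e3] .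
  define c where "c = op_diff b (op_scale (tau b) (L 0))"
  have c: "c \<in> fin_alg" unfolding c_def using b by (intro fin_alg_add fin_alg_scale fin_alg_L)
  have "c (delta 0) 0 = tau c" by (simp add: tau_def)
  also have "\<dots> = 0" by (simp add: c_def)
  finally obtain \<Phi> where \<Phi>: "\<Phi> \<in> avg" "opnorm (\<Phi> c) < e/3" using avg_small[OF kl hc c _ e3] by blast
  have bd: "bounded_op a" "bounded_op b" "bounded_op c" using a b c by auto
  have bd': "bounded_op (\<Phi> a)" "bounded_op (\<Phi> b)" "bounded_op (\<Phi> c)" "bounded_op (op_diff a b)"
    using bd avg_bounded[OF \<Phi>(1)] by auto
  have 1: "\<Phi> c = op_diff (\<Phi> b) (op_scale (tau b) (L 0))" unfolding c_def
    using \<Phi>(1) bd by (simp add: avg_add avg_scale avg_one bounded_op_op_scale)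
  have 2: "\<Phi> (op_diff a b) = op_diff (\<Phi> a) (\<Phi> b)"
    using \<Phi>(1) bd by (simp add: avg_add avg_scale bounded_op_op_scale)
  \<comment> \<open>Three errors of size \<open>e/3\<close>: approximating \<open>a\<close> by
    \<open>b\<close>, averaging \<open>b\<close> minus its trace, and replacing \<open>tau b\<close>
    by \<open>tau a\<close>.\<close>
  have eq: "op_diff (\<Phi> a) (op_scale (tau a) (L 0)) =
      op_add (op_add (\<Phi> (op_diff a b)) (\<Phi> c)) (op_scale (- tau (op_diff a b)) (L 0))"
    unfolding 1 2 tau_add tau_scale by (simp add: fun_eq_iff op_apply_at algebra_simps)
  have "opnorm (op_diff (\<Phi> a) (op_scale (tau a) (L 0))) \<le>
      opnorm (op_add (\<Phi> (op_diff a b)) (\<Phi> c)) + opnorm (op_scale (- tau (op_diff a b)) (L 0))"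
    unfolding eq using bd' avg_bounded[OF \<Phi>(1)] by (intro opnorm_add_le bounded_op_op_add bounded_op_op_scale bounded_op_L)
  also have "\<dots> \<le> (opnorm (\<Phi> (op_diff a b)) + opnorm (\<Phi> c)) + cmod (tau (op_diff a b)) * opnorm (L 0)"
    using bd' avg_bounded[OF \<Phi>(1)] opnorm_scale_le[OF bounded_op_L, of "- tau (op_diff a b)" 0]
    by (intro add_mono opnorm_add_le) (simp_all del: tau_add tau_scale)
  also have "\<dots> \<le> (opnorm (op_diff a b) + opnorm (\<Phi> c)) + opnorm (op_diff a b) * 1"
    by (intro add_mono mult_mono avg_opnorm_le[OF \<Phi>(1)] cmod_tau_le bd' opnorm_L_le opnorm_nonneg bounded_op_L order_refl)
  also have "\<dots> < e" using b \<Phi> by simp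
  finally show ?thesis using \<Phi>(1) by blast
qed

lemma one_nonzero: "L 0 \<noteq> op_zero"
proof
  assume "L 0 = op_zero"
  then have "tau (L 0) = tau op_zero" by simp
  then show False by (simp del: L_zero)
qed

lemma tau_adjoint_mult: "bounded_op a \<Longrightarrow> tau (op_mult (adjoint a) a) = of_real ((l2norm (a (delta 0)))\<^sup>2)"
  unfolding tau_def by (simp add: adjoint_mult_self_entry l2inner_self bounded_op_ell2)

theorem kleppner_imp_simple:
  assumes kl: "kleppner \<sigma>" and hc: "FC_hypercentral TYPE('g)"
  shows "simple_alg A"
  unfolding simple_alg_def
proof (intro conjI allI impI)
  show "A \<noteq> {op_zero}" using one_nonzero L_in_A[of 0] by (metis singletonD)
  fix J assume J: "closed_ideal A J"
  show "J = {op_zero} \<or> J = A"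
  proof (cases "J = {op_zero}")
    case False
    moreover have "op_zero \<in> J" using J by (simp add: closed_ideal_def)
    ultimately obtain a where a: "a \<in> J" "a \<noteq> op_zero" by blast
    have aA: "a \<in> A" by (rule closed_idealD(1)[OF J a(1)])
    define b where "b = op_mult (adjoint a) a"
    have b: "b \<in> J" unfolding b_def by (intro closed_idealD(4)[OF J] reduced_twisted.adj aA a)
    have bA: "b \<in> A" by (rule closed_idealD(1)[OF J b])
    have "l2norm (a (delta 0)) \<noteq> 0"
      using A_faithful[OF aA] a(2) l2norm_eq_0[OF bounded_op_ell2[OF A_bounded[OF aA] ell2_delta]] by blast
    then have t: "tau b \<noteq> 0" unfolding b_def tau_adjoint_mult[OF A_bounded[OF aA]] by simp
    have "\<exists>\<Phi>\<in>avg. opnorm (op_diff (\<Phi> b) (op_scale (tau b) (L 0))) < inverse (Suc n)" for n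
      by (rule avg_to_tau[OF kl hc bA]) simp
    then obtain X where X: "\<And>n. X n \<in> avg"
        "\<And>n. opnorm (op_diff (X n b) (op_scale (tau b) (L 0))) < inverse (Suc n)"
      by metis
    have s: "op_scale (tau b) (L 0) \<in> J"
    proof (rule closed_ideal_limit[OF J])
      show "\<forall>n. X n b \<in> J" using avg_ideal[OF J X(1) b] by simp
      show "op_scale (tau b) (L 0) \<in> A" by (intro reduced_twisted.scale L_in_A)
      show "(\<lambda>n. opnorm (op_diff (X n b) (op_scale (tau b) (L 0)))) \<longlonglongrightarrow> 0"
      proof (rule tendsto_sandwich[OF _ _ tendsto_const LIMSEQ_inverse_real_of_nat])
        show "\<forall>\<^sub>F n in sequentially. 0 \<le> opnorm (op_diff (X n b) (op_scale (tau b) (L 0)))"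
          using avg_bounded[OF X(1) A_bounded[OF bA]]
          by (intro always_eventually allI opnorm_nonneg bounded_op_op_add bounded_op_op_scale bounded_op_L)
        show "\<forall>\<^sub>F n in sequentially. opnorm (op_diff (X n b) (op_scale (tau b) (L 0))) \<le> inverse (Suc n)"
          using X(2) by (intro always_eventually allI less_imp_le)
      qed
    qed
    have "op_scale (1 / tau b) (op_scale (tau b) (L 0)) = L 0" using t by (simp add: fun_eq_iff op_apply_at)
    then have one: "L 0 \<in> J" using closed_idealD(3)[OF J s, of "1 / tau b"] by simp
    have "d \<in> J" if d: "d \<in> A" for d
      using closed_idealD(4)[OF J d one] op_mult_L_zero(2)[OF A_bounded[OF d]] by simp
    then show ?thesis using closed_idealD(1)[OF J] by blast
  qed simp
qed

theorem kleppner_imp_unique_trace: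
  assumes kl: "kleppner \<sigma>" and hc: "FC_hypercentral TYPE('g)"
  shows "unique_tracial_state A"
  unfolding unique_tracial_state_def
proof (rule ex1I)
  show "tracial_state A (vector_state (L 0))" by (rule vector_state_one_tracial)
next
  fix \<phi> assume tr: "tracial_state A \<phi>"
  obtain K where K: "\<And>a. a \<in> A \<Longrightarrow> cmod (\<phi> a) \<le> K * opnorm a" using tracial_stateD(5)[OF tr] by blast
  have eq: "\<phi> a = tau a * \<phi> (L 0)" if a: "a \<in> A" for a
  proof -
    have "cmod (\<phi> a - tau a * \<phi> (L 0)) \<le> \<bar>K\<bar> * e" if e: "e > 0" for e
    proof -
      obtain \<Phi> where \<Phi>: "\<Phi> \<in> avg" "opnorm (op_diff (\<Phi> a) (op_scale (tau a) (L 0))) < e"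
        using avg_to_tau[OF kl hc a e] by blast
      have \<Phi>a: "\<Phi> a \<in> A" by (rule avg_A[OF \<Phi>(1) a])
      have sA: "op_scale (tau a) (L 0) \<in> A" by (intro reduced_twisted.scale L_in_A)
      have dA: "op_diff (\<Phi> a) (op_scale (tau a) (L 0)) \<in> A" by (rule A_diff[OF \<Phi>a sA])
      have "\<phi> a - tau a * \<phi> (L 0) = \<phi> (op_diff (\<Phi> a) (op_scale (tau a) (L 0)))"
        unfolding tracial_stateD(1)[OF tr \<Phi>a reduced_twisted.scale[OF sA]] tracial_stateD(2)[OF tr sA]
          tracial_stateD(2)[OF tr L_in_A] avg_trace[OF tr \<Phi>(1) a] by simp
      then have "cmod (\<phi> a - tau a * \<phi> (L 0)) \<le> K * opnorm (op_diff (\<Phi> a) (op_scale (tau a) (L 0)))"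
        using K[OF dA] by simp
      also have "\<dots> \<le> \<bar>K\<bar> * e" using \<Phi>(2) opnorm_nonneg[OF A_bounded[OF dA]] by (intro mult_mono) auto
      finally show ?thesis .
    qed
    then have "cmod (\<phi> a - tau a * \<phi> (L 0)) \<le> 0" by (rule zero_if_le_all) simp_all
    then show ?thesis by simp
  qed
  \<comment> \<open>A tracial state is normalized by its norm, which only gives
    \<open>cmod (\<phi> (L 0)) = 1\<close>. Positivity at \<open>L 0\<close> then fixes the
    phase.\<close>
  have "Sup {cmod (\<phi> a) | a. a \<in> A \<and> opnorm a \<le> 1} = cmod (\<phi> (L 0))"
  proof (rule cSup_eq_maximum)
    show "cmod (\<phi> (L 0)) \<in> {cmod (\<phi> a) | a. a \<in> A \<and> opnorm a \<le> 1}"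
      using opnorm_L_le[of 0] L_in_A by blast
    fix t assume "t \<in> {cmod (\<phi> a) | a. a \<in> A \<and> opnorm a \<le> 1}"
    then obtain a where a: "a \<in> A" "opnorm a \<le> 1" "t = cmod (\<phi> a)" by blast
    then have "cmod (tau a) \<le> 1" using cmod_tau_le[OF A_bounded[OF a(1)]] by simp
    then show "t \<le> cmod (\<phi> (L 0))"
      using a eq[OF a(1)] mult_right_mono[of "cmod (tau a)" 1 "cmod (\<phi> (L 0))"] by (simp add: norm_mult)
  qed
  then have n1: "cmod (\<phi> (L 0)) = 1" using tracial_stateD(6)[OF tr] by simp
  have "op_mult (adjoint (L 0)) (L 0) = L 0" by (rule L_unitary(1))
  then have "\<phi> (L 0) \<in> \<real>" "0 \<le> Re (\<phi> (L 0))"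
    using tracial_stateD(3,4)[OF tr L_in_A[of 0]] by simp_all
  then have one: "\<phi> (L 0) = 1" using n1 by (auto elim!: Reals_cases)
  show "\<phi> = vector_state (L 0)"
  proof
    fix a show "\<phi> a = vector_state (L 0) a"
    proof (cases "a \<in> A")
      case True then show ?thesis using eq[OF True] one by (simp add: vector_state_one)
    next
      case False then show ?thesis using tracial_stateD(8)[OF tr] by (simp add: vector_state_def)
    qed
  qed
qed

end

section \<open>Failure of Kleppner's condition\<close>

context twisted_group
begin

lemma Ad_op_sum:
  assumes "finite I" "\<And>i. i \<in> I \<Longrightarrow> bounded_op (T i)"
  shows "bounded_op (op_sum I T) \<and> Ad g (op_sum I T) = op_sum I (\<lambda>i. Ad g (T i))"
  using assms
proof (induction I rule: finite_induct)
  case (insert i I)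
  then have "bounded_op (op_sum I T)" "Ad g (op_sum I T) = op_sum I (\<lambda>i. Ad g (T i))" "bounded_op (T i)"
    by simp_all
  then show ?case unfolding op_sum_insert[OF insert(1,2)] by (simp add: Ad_add bounded_op_op_add)
qed simp

text \<open>The unitaries multiply only up to phases, but the phases cancel under conjugation, so
  \<open>Ad\<close> is a genuine group action.\<close>

lemma Ad_Ad:
  assumes "bounded_op a" shows "Ad h (Ad k a) = Ad (h + k) a"
proof -
  have adj: "op_mult (adjoint (L k)) (adjoint (L h)) = op_scale (cnj (\<sigma> h k)) (adjoint (L (h + k)))"
    by (simp add: adjoint_op_mult[symmetric] L_mult adjoint_op_scale)
  have "Ad h (Ad k a) = op_mult (op_mult (L h) (L k)) (op_mult a (op_mult (adjoint (L k)) (adjoint (L h))))"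
    by (simp add: Ad_def op_mult_assoc)
  also have "\<dots> = op_scale (\<sigma> h k) (op_scale (cnj (\<sigma> h k)) (Ad (h + k) a))"
    unfolding adj L_mult Ad_def using assms
    by (simp add: op_mult_scale_left op_mult_scale_right op_mult_assoc bounded_op_adjoint bounded_op_op_mult)
  also have "\<dots> = Ad (h + k) a" by (simp add: fun_eq_iff op_apply_at mult.assoc[symmetric])
  finally show ?thesis .
qed

lemma Ad_fixed_commute:
  assumes "bounded_op z" "Ad k z = z" shows "op_mult z (L k) = op_mult (L k) z"
proof -
  have "op_mult (Ad k z) (L k) = op_mult (op_mult (L k) z) (op_mult (adjoint (L k)) (L k))"
    by (simp add: Ad_def op_mult_assoc)
  then show ?thesis using assms by (simp add: L_unitary bounded_op_op_mult)
qed

text \<open>If \<open>h\<close> and \<open>h'\<close> give the same conjugate of \<open>g\<close>,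
  they differ by an element \<open>s\<close> of the centralizer of \<open>g\<close>, and regularity
  says that \<open>Ad s\<close> fixes \<open>L g\<close>. Hence the orbit of \<open>L g\<close> is
  parametrized by the conjugacy class.\<close>

lemma regular_Ad_L_cong:
  assumes reg: "sigma_regular \<sigma> g" and eq: "h + g - h = h' + g - h'"
  shows "Ad h (L g) = Ad h' (L g)"
proof -
  define s where "s = - h + h'"
  have h': "h' = h + s" by (simp add: s_def add.assoc[symmetric])
  have "g + s = - h + (h + g - h) + h'"
    by (simp add: s_def diff_conv_add_uminus add.assoc[symmetric] del: add_uminus_conv_diff)
  also have "\<dots> = s + g" unfolding eq
    by (simp add: s_def diff_conv_add_uminus add.assoc del: add_uminus_conv_diff)
  finally have comm: "g + s = s + g" .
  have sgs: "s + g - s = g" by (simp add: comm[symmetric])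
  have "gamma s g = 1" using reg comm by (simp add: gamma_def sgs sigma_regular_def)
  then have "Ad s (L g) = L g" unfolding Ad_L sgs by (simp add: fun_eq_iff op_apply_at)
  then show ?thesis unfolding h' by (metis Ad_Ad bounded_op_L)
qed

text \<open>The sum over the finitely many conjugates of \<open>L g\<close> is central; it is not scalar, since its coefficient
  at \<open>g\<close> is \<open>1\<close>.\<close>

lemma regular_class_central:
  assumes g: "g \<noteq> 0" and reg: "sigma_regular \<sigma> g" and fin: "finite (conj_class g)"
  shows "\<exists>T\<in>A. (\<forall>k. op_mult T (L k) = op_mult (L k) T) \<and> T (delta 0) g = 1"
proof -
  \<comment> \<open>Taking the orbit as a set of operators discards the repetitions caused by the
    centralizer, so the sum is finite and \<open>L g\<close> occurs in it once.\<close>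
  define Orb where "Orb = range (\<lambda>h. Ad h (L g))"
  have fc: "finite (range (\<lambda>h. h + g - h))" using fin by (simp add: conj_class_def full_SetCompr_eq)
  have Orb: "finite Orb" unfolding Orb_def
    by (rule finite_range_factor[OF fc fc]) (rule regular_Ad_L_cong[OF reg])
  have Orb_fin: "B \<in> fin_alg" if "B \<in> Orb" for B using that by (auto simp: Orb_def fin_alg_Ad)
  define T where "T = op_sum Orb (\<lambda>B. B)"
  have T: "T \<in> fin_alg" unfolding T_def by (rule fin_alg_op_sum[OF Orb Orb_fin])
  have inv: "Ad k T = T" for k
  proof -
    have closed: "Ad k B \<in> Orb" if "B \<in> Orb" for k B using that by (auto simp: Orb_def Ad_Ad)
    have undo: "Ad k (Ad (- k) B) = B" "Ad (- k) (Ad k B) = B" if "B \<in> Orb" for k B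
      using fin_alg_bounded[OF Orb_fin[OF that]] by (simp_all add: Ad_Ad)
    have bij: "bij_betw (Ad k) Orb Orb"
      by (rule bij_betwI[where g = "Ad (- k)"]) (use closed undo in auto)
    have "Ad k T = op_sum Orb (Ad k)"
      unfolding T_def using Ad_op_sum[OF Orb, of "\<lambda>B. B" k] Orb_fin by (simp add: fin_alg_bounded)
    also have "\<dots> = T" unfolding T_def op_sum_def
    proof (intro ext)
      fix f x
      show "(\<Sum>B\<in>Orb. Ad k B f x) = (\<Sum>B\<in>Orb. B f x)"
        by (rule sum.reindex_bij_betw[OF bij, of "\<lambda>B. B f x"])
    qed
    finally show ?thesis .
  qed
  have LgO: "L g \<in> Orb" unfolding Orb_def by (rule range_eqI[of _ _ 0]) simp
  \<comment> \<open>Distinct members of the orbit sit at distinct group elements, so only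
    \<open>L g\<close> contributes at \<open>g\<close>.\<close>
  have "B (delta 0) g = (if B = L g then 1 else 0)" if B: "B \<in> Orb" for B
  proof (cases "B = L g")
    case False
    obtain h where h: "B = Ad h (L g)" using B by (auto simp: Orb_def)
    have "h + g - h \<noteq> g" using regular_Ad_L_cong[OF reg, of h 0] False h by auto
    then have "delta (h + g - h) g = 0" by (auto simp: delta_def)
    then have "B (delta 0) g = 0" unfolding h Ad_L by (simp add: op_apply_at)
    then show ?thesis using False by simp
  qed simp
  then have "T (delta 0) g = (\<Sum>B\<in>Orb. if B = L g then 1 else 0)" unfolding T_def op_sum_def by simp
  then have "T (delta 0) g = 1" using Orb LgO by simp
  moreover have "op_mult T (L k) = op_mult (L k) T" for k
    by (rule Ad_fixed_commute[OF fin_alg_bounded[OF T] inv])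
  ultimately show ?thesis using fin_alg_subset[OF T] by blast
qed

text \<open>The adjoint of \<open>L (- k)\<close> is a unimodular multiple of \<open>L k\<close>, so
  taking adjoints of the commutation with \<open>L (- k)\<close> suffices.\<close>

lemma adjoint_commute_L:
  assumes T: "bounded_op T" and comm: "\<And>k. op_mult T (L k) = op_mult (L k) T"
  shows "op_mult (adjoint T) (L k) = op_mult (L k) (adjoint T)"
proof -
  let ?c = "\<sigma> (- k) k"
  have "op_mult (adjoint T) (adjoint (L (- k))) = op_mult (adjoint (L (- k))) (adjoint T)"
    using arg_cong[OF comm[of "- k"], of adjoint] T by (simp add: adjoint_op_mult)
  then have "op_scale ?c (op_mult (adjoint T) (op_scale (cnj ?c) (L k))) =
      op_scale ?c (op_mult (op_scale (cnj ?c) (L k)) (adjoint T))"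
    by (simp add: adjoint_L)
  then have eq: "op_scale ?c (op_scale (cnj ?c) (op_mult (adjoint T) (L k))) =
      op_scale ?c (op_scale (cnj ?c) (op_mult (L k) (adjoint T)))"
    using T by (simp add: op_mult_scale_right op_mult_scale_left bounded_op_adjoint)
  have cancel: "op_scale ?c (op_scale (cnj ?c) R) = R" for R
    by (simp add: fun_eq_iff op_apply_at mult.assoc[symmetric])
  show ?thesis using eq unfolding cancel .
qed

lemma not_kleppner_central:
  assumes "\<not> kleppner \<sigma>"
  obtains z g where "central z" "adjoint z = z" "g \<noteq> 0" "z (delta 0) g \<noteq> 0"
proof -
  obtain g where g: "g \<noteq> 0" "\<forall>x\<in>conj_class g. sigma_regular \<sigma> x" "finite (conj_class g)"
    using assms unfolding kleppner_def by blast
  then have reg: "sigma_regular \<sigma> g" using conj_class_self by blast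
  obtain T where T: "T \<in> A" "\<And>k. op_mult T (L k) = op_mult (L k) T" "T (delta 0) g = 1"
    using regular_class_central[OF g(1) reg g(3)] by blast
  have bT: "bounded_op T" using T(1) by auto
  have bT': "bounded_op (adjoint T)" using bT by auto
  define z where "z = (\<lambda>c. op_add (op_scale c T) (op_scale (cnj c) (adjoint T)))"
  have central: "central (z c)" for c
  proof -
    have A: "z c \<in> A" unfolding z_def by (intro reduced_twisted.add reduced_twisted.scale reduced_twisted.adj T)
    have "op_mult (z c) (L k) = op_mult (L k) (z c)" for k
      unfolding z_def using bT bT' T(2) adjoint_commute_L[OF bT T(2)]
      by (simp add: op_mult_add_left op_mult_scale_left op_mult_add_right op_mult_scale_right bounded_op_op_scale)
    then show ?thesis unfolding central_def using A commute_A[OF A_bounded[OF A]] by blast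
  qed
  have sa: "adjoint (z c) = z c" for c
    unfolding z_def using bT bT'
    by (simp add: adjoint_op_add adjoint_op_scale adjoint_adjoint bounded_op_op_scale)
      (simp add: fun_eq_iff op_apply_at add.commute)
  have at: "z c (delta 0) g = c + cnj c * adjoint T (delta 0) g" for c
    unfolding z_def by (simp add: op_add_apply op_scale_apply T(3))
  \<comment> \<open>These are twice the real part of \<open>T\<close> and, up to sign, twice its
    imaginary part. With \<open>t\<close> the coefficient of \<open>adjoint T\<close> at
    \<open>g\<close>, their coefficients there are \<open>1 + t\<close> and
    \<open>\<i> * (1 - t)\<close>, which cannot both vanish.\<close>
  have "z 1 (delta 0) g \<noteq> 0 \<or> z \<i> (delta 0) g \<noteq> 0"
  proof (rule ccontr)
    assume "\<not> (z 1 (delta 0) g \<noteq> 0 \<or> z \<i> (delta 0) g \<noteq> 0)"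
    then have z0: "z 1 (delta 0) g = 0" "z \<i> (delta 0) g = 0" by simp_all
    have "adjoint T (delta 0) g = 1" using at[of "\<i>"] z0(2) by simp
    then show False using at[of 1] z0(1) by simp
  qed
  then show thesis using that central sa g(1) by blast
qed

section \<open>Distinct traces from a non-scalar central element\<close>

lemma central_op_add: "central z \<Longrightarrow> central w \<Longrightarrow> central (op_add z w)"
  unfolding central_def
  by (auto simp: reduced_twisted.add op_mult_add_left op_mult_add_right A_bounded)

lemma central_op_scale: "central z \<Longrightarrow> central (op_scale c z)"
  unfolding central_def
  by (auto simp: reduced_twisted.scale op_mult_scale_left op_mult_scale_right A_bounded)

lemma central_op_mult: "central z \<Longrightarrow> central w \<Longrightarrow> central (op_mult z w)"
  unfolding central_def by (metis op_mult_assoc reduced_twisted.mult)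

text \<open>Evaluating at \<open>adjoint (L g)\<close> reads off the coefficient at \<open>g\<close>
  of the square of \<open>S\<close>. The canonical trace vanishes there when
  \<open>g \<noteq> 0\<close>, so uniqueness becomes an equation for this coefficient.\<close>

lemma vector_state_at_adjoint_L:
  assumes S: "central S" and sa: "adjoint S = S"
  shows "vector_state S (adjoint (L g)) = S (S (delta 0)) g / of_real ((l2norm (S (delta 0)))\<^sup>2)"
proof -
  have bS: "bounded_op S" using S by (auto simp: central_def)
  have aA: "adjoint (L g) \<in> A" by (intro reduced_twisted.adj L_in_A)
  note ell = bounded_op_ell2[OF bS ell2_delta[of 0]] bounded_op_ell2[OF bS bounded_op_ell2[OF bS ell2_delta[of 0]]]
  have "op_mult S (adjoint (L g)) (S (delta 0)) = op_mult (adjoint (L g)) S (S (delta 0))"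
    using S aA by (simp add: central_def)
  then have c: "S (adjoint (L g) (S (delta 0))) = adjoint (L g) (S (S (delta 0)))" by (simp add: op_mult_apply)
  have "l2inner (S (delta 0)) (adjoint (L g) (S (delta 0))) = l2inner (delta 0) (S (adjoint (L g) (S (delta 0))))"
    using adjoint_props(3)[OF bS ell2_delta, of "adjoint (L g) (S (delta 0))" 0] ell sa by (simp add: adjoint_props)
  also have "\<dots> = l2inner (L g (delta 0)) (S (S (delta 0)))"
    unfolding c by (rule adjoint_inner_right[OF bounded_op_L ell(2) ell2_delta])
  also have "\<dots> = S (S (delta 0)) g" by simp
  finally show ?thesis using aA by (simp add: vector_state_def)
qed

theorem unique_trace_imp_kleppner:
  assumes "unique_tracial_state A" shows "kleppner \<sigma>"
proof (rule ccontr)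
  assume "\<not> kleppner \<sigma>"
  then obtain z g where z: "central z" "adjoint z = z" "g \<noteq> 0" "z (delta 0) g \<noteq> 0"
    by (rule not_kleppner_central)
  have bz: "bounded_op z" using z by (auto simp: central_def)
  have zz: "z (delta 0) \<in> ell2" using bz by (auto intro: bounded_op_ell2)
  have d0: "delta 0 g = 0" using z(3) by (simp add: delta_def)
  \<comment> \<open>This is the coefficient at \<open>g\<close> of the square of
    \<open>1 + t z\<close>, using \<open>t * t = 1\<close>. Comparing the two signs eliminates the
    term quadratic in \<open>z\<close>.\<close>
  have vanish: "2 * of_real t * z (delta 0) g + z (z (delta 0)) g = 0" if t: "t = 1 \<or> t = -1" for t :: real
  proof -
    define S where "S = op_add (L 0) (op_scale (of_real t) z)"
    have S: "central S" unfolding S_def by (intro central_op_add central_op_scale central_one z)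
    have sa: "adjoint S = S" unfolding S_def using bz z(2)
      by (simp add: adjoint_op_add adjoint_op_scale bounded_op_op_scale)
    have S0: "S (delta 0) = (\<lambda>x. delta 0 x + of_real t * z (delta 0) x)"
      unfolding S_def by (simp add: op_add_apply op_scale_apply)
    have Sz: "S (z (delta 0)) = (\<lambda>x. z (delta 0) x + of_real t * z (z (delta 0)) x)"
      unfolding S_def using zz by (simp add: op_add_apply op_scale_apply)
    have bS: "bounded_op S" using S by (auto simp: central_def)
    have SS: "S (S (delta 0)) = (\<lambda>x. S (delta 0) x + of_real t * S (z (delta 0)) x)"
      using bounded_op_add[OF bS ell2_delta[of 0] ell2_scale[OF zz]] bounded_op_cmult[OF bS zz] unfolding S0[symmetric]
      by (simp add: S0)
    have "S (delta 0) g \<noteq> 0" unfolding S0 using z(3,4) t by (auto simp: delta_def)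
    then have nz: "S (delta 0) \<noteq> (\<lambda>_. 0)" by auto
    have l: "l2norm (S (delta 0)) \<noteq> 0" using l2norm_eq_0[OF bounded_op_ell2[OF bS ell2_delta]] nz by blast
    have "vector_state S = vector_state (L 0)"
      using assms vector_state_tracial[OF S sa nz] vector_state_one_tracial
      unfolding unique_tracial_state_def by blast
    then have "S (S (delta 0)) g / of_real ((l2norm (S (delta 0)))\<^sup>2) = 0"
      using vector_state_at_adjoint_L[OF S sa, of g] vector_state_at_adjoint_L[OF central_one adjoint_L_zero, of g] d0
      by simp
    then have "S (S (delta 0)) g = 0" using l by simp
    moreover have "S (S (delta 0)) g = 2 * of_real t * z (delta 0) g + z (z (delta 0)) g"
      unfolding SS unfolding S0 Sz using t z(3) by (auto simp: delta_def algebra_simps)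
    ultimately show ?thesis by simp
  qed
  from vanish[of 1] vanish[of "-1"] have "4 * z (delta 0) g = 0" by (simp add: algebra_simps)
  then show False using z(4) by simp
qed

section \<open>Closed ideals generated by central elements\<close>

definition closed_ideal_of :: "'g opr \<Rightarrow> 'g opr set" where
  "closed_ideal_of w = {T \<in> A. \<forall>e>0. \<exists>a\<in>A. opnorm (op_diff T (op_mult a w)) < e}"

lemma closed_ideal_ofI:
  assumes "T \<in> A" "0 \<le> K" "\<And>e. e > 0 \<Longrightarrow> \<exists>a\<in>A. opnorm (op_diff T (op_mult a w)) \<le> K * e"
  shows "T \<in> closed_ideal_of w"
  unfolding closed_ideal_of_def
proof (intro CollectI conjI allI impI)
  fix e :: real assume e: "e > 0"
  have "e / (K + 1) > 0" using e assms(2) by simp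
  then obtain a where a: "a \<in> A" "opnorm (op_diff T (op_mult a w)) \<le> K * (e / (K + 1))"
    using assms(3) by blast
  have "K * (e / (K + 1)) < e" using e assms(2) by (simp add: field_simps)
  then show "\<exists>a\<in>A. opnorm (op_diff T (op_mult a w)) < e" using a by force
qed (rule assms(1))

text \<open>The approximants \<open>a w\<close> form a left ideal for any \<open>w\<close>.
  Centrality lets a right factor move past \<open>w\<close>, which makes the closure
  two-sided.\<close>

lemma closed_ideal_of_closed_ideal:
  assumes w: "central w" shows "closed_ideal A (closed_ideal_of w)"
proof -
  let ?I = "closed_ideal_of w"
  have wA: "w \<in> A" and comm: "\<And>a. a \<in> A \<Longrightarrow> op_mult w a = op_mult a w" using w by (auto simp: central_def)
  have bw: "bounded_op w" using wA by auto
  have IA: "x \<in> A" if "x \<in> ?I" for x using that by (simp add: closed_ideal_of_def)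
  have app: "\<exists>a\<in>A. opnorm (op_diff x (op_mult a w)) < e" if "x \<in> ?I" "e > 0" for x e
    using that by (simp add: closed_ideal_of_def)
  have bdiff: "bounded_op (op_diff x (op_mult a w))" if "x \<in> A" "a \<in> A" for x a
    using that wA by (intro bounded_op_op_add bounded_op_op_scale bounded_op_op_mult A_bounded)
  have zero: "op_zero \<in> ?I"
  proof (rule closed_ideal_ofI[where K = 0])
    show "\<exists>a\<in>A. opnorm (op_diff op_zero (op_mult a w)) \<le> 0 * e" for e :: real
      by (rule bexI[of _ op_zero]) simp_all
  qed simp_all
  have add: "op_add x y \<in> ?I" if x: "x \<in> ?I" and y: "y \<in> ?I" for x y
  proof (rule closed_ideal_ofI[where K = 2])
    fix e :: real assume e: "e > 0"
    obtain a where a: "a \<in> A" "opnorm (op_diff x (op_mult a w)) < e" using app[OF x e] by blast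
    obtain b where b: "b \<in> A" "opnorm (op_diff y (op_mult b w)) < e" using app[OF y e] by blast
    have "op_diff (op_add x y) (op_mult (op_add a b) w) = op_add (op_diff x (op_mult a w)) (op_diff y (op_mult b w))"
      unfolding op_mult_add_left by (simp add: fun_eq_iff op_apply_at)
    then have "opnorm (op_diff (op_add x y) (op_mult (op_add a b) w)) \<le>
        opnorm (op_diff x (op_mult a w)) + opnorm (op_diff y (op_mult b w))"
      using opnorm_add_le[OF bdiff[OF IA[OF x] a(1)] bdiff[OF IA[OF y] b(1)]] by simp
    then have "opnorm (op_diff (op_add x y) (op_mult (op_add a b) w)) \<le> 2 * e" using a b by linarith
    then show "\<exists>a\<in>A. opnorm (op_diff (op_add x y) (op_mult a w)) \<le> 2 * e"
      using reduced_twisted.add[OF a(1) b(1)] by blast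
  qed (use IA x y in \<open>simp_all add: reduced_twisted.add\<close>)
  have scale: "op_scale c x \<in> ?I" if x: "x \<in> ?I" for x c
  proof (rule closed_ideal_ofI[where K = "cmod c"])
    fix e :: real assume e: "e > 0"
    obtain a where a: "a \<in> A" "opnorm (op_diff x (op_mult a w)) < e" using app[OF x e] by blast
    have "op_diff (op_scale c x) (op_mult (op_scale c a) w) = op_scale c (op_diff x (op_mult a w))"
      unfolding op_mult_scale_left by (simp add: fun_eq_iff op_apply_at algebra_simps)
    then have "opnorm (op_diff (op_scale c x) (op_mult (op_scale c a) w)) \<le> cmod c * opnorm (op_diff x (op_mult a w))"
      using opnorm_scale_le[OF bdiff[OF IA[OF x] a(1)]] by simp
    also have "\<dots> \<le> cmod c * e" using a(2) by (intro mult_left_mono) simp_all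
    finally show "\<exists>a\<in>A. opnorm (op_diff (op_scale c x) (op_mult a w)) \<le> cmod c * e"
      using reduced_twisted.scale[OF a(1)] by blast
  qed (use IA x in \<open>simp_all add: reduced_twisted.scale\<close>)
  have left: "op_mult b x \<in> ?I" if b: "b \<in> A" and x: "x \<in> ?I" for b x
  proof (rule closed_ideal_ofI[where K = "opnorm b"])
    fix e :: real assume e: "e > 0"
    obtain a where a: "a \<in> A" "opnorm (op_diff x (op_mult a w)) < e" using app[OF x e] by blast
    have "op_diff (op_mult b x) (op_mult (op_mult b a) w) = op_mult b (op_diff x (op_mult a w))"
      using A_bounded[OF b] A_bounded[OF IA[OF x]] A_bounded[OF a(1)] bw
      by (simp add: op_mult_add_right op_mult_scale_right op_mult_assoc bounded_op_op_scale bounded_op_op_mult)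
    then have "opnorm (op_diff (op_mult b x) (op_mult (op_mult b a) w)) \<le> opnorm b * opnorm (op_diff x (op_mult a w))"
      using opnorm_mult_le[OF A_bounded[OF b] bdiff[OF IA[OF x] a(1)]] by simp
    also have "\<dots> \<le> opnorm b * e" using a(2) b by (intro mult_left_mono) (simp_all add: opnorm_nonneg A_bounded)
    finally show "\<exists>a\<in>A. opnorm (op_diff (op_mult b x) (op_mult a w)) \<le> opnorm b * e"
      using reduced_twisted.mult[OF b a(1)] by blast
  qed (use IA x b in \<open>simp_all add: reduced_twisted.mult opnorm_nonneg A_bounded\<close>)
  have right: "op_mult x b \<in> ?I" if b: "b \<in> A" and x: "x \<in> ?I" for b x
  proof (rule closed_ideal_ofI[where K = "opnorm b"])
    fix e :: real assume e: "e > 0"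
    obtain a where a: "a \<in> A" "opnorm (op_diff x (op_mult a w)) < e" using app[OF x e] by blast
    have "op_diff (op_mult x b) (op_mult (op_mult a b) w) = op_mult (op_diff x (op_mult a w)) b"
      by (simp add: op_mult_add_left op_mult_scale_left op_mult_assoc comm[OF b])
    then have "opnorm (op_diff (op_mult x b) (op_mult (op_mult a b) w)) \<le> opnorm (op_diff x (op_mult a w)) * opnorm b"
      using opnorm_mult_le[OF bdiff[OF IA[OF x] a(1)] A_bounded[OF b]] by simp
    also have "\<dots> \<le> e * opnorm b" using a(2) b by (intro mult_right_mono) (simp_all add: opnorm_nonneg A_bounded)
    finally show "\<exists>a\<in>A. opnorm (op_diff (op_mult x b) (op_mult a w)) \<le> opnorm b * e"
      using reduced_twisted.mult[OF a(1) b] by (metis mult.commute)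
  qed (use IA x b in \<open>simp_all add: reduced_twisted.mult opnorm_nonneg A_bounded\<close>)
  have limit: "T \<in> ?I"
    if s: "\<forall>n. s n \<in> ?I" and T: "T \<in> A" and lim: "(\<lambda>n. opnorm (op_diff (s n) T)) \<longlonglongrightarrow> 0" for s T
  proof (rule closed_ideal_ofI[where K = 2])
    fix e :: real assume e: "e > 0"
    have "\<forall>\<^sub>F n in sequentially. opnorm (op_diff (s n) T) < e" using order_tendstoD(2)[OF lim e] .
    then obtain n where n: "opnorm (op_diff (s n) T) < e" by (auto simp: eventually_sequentially)
    obtain a where a: "a \<in> A" "opnorm (op_diff (s n) (op_mult a w)) < e" using app[OF s[rule_format] e] by blast
    have "opnorm (op_diff T (op_mult a w)) \<le> opnorm (op_diff T (s n)) + opnorm (op_diff (s n) (op_mult a w))"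
      using T IA[OF s[rule_format]] a(1) wA by (intro op_diff_triangle bounded_op_op_mult A_bounded)
    also have "\<dots> \<le> 2 * e" using n a(2) op_diff_commute[of T "s n"] by linarith
    finally show "\<exists>a\<in>A. opnorm (op_diff T (op_mult a w)) \<le> 2 * e" using a(1) by blast
  qed (use T in simp_all)
  show ?thesis unfolding closed_ideal_def
    by (intro conjI ballI allI impI subsetI; (elim conjE)?;
        (rule IA zero add scale left right limit; assumption))
qed

text \<open>If the ideal generated by \<open>w\<close> is everything, some product
  \<open>a w\<close> lies within 1/2 of the identity, so it at most halves norms; this bounds
  \<open>w\<close> below and stands in for invertibility.\<close>

lemma simple_central_dichotomy:
  assumes simple: "simple_alg A" and w: "central w"
  shows "w = op_zero \<or> (\<exists>K\<ge>0. \<forall>f\<in>ell2. l2norm f \<le> K * l2norm (w f))"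
proof -
  have wA: "w \<in> A" using w by (simp add: central_def)
  have bw: "bounded_op w" using wA by auto
  have wI: "w \<in> closed_ideal_of w"
  proof (rule closed_ideal_ofI[where K = 0])
    show "\<exists>a\<in>A. opnorm (op_diff w (op_mult a w)) \<le> 0 * e" for e
      by (rule bexI[of _ "L 0"]) (simp_all add: bw)
  qed (simp_all add: wA)
  have "closed_ideal_of w = {op_zero} \<or> closed_ideal_of w = A"
    using simple closed_ideal_of_closed_ideal[OF w] by (simp add: simple_alg_def)
  then show ?thesis
  proof
    assume "closed_ideal_of w = {op_zero}"
    then show ?thesis using wI by blast
  next
    assume "closed_ideal_of w = A"
    then have "L 0 \<in> closed_ideal_of w" by simp
    then have "\<forall>e>0. \<exists>a\<in>A. opnorm (op_diff (L 0) (op_mult a w)) < e" unfolding closed_ideal_of_def by blast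
    then obtain a where a: "a \<in> A" "opnorm (op_diff (L 0) (op_mult a w)) < 1/2"
      by (meson half_gt_zero zero_less_one)
    have ba: "bounded_op a" using a(1) by auto
    have bd: "bounded_op (op_diff (L 0) (op_mult a w))"
      using ba bw by (intro bounded_op_op_add bounded_op_op_scale bounded_op_op_mult bounded_op_L)
    have "l2norm f \<le> (2 * opnorm a) * l2norm (w f)" if f: "f \<in> ell2" for f
    proof -
      have wf: "w f \<in> ell2" using bw f by (rule bounded_op_ell2)
      let ?d = "op_diff (L 0) (op_mult a w) f"
      have "l2norm f = l2norm (\<lambda>x. ?d x + a (w f) x)"
        using f by (simp add: op_add_apply op_scale_apply op_mult_apply)
      also have "\<dots> \<le> l2norm ?d + l2norm (a (w f))"
        by (rule l2norm_triangle[OF bounded_op_ell2[OF bd f] bounded_op_ell2[OF ba wf]])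
      also have "\<dots> \<le> opnorm (op_diff (L 0) (op_mult a w)) * l2norm f + opnorm a * l2norm (w f)"
        by (intro add_mono opnorm_apply bd ba f wf)
      also have "\<dots> \<le> 1/2 * l2norm f + opnorm a * l2norm (w f)"
        using a(2) by (intro add_mono mult_right_mono) simp_all
      finally show ?thesis by simp
    qed
    then show ?thesis using opnorm_nonneg[OF ba] by (intro disjI2 exI[of _ "2 * opnorm a"]) simp
  qed
qed

text \<open>A self-adjoint \<open>z\<close> of norm \<open>r\<close> nearly attains its norm, so \<open>z\<^sup>2 - r\<^sup>2\<close> is not bounded below; in a
  simple algebra this forces \<open>z\<^sup>2 = r\<^sup>2\<close> for central \<open>z\<close>, and then \<open>z\<close> is scalar.\<close>

theorem simple_imp_kleppner:
  assumes simple: "simple_alg A" shows "kleppner \<sigma>"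
proof (rule ccontr)
  assume "\<not> kleppner \<sigma>"
  then obtain z g where z: "central z" "adjoint z = z" "g \<noteq> 0" "z (delta 0) g \<noteq> 0"
    by (rule not_kleppner_central)
  have bz: "bounded_op z" using z by (auto simp: central_def)
  define r where "r = opnorm z"
  have r: "0 < r" using cmod_matrix_entry_le[OF bz, of 0 g] z(4) unfolding r_def
    by (meson less_le_trans zero_less_norm_iff)
  \<comment> \<open>Here \<open>w\<close> is \<open>z^2 - r^2\<close>, which factors as
    \<open>u\<close> times \<open>z + r\<close>.\<close>
  define w where "w = op_add (op_mult z z) (op_scale (- of_real (r\<^sup>2)) (L 0))"
  define u where "u = op_add z (op_scale (- of_real r) (L 0))"
  have cw: "central w" unfolding w_def by (intro central_op_add central_op_mult central_op_scale central_one z)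
  have cu: "central u" unfolding u_def by (intro central_op_add central_op_scale central_one z)
  have wf: "w f = (\<lambda>x. z (z f) x - of_real (r\<^sup>2) * f x)" if "f \<in> ell2" for f
    unfolding w_def using that by (simp add: op_add_apply op_scale_apply op_mult_apply)
  have uf: "u f = (\<lambda>x. z f x - of_real r * f x)" if "f \<in> ell2" for f
    unfolding u_def using that by (simp add: op_add_apply op_scale_apply)
  have "\<not> (\<exists>K\<ge>0. \<forall>f\<in>ell2. l2norm f \<le> K * l2norm (w f))"
  proof
    assume "\<exists>K\<ge>0. \<forall>f\<in>ell2. l2norm f \<le> K * l2norm (w f)"
    then obtain K where K: "0 \<le> K" "\<And>f. f \<in> ell2 \<Longrightarrow> l2norm f \<le> K * l2norm (w f)" by blast
    \<comment> \<open>A lower bound with constant \<open>K\<close> for \<open>w\<close> would give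
      \<open>(l2norm (z f))^2 \<le> C / (1 + C) * r^2 * (l2norm f)^2\<close>, so the norm of
      \<open>z\<close> would be strictly below \<open>r\<close>.\<close>
    define C where "C = K\<^sup>2 * r\<^sup>2 * r\<^sup>2"
    have C: "0 \<le> C" by (simp add: C_def)
    have "r \<le> sqrt (C * r\<^sup>2 / (1 + C))"
      unfolding r_def
    proof (rule opnorm_le_sq, fold r_def)
      fix f :: "'g vec" assume f: "f \<in> ell2"
      have zf: "z f \<in> ell2" and zzf: "z (z f) \<in> ell2" using bz f by (auto intro: bounded_op_ell2)
      define p where "p = (l2norm (z f))\<^sup>2"
      define q where "q = (l2norm f)\<^sup>2"
      have "l2norm (z (z f)) \<le> r * l2norm (z f)" unfolding r_def by (rule opnorm_apply[OF bz zf])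
      then have zz: "(l2norm (z (z f)))\<^sup>2 \<le> r\<^sup>2 * p"
        using power_mono[of "l2norm (z (z f))" "r * l2norm (z f)" 2] by (simp add: p_def power_mult_distrib)
      have "l2norm (z f) \<le> r * l2norm f" unfolding r_def by (rule opnorm_apply[OF bz f])
      then have zq: "p \<le> r\<^sup>2 * q"
        using power_mono[of "l2norm (z f)" "r * l2norm f" 2] by (simp add: p_def q_def power_mult_distrib)
      have inner: "l2inner (z (z f)) f = of_real p"
        using adjoint_props(3)[OF bz zf f] z(2) by (simp add: l2inner_self zf p_def)
      have "(l2norm (w f))\<^sup>2 = (l2norm (z (z f)))\<^sup>2 - 2 * (r\<^sup>2 * p) + (r\<^sup>2)\<^sup>2 * q"
        unfolding wf[OF f] l2norm_diff_sq[OF zzf ell2_scale[OF f]] l2inner_cmult_right inner l2norm_cmult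
        by (simp add: q_def power_mult_distrib norm_power)
      also have "\<dots> \<le> r\<^sup>2 * (r\<^sup>2 * q - p)" using zz by (simp add: power2_eq_square algebra_simps)
      finally have wle: "(l2norm (w f))\<^sup>2 \<le> r\<^sup>2 * (r\<^sup>2 * q - p)" .
      have "q \<le> K\<^sup>2 * (l2norm (w f))\<^sup>2"
        using power_mono[OF K(2)[OF f], of 2] by (simp add: q_def power_mult_distrib)
      also have "\<dots> \<le> K\<^sup>2 * (r\<^sup>2 * (r\<^sup>2 * q - p))" using wle by (intro mult_left_mono) simp_all
      finally have "r\<^sup>2 * q \<le> r\<^sup>2 * (K\<^sup>2 * (r\<^sup>2 * (r\<^sup>2 * q - p)))" by (intro mult_left_mono) simp_all
      then have "p \<le> C * (r\<^sup>2 * q - p)" using zq by (simp add: C_def mult_ac)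
      then have "p * (1 + C) \<le> C * r\<^sup>2 * q" by (simp add: algebra_simps)
      then have "p \<le> C * r\<^sup>2 * q / (1 + C)" using C by (simp add: le_divide_eq)
      then show "(l2norm (z f))\<^sup>2 \<le> C * r\<^sup>2 / (1 + C) * (l2norm f)\<^sup>2" by (simp add: p_def q_def)
    qed (use C in simp)
    then have "r\<^sup>2 \<le> C * r\<^sup>2 / (1 + C)" using r C power_mono[of r "sqrt (C * r\<^sup>2 / (1 + C))" 2] by simp
    then have "r\<^sup>2 * (1 + C) \<le> C * r\<^sup>2" using C by (simp add: le_divide_eq)
    then have "r\<^sup>2 \<le> 0" by (simp add: algebra_simps)
    then show False using r by simp
  qed
  then have w0: "w = op_zero" using simple_central_dichotomy[OF simple cw] by blast
  have dz: "z (delta 0) \<in> ell2" using bz by (auto intro: bounded_op_ell2)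
  \<comment> \<open>If \<open>u = 0\<close>, then \<open>z\<close> is the scalar \<open>r\<close>.
    Otherwise \<open>u\<close> is injective, and since it annihilates
    \<open>(z + r) \<delta>\<close> this vector is 0. Either way the coefficient of \<open>z\<close>
    at \<open>g\<close> would vanish.\<close>
  consider "u = op_zero" | K where "\<And>f. f \<in> ell2 \<Longrightarrow> l2norm f \<le> K * l2norm (u f)"
    using simple_central_dichotomy[OF simple cu] by blast
  then show False
  proof cases
    case 1
    then have "u (delta 0) g = 0" by (simp add: op_zero_apply)
    then show False using uf[OF ell2_delta, of 0] z(3,4) by (simp add: delta_def)
  next
    case 2
    let ?h = "\<lambda>x. z (delta 0) x + of_real r * delta 0 x"
    have h: "?h \<in> ell2" using dz by (intro ell2_add ell2_scale ell2_delta)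
    have "z ?h = (\<lambda>x. z (z (delta 0)) x + of_real r * z (delta 0) x)"
      using bounded_op_add[OF bz dz ell2_scale[OF ell2_delta[of 0]]] bounded_op_cmult[OF bz ell2_delta] by simp
    then have "u ?h = w (delta 0)"
      unfolding uf[OF h] wf[OF ell2_delta] by (simp add: algebra_simps power2_eq_square)
    then have "u ?h = (\<lambda>x. 0)" using w0 by (simp add: op_zero_apply)
    then have "l2norm ?h = 0" using 2[OF h] l2norm_nonneg[of ?h] by simp
    then have "?h = (\<lambda>x. 0)" by (rule l2norm_eq_0[OF h])
    from fun_cong[OF this, of g] show False using z(3,4) by (simp add: delta_def)
  qed
qed

end

theorem theorem3p1:
  fixes \<sigma> :: "'g::group_add \<Rightarrow> 'g \<Rightarrow> complex"
  assumes "FC_hypercentral TYPE('g)"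
    and "two_cocycle \<sigma>"
  shows "(kleppner \<sigma> \<longleftrightarrow> simple_alg (reduced_twisted \<sigma>))
       \<and> (simple_alg (reduced_twisted \<sigma>) \<longleftrightarrow> unique_tracial_state (reduced_twisted \<sigma>))"
proof -
  interpret twisted_group \<sigma> by unfold_locales (rule assms(2))
  show ?thesis
    using kleppner_imp_simple[OF _ assms(1)] kleppner_imp_unique_trace[OF _ assms(1)]
      simple_imp_kleppner unique_trace_imp_kleppner by blast
qed

end
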